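(* Let $\sigma$ be the surface measure on the unit sphere $S^2\subset\mathbb{R}^3$. The following inequalities hold and they are sharp (i.e. the constants cannot be improved): (i) $\|f\|_{L^2(\sigma)^2}\le2\|W(f)\|_{L^2(\sigma)^2}$ for all $f\in L^2(\sigma)^2$. (ii) $2\pi\|h\|_{L^2(\sigma)}\le\|R_\sigma(h)\|_{L^2(\sigma)^3}$ for all real-valued $h\in L^2(\sigma)$.
   Context: Let $\widetilde\sigma\cdot x=x_1\sigma_1+x_2\sigma_2+x_3\sigma_3$ with the Pauli matrices $\sigma_1=\begin{pmatrix}0&1\\1&0\end{pmatrix}$, $\sigma_2=\begin{pmatrix}0&-i\\i&0\end{pmatrix}$, $\sigma_3=\begin{pmatrix}1&0\\0&-1\end{pmatrix}$. $L^2(\sigma)^2$ denotes the $\mathbb{C}^2$-valued functions in $L^2(\sigma)$. Set $w(x)=(4\pi|x|^3)^{-1}\,i\,\widetilde\sigma\cdot x$ for $x\in\mathbb{R}^3\setminus\{0\}$ and $W(f)(x)=\lim_{\epsilon\searrow0}\int_{|x-z|>\epsilon}w(x-z)f(z)\,d\sigma(z)$ for $x\in S^2$, $f\in L^2(\sigma)^2$. The $2$-dimensional Riesz transform is $R_\sigma(h)(x)=\lim_{\epsilon\searrow0}\int_{|x-y|>\epsilon}\frac{x-y}{|x-y|^3}h(y)\,d\sigma(y)$ for $h\in L^2(\sigma)$. Both limits exist $\sigma$-a.e. and define bounded operators $W:L^2(\sigma)^2\to L^2(\sigma)^2$ and $R_\sigma:L^2(\sigma)\to L^2(\sigma)^3$.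 *)

theory Defs
  imports "HOL-Analysis.Analysis"
begin

text \<open>Surface measure of the unit sphere of \<open>\<real>\<^sup>3\<close>, as a Borel measure on \<open>\<real>\<^sup>3\<close> concentrated on
  the sphere. It is given by the cone formula of polar coordinates,
  \<open>\<sigma>(A) = 3 \<cdot> |{r *\<^sub>R x | 0 < r \<le> 1, x \<in> A}|\<close> for \<open>A\<close> in the sphere, where \<open>|_|\<close> is Lebesgue measure:
  the radial projection \<open>sgn\<close> pushes forward three times Lebesgue measure on the unit ball.
  (\<open>sgn 0 = 0\<close> is a null set and plays no role.)
  The lemmas below identify it as the rotation invariant measure on the sphere of
  total mass \<open>4 * pi\<close>.\<close>

definition sphere_measure :: "(real^3) measure" where
  "sphere_measure = distr (density lborel (\<lambda>x. 3 * indicator (cball 0 1) x)) borel sgn"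

lemma borel_measurable_sgn_vec [measurable]: "(sgn :: real^3 \<Rightarrow> real^3) \<in> borel_measurable borel"
  unfolding sgn_div_norm by measurable

lemma space_sphere_measure [simp]: "space sphere_measure = UNIV"
  and sets_sphere_measure [simp, measurable_cong]: "sets sphere_measure = sets borel"
  by (simp_all add: sphere_measure_def)

lemma emeasure_sphere_measure:
  assumes "A \<in> sets borel"
  shows "emeasure sphere_measure A = 3 * emeasure lborel (sgn -` A \<inter> cball 0 1)"
proof -
  have [measurable]: "sgn -` A \<in> sets borel"
    using measurable_sets[OF borel_measurable_sgn_vec assms] by simp
  have "emeasure sphere_measure A
      = (\<integral>\<^sup>+x. 3 * indicator (cball 0 1) x * indicator (sgn -` A) x \<partial>lborel)"
    using assms by (simp add: sphere_measure_def emeasure_distr)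
      (subst emeasure_density; measurable; simp)
  also have "\<dots> = (\<integral>\<^sup>+x. 3 * indicator (sgn -` A \<inter> cball 0 1) x \<partial>lborel)"
    by (intro nn_integral_cong) (auto simp: indicator_def)
  also have "\<dots> = 3 * emeasure lborel (sgn -` A \<inter> cball 0 1)"
    by (subst nn_integral_cmult_indicator) auto
  finally show ?thesis .
qed

lemma emeasure_sphere_measure_UNIV: "emeasure sphere_measure UNIV = ennreal (4 * pi)"
proof -
  have "emeasure lborel (cball 0 1 :: (real^3) set) = ennreal (4 / 3 * pi)"
    by (simp add: emeasure_cball unit_ball_vol_3)
  then show ?thesis
    by (simp add: emeasure_sphere_measure ennreal_mult'[of 3, symmetric, simplified])
qed

lemma AE_sphere_measure_sphere: "AE x in sphere_measure. x \<in> sphere 0 1"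
proof -
  have "emeasure sphere_measure (- sphere 0 1) = 0"
  proof -
    have "sgn -` (- sphere 0 1) \<inter> cball 0 1 \<subseteq> {0 :: real^3}"
      by (auto simp: norm_sgn split: if_splits)
    then have "emeasure lborel (sgn -` (- sphere 0 1) \<inter> cball 0 1 :: (real^3) set) = 0"
      by (metis emeasure_lborel_singleton emeasure_empty subset_singletonD)
    then show ?thesis
      by (simp add: emeasure_sphere_measure borel_comp)
  qed
  then show ?thesis
    by (intro AE_I[where N = "- sphere 0 1"]) (auto simp: borel_comp)
qed

lemma distr_sphere_measure_orthogonal:
  assumes T: "orthogonal_transformation (T :: real^3 \<Rightarrow> real^3)"
  shows "distr sphere_measure borel T = sphere_measure"
proof (rule measure_eqI)
  fix A assume "A \<in> sets (distr sphere_measure borel T)"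
  then have A [measurable]: "A \<in> sets borel" by simp
  have lin: "linear T" using T by (rule orthogonal_transformation_linear)
  then have T_meas [measurable]: "T \<in> borel_measurable borel"
    by (intro borel_measurable_continuous_onI linear_continuous_on linear_conv_bounded_linear[THEN iffD1])
  have normT: "norm (T x) = norm x" for x
    using T by (simp add: orthogonal_transformation_norm)
  have sgnT: "sgn (T x) = T (sgn x)" for x
    by (simp add: sgn_div_norm normT linear_scale[OF lin])
  define B where "B = sgn -` (T -` A) \<inter> (cball 0 1 :: (real^3) set)"
  have TA: "T -` A \<in> sets borel"
    using measurable_sets[OF T_meas A] by simp
  have B: "B \<in> sets borel" 
    unfolding B_def using measurable_sets[OF borel_measurable_sgn_vec TA] by simp
  have C: "sgn -` A \<inter> cball 0 1 \<in> sets borel"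
    using measurable_sets[OF borel_measurable_sgn_vec A] by simp
  have img: "T ` B = sgn -` A \<inter> cball 0 1"
  proof
    show "T ` B \<subseteq> sgn -` A \<inter> cball 0 1"
      by (auto simp: B_def sgnT normT)
    show "sgn -` A \<inter> cball 0 1 \<subseteq> T ` B"
    proof
      fix y assume y: "y \<in> sgn -` A \<inter> cball 0 1"
      obtain x where "y = T x"
        using orthogonal_transformation_surj[OF T] by (metis surjD)
      with y show "y \<in> T ` B" by (auto simp: B_def sgnT normT)
    qed
  qed
  have "bounded B" unfolding B_def by (meson bounded_Int bounded_cball)
  then have lm: "B \<in> lmeasurable"
    using B by (simp add: bounded_set_imp_lmeasurable)
  have "measure lebesgue (T ` B) = measure lebesgue B" "T ` B \<in> lmeasurable"
    using measure_orthogonal_image[OF T lm] measurable_orthogonal_image[OF T lm] by auto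
  then have "emeasure lebesgue (T ` B) = emeasure lebesgue B"
    using lm by (simp add: emeasure_eq_measure2 fmeasurableD2)
  then have "emeasure lborel (sgn -` A \<inter> cball 0 1) = emeasure lborel B"
    using B C by (simp add: img)
  then show "emeasure (distr sphere_measure borel T) A = emeasure sphere_measure A"
    using A TA by (simp add: emeasure_distr emeasure_sphere_measure B_def)
qed simp


definition L2 :: "'a measure \<Rightarrow> ('a \<Rightarrow> 'b::euclidean_space) set" where
  "L2 M = {f. f \<in> borel_measurable M \<and> integrable M (\<lambda>x. (norm (f x))\<^sup>2)}"

definition L2_norm :: "'a measure \<Rightarrow> ('a \<Rightarrow> 'b::euclidean_space) \<Rightarrow> real" where
  "L2_norm M f = sqrt (LINT x|M. (norm (f x))\<^sup>2)"


definition pauli1 :: "complex^2^2" where "pauli1 = vector [vector [0, 1], vector [1, 0]]"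
definition pauli2 :: "complex^2^2" where "pauli2 = vector [vector [0, - \<i>], vector [\<i>, 0]]"
definition pauli3 :: "complex^2^2" where "pauli3 = vector [vector [1, 0], vector [0, - 1]]"

definition pauli_dot :: "real^3 \<Rightarrow> complex^2^2" where
  "pauli_dot x = (x$1) *\<^sub>R pauli1 + (x$2) *\<^sub>R pauli2 + (x$3) *\<^sub>R pauli3"

text \<open>\<open>mat \<i>\<close> is \<open>\<i>\<close> times the identity matrix.\<close>

definition w_kernel :: "real^3 \<Rightarrow> complex^2^2" where
  "w_kernel x = inverse (4 * pi * norm x ^ 3) *\<^sub>R (mat \<i> ** pauli_dot x)"


text \<open>Both singular integrals are pointwise limits of the truncated integrals. \<open>Lim\<close> is
  unspecified where the limit does not exist; this concerns only a \<open>\<sigma>\<close>-null set when the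
  argument lies in \<open>L2 sphere_measure\<close>.\<close>

definition W_op :: "(real^3 \<Rightarrow> complex^2) \<Rightarrow> real^3 \<Rightarrow> complex^2" where
  "W_op f x = Lim (at_right 0)
     (\<lambda>\<epsilon>. LINT z:{z. \<epsilon> < norm (x - z)}|sphere_measure. w_kernel (x - z) *v f z)"

definition riesz_transform :: "(real^3 \<Rightarrow> real) \<Rightarrow> real^3 \<Rightarrow> real^3" where
  "riesz_transform h x = Lim (at_right 0)
     (\<lambda>\<epsilon>. LINT y:{y. \<epsilon> < norm (x - y)}|sphere_measure.
        h y *\<^sub>R (inverse (norm (x - y) ^ 3) *\<^sub>R (x - y)))"

end

theory Submission
  imports Defs
begin

text \<open>
  Clifford multiplication \<open>clif x = \<i> (\<sigma> \<cdot> x)\<close> satisfies \<open>clif x \<circ> clif x = - |x|\<^sup>2\<close>. The Cauchy integrals over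
  the sphere for the Dirac operator of the ball and of its exterior, read on spheres of radius \<open>r < 1\<close>
  and \<open>1 / r\<close> and normalised by \<open>clif x\<close>, give two self-adjoint families \<open>A\<^sub>r\<close>, \<open>B\<^sub>r\<close> with
  \<open>A\<^sub>r A\<^sub>s = A\<^sub>r\<^sub>s\<close>, \<open>B\<^sub>r B\<^sub>s = B\<^sub>r\<^sub>s\<close>, \<open>A\<^sub>r B\<^sub>s = 0\<close> such that \<open>r A\<^sub>r + B\<^sub>r\<close> is the Poisson semigroup; as
  \<open>r \<rightarrow> 1\<close> they tend to complementary orthogonal projections. The mean of the interior and exterior
  Cauchy integrals is \<open>- clif x (A\<^sub>r - B\<^sub>r) / 2\<close>, and at Lebesgue points it has the same limit as the
  truncated integral over \<open>|x - z| > 1 - r\<close>. Hence \<open>W = - clif x (A\<^sub>1 - B\<^sub>1) / 2\<close> is half an isometry,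
  so (i) is always an equality. For real \<open>h\<close> and a unit spinor \<open>e\<close> one has
  \<open>W (h e) = clif (R h) e / (4 * pi)\<close>, so (ii) is an equality as well.

  The semigroup laws need no spherical harmonics. The operator \<open>\<Gamma> = \<Sum>\<^sub>j clif e\<^sub>j \<partial>\<^sub>j\<close>, with \<open>\<partial>\<^sub>j\<close> the derivative along
  rotations about the \<open>j\<close>-th axis, is symmetric because the measure is rotation invariant, and it acts on
  the kernels as \<open>r d/dr + 2\<close> on \<open>A\<^sub>r\<close> and as \<open>- r d/dr\<close> on \<open>B\<^sub>r\<close>. So the pairings of the kernels obey
  simple differential equations in the radii.
\<close>

text \<open>On spherical harmonics of degree n, \<Gamma> has the eigenvalues -n and n + 1; B_r is
  r^n on the first eigenspace and A_r is r^(n-1) on the second. This is the origin of the shift 2 in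
  the law for A_r and of the weight r in the Poisson semigroup. The isometry rests on (A_r -
  B_r)(A_s - B_s) = A_rs + B_rs = (A_r + B_r)(A_s + B_s). The kernel of the sum is dominated by the
  Poisson kernel, while the difference is the singular object. The obstacle is pointwise
  convergence: the Hilbert space argument yields a limit g of (A_r - B_r) f only along a sequence.
  But (A_s + B_s) g = (A_s - B_s) f for every s, so the singular family applied to f is an
  approximate identity applied to g. A maximal function of plain cap averages then suffices, and no
  maximal singular integral has to be estimated.\<close>

type_synonym spinor = "complex^2"

abbreviation S2 :: "(real^3) set" where "S2 \<equiv> sphere 0 1"
abbreviation sg :: "(real^3) measure" where "sg \<equiv> sphere_measure"

subsection \<open>Clifford multiplication\<close>

definition clif :: "real^3 \<Rightarrow> spinor \<Rightarrow> spinor" where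
  "clif x v = (mat \<i> ** pauli_dot x) *v v"

lemma clif_nth:
  "clif x v $ 1 = \<i> * (of_real (x$3) * v$1 + (of_real (x$1) - \<i> * of_real (x$2)) * v$2)"
  "clif x v $ 2 = \<i> * ((of_real (x$1) + \<i> * of_real (x$2)) * v$1 - of_real (x$3) * v$2)"
  by (simp_all add: clif_def matrix_vector_mult_def matrix_matrix_mult_def mat_def sum_2
      pauli_dot_def pauli1_def pauli2_def pauli3_def scaleR_conv_of_real[where 'a=complex] algebra_simps)

lemma bilinear_clif: "bilinear clif"
  by (auto simp: bilinear_def linear_iff vec_eq_iff forall_2 clif_nth scaleR_conv_of_real[where 'a=complex]
      algebra_simps)

text \<open>The factor i makes the Hermitian matrix \<sigma> \<cdot> x skew-Hermitian, and
  \<open>\<bullet>\<close> is the real part of the Hermitian product. All adjoints below are taken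
  for this real inner product.\<close>

lemma clif_skew: "clif x v \<bullet> w = - (v \<bullet> clif x w)"
  by (simp add: inner_vec_def sum_2 clif_nth inner_complex_def algebra_simps)

lemma clif_clif: "clif x (clif y v) = - ((x \<bullet> y) *\<^sub>R v) - clif (cross3 x y) v"
  by (simp add: vec_eq_iff forall_2 clif_nth inner_vec_def sum_3 cross_components complex_eq_iff
      algebra_simps)

interpretation clif: bounded_bilinear clif
  using bilinear_clif by (simp add: bilinear_conv_bounded_bilinear)

lemma clif_self: "clif x (clif x v) = - ((norm x)\<^sup>2 *\<^sub>R v)"
  by (simp add: clif_clif power2_norm_eq_inner clif.zero_left)

lemma norm_clif: "norm (clif x v) = norm x * norm v"
proof -
  have "(norm (clif x v))\<^sup>2 = (norm x * norm v)\<^sup>2"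
    by (simp add: power2_norm_eq_inner[of "clif x v"] clif_skew clif_self power_mult_distrib)
      (simp add: power2_norm_eq_inner)
  then show ?thesis by (simp add: power2_eq_iff_nonneg)
qed

lemma w_kernel_mult: "w_kernel x *v v = inverse (4 * pi * norm x ^ 3) *\<^sub>R clif x v"
  unfolding w_kernel_def clif_def
  by (simp add: vec_eq_iff matrix_vector_mult_def scaleR_sum_right)

subsection \<open>Differentiating integrals over the sphere\<close>

lemma finite_measure_sphere_measure: "finite_measure sphere_measure"
  by (rule finite_measureI) (simp add: emeasure_sphere_measure_UNIV)

interpretation sphere: finite_measure sphere_measure
  by (rule finite_measure_sphere_measure)

lemma integrable_sphere_bounded:
  fixes f :: "real^3 \<Rightarrow> 'b::{banach, second_countable_topology}"
  assumes "f \<in> borel_measurable borel" "\<And>x. x \<in> S2 \<Longrightarrow> norm (f x) \<le> K"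
  shows "integrable sg f"
  using assms AE_sphere_measure_sphere
  by (intro sphere.integrable_const_bound[where B = K]) (auto elim!: AE_mp)

lemma integrable_sphere_continuous:
  fixes f :: "real^3 \<Rightarrow> 'b::{banach, second_countable_topology}"
  assumes "f \<in> borel_measurable borel" "continuous_on S2 f"
  shows "integrable sg f"
proof -
  have "bounded (f ` S2)"
    using assms(2) by (intro compact_imp_bounded compact_continuous_image) auto
  then show ?thesis
    using assms(1) by (auto simp: bounded_iff intro: integrable_sphere_bounded)
qed

lemma integral_sphere_cong:
  assumes "\<And>x. x \<in> S2 \<Longrightarrow> f x = g x"
    and "f \<in> borel_measurable borel" "g \<in> borel_measurable borel"
  shows "(LINT x|sg. f x) = (LINT x|sg. g x :: 'b::{banach, second_countable_topology})"
  using assms AE_sphere_measure_sphere by (intro integral_cong_AE) (auto elim!: AE_mp)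

lemma measure_sphere_UNIV: "measure sg UNIV = 4 * pi"
  by (simp add: measure_def emeasure_sphere_measure_UNIV)

lemma integral_sphere_orthogonal:
  fixes f :: "real^3 \<Rightarrow> 'b::{banach, second_countable_topology}"
  assumes T: "orthogonal_transformation T" and f: "f \<in> borel_measurable borel"
  shows "(LINT x|sg. f (T x)) = (LINT x|sg. f x)"
proof -
  have [measurable]: "T \<in> borel_measurable borel"
    using orthogonal_transformation_linear[OF T]
    by (intro borel_measurable_continuous_onI linear_continuous_on linear_conv_bounded_linear[THEN iffD1])
  have "(LINT x|sg. f (T x)) = (LINT x|distr sg borel T. f x)"
    using f by (subst integral_distr) auto
  then show ?thesis
    by (simp add: distr_sphere_measure_orthogonal[OF T])
qed

text \<open>The pointwise derivative is continuous on a compact interval times the sphere, hence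
  bounded there. The mean value inequality turns this bound into a constant dominating the
  difference quotients, and a constant is integrable because the sphere has finite area.\<close>

lemma has_real_derivative_sphere_integral:
  fixes \<Phi> \<Phi>' :: "real \<Rightarrow> real^3 \<Rightarrow> real"
  assumes meas: "\<And>t. \<Phi> t \<in> borel_measurable borel" "\<Phi>' t0 \<in> borel_measurable borel"
    and t0: "t0 \<in> {a<..<b}"
    and int: "\<And>t. t \<in> {a<..<b} \<Longrightarrow> integrable sg (\<Phi> t)"
    and deriv: "\<And>t y. t \<in> {a<..<b} \<Longrightarrow> y \<in> S2 \<Longrightarrow>
      ((\<lambda>t. \<Phi> t y) has_real_derivative \<Phi>' t y) (at t)"
    and cont: "continuous_on ({a<..<b} \<times> S2) (\<lambda>(t, y). \<Phi>' t y)"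
  shows "((\<lambda>t. LINT y|sg. \<Phi> t y) has_real_derivative (LINT y|sg. \<Phi>' t0 y)) (at t0)"
proof -
  obtain d where d: "d > 0" "cball t0 d \<subseteq> {a<..<b}"
    using t0 by (meson open_contains_cball open_greaterThanLessThan)
  have "compact ((\<lambda>(t, y). \<Phi>' t y) ` (cball t0 d \<times> S2))"
    using d by (intro compact_continuous_image continuous_on_subset[OF cont] compact_Times) auto
  then obtain K where "\<forall>p \<in> cball t0 d \<times> S2. \<bar>\<Phi>' (fst p) (snd p)\<bar> \<le> K"
    by (auto dest!: compact_imp_bounded simp: bounded_iff)
  then have K: "\<And>t y. t \<in> cball t0 d \<Longrightarrow> y \<in> S2 \<Longrightarrow> \<bar>\<Phi>' t y\<bar> \<le> K"
    by auto
  have lip: "\<bar>(\<Phi> (t0 + h) y - \<Phi> t0 y) / h\<bar> \<le> K" if h: "\<bar>h\<bar> \<le> d" "h \<noteq> 0" and y: "y \<in> S2" for h y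
  proof -
    have "norm (\<Phi> (t0 + h) y - \<Phi> t0 y) \<le> K * norm (t0 + h - t0)"
    proof (rule field_differentiable_bound[where S = "cball t0 d"])
      show "((\<lambda>t. \<Phi> t y) has_field_derivative \<Phi>' z y) (at z within cball t0 d)"
        if "z \<in> cball t0 d" for z
      proof -
        have "z \<in> {a<..<b}" using that d(2) by blast
        then show ?thesis using deriv y by (blast intro: has_field_derivative_at_within)
      qed
    qed (use K y h d in \<open>auto simp: dist_real_def\<close>)
    then show ?thesis using h by (simp add: field_simps)
  qed
  show ?thesis
    unfolding DERIV_def tendsto_at_iff_sequentially
  proof (intro allI impI, unfold o_def)
    fix X :: "nat \<Rightarrow> real"
    assume X: "\<forall>i. X i \<in> UNIV - {0}" "X \<longlonglongrightarrow> 0"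
    have "\<forall>\<^sub>F n in sequentially. \<bar>X n\<bar> \<le> d"
      using tendstoD[OF X(2) d(1)] by eventually_elim auto
    \<comment> \<open>Dominated convergence asks for the bound at every index, so an initial segment
      of the sequence is dropped and restored at the end.\<close>
    then obtain N where N: "\<And>n. n \<ge> N \<Longrightarrow> \<bar>X n\<bar> \<le> d" by (auto simp: eventually_sequentially)
    have dom: "t0 + X (n + N) \<in> {a<..<b}" for n
      using N[of "n + N"] d by (auto simp: subset_iff dist_real_def)
    have "(\<lambda>n. LINT y|sg. (\<Phi> (t0 + X (n + N)) y - \<Phi> t0 y) / X (n + N)) \<longlonglongrightarrow> (LINT y|sg. \<Phi>' t0 y)"
    proof (rule integral_dominated_convergence[where w = "\<lambda>_. K"])
      show "AE y in sg. (\<lambda>n. (\<Phi> (t0 + X (n + N)) y - \<Phi> t0 y) / X (n + N)) \<longlonglongrightarrow> \<Phi>' t0 y"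
        using AE_sphere_measure_sphere
      proof eventually_elim
        case (elim y)
        have "((\<lambda>h. (\<Phi> (t0 + h) y - \<Phi> t0 y) / h) \<longlongrightarrow> \<Phi>' t0 y) (at 0)"
          using deriv[OF t0 elim] by (simp add: DERIV_def)
        then have "(\<lambda>n. (\<Phi> (t0 + X n) y - \<Phi> t0 y) / X n) \<longlonglongrightarrow> \<Phi>' t0 y"
          using X unfolding tendsto_at_iff_sequentially by (auto simp: o_def)
        then show ?case by (rule LIMSEQ_ignore_initial_segment)
      qed
      show "AE y in sg. norm ((\<Phi> (t0 + X (n + N)) y - \<Phi> t0 y) / X (n + N)) \<le> K" for n
        using AE_sphere_measure_sphere
      proof eventually_elim
        case (elim y)
        then show ?case using lip[of "X (n + N)" y] X N[of "n + N"] by simp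
      qed
    qed (use meas in auto)
    also have "(\<lambda>n. LINT y|sg. (\<Phi> (t0 + X (n + N)) y - \<Phi> t0 y) / X (n + N)) =
      (\<lambda>n. ((LINT y|sg. \<Phi> (t0 + X (n + N)) y) - (LINT y|sg. \<Phi> t0 y)) / X (n + N))"
      using int[OF dom] int[OF t0] by simp
    finally show "(\<lambda>n. ((LINT y|sg. \<Phi> (t0 + X n) y) - (LINT y|sg. \<Phi> t0 y)) / X n)
        \<longlonglongrightarrow> (LINT y|sg. \<Phi>' t0 y)"
      by (rule LIMSEQ_offset)
  qed
qed

section \<open>Rotations and integration by parts on the sphere\<close>

definition rot :: "real^3 \<Rightarrow> real \<Rightarrow> real^3 \<Rightarrow> real^3" where
  "rot e \<tau> y = cos \<tau> *\<^sub>R y + sin \<tau> *\<^sub>R cross3 e y + ((1 - cos \<tau>) * (e \<bullet> y)) *\<^sub>R e"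

interpretation cross3: bounded_bilinear cross3
  using bilinear_cross by (simp add: bilinear_conv_bounded_bilinear)

lemma cross3_cross3_unit:
  assumes "norm e = 1" shows "cross3 e (cross3 e y) = (e \<bullet> y) *\<^sub>R e - y"
  using assms by (simp add: Lagrange norm_eq_1)

text \<open>\<open>rot\<close> is Rodrigues' formula for the rotation by the angle \<tau> about the
  axis \<open>e\<close>. Expanding the squared norm only needs that \<open>cross3 e y\<close> is
  orthogonal to \<open>e\<close> and \<open>y\<close> and has squared length |y|^2 - (e \<bullet>
  y)^2.\<close>

lemma orthogonal_rot:
  assumes e: "norm e = 1"
  shows "orthogonal_transformation (rot e \<tau>)"
proof -
  have lin: "linear (rot e \<tau>)"
    by (rule linearI) (simp_all add: rot_def cross3.add_right cross3.scaleR_right algebra_simps)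
  have "(norm (rot e \<tau> y))\<^sup>2 = (norm y)\<^sup>2" for y
  proof -
    define p where "p = e \<bullet> y"
    have e1: "e \<bullet> e = 1" using e by (simp add: norm_eq_1)
    have 1: "cross3 e y \<bullet> cross3 e y = y \<bullet> y - p\<^sup>2"
      using norm_cross[of e y] e by (simp add: power2_norm_eq_inner p_def)
    have 2: "y \<bullet> cross3 e y = 0" "cross3 e y \<bullet> y = 0" "e \<bullet> cross3 e y = 0" "cross3 e y \<bullet> e = 0"
      by (simp_all add: dot_cross_self inner_commute)
    have "(norm (rot e \<tau> y))\<^sup>2 = (cos \<tau>)\<^sup>2 * (y \<bullet> y) + (sin \<tau>)\<^sup>2 * (y \<bullet> y - p\<^sup>2)
      + 2 * cos \<tau> * (1 - cos \<tau>) * p\<^sup>2 + (1 - cos \<tau>)\<^sup>2 * p\<^sup>2"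
      unfolding power2_norm_eq_inner rot_def
      by (simp add: inner_add_left inner_add_right 1 2 e1 p_def[symmetric] inner_commute[of y e])
        (simp add: power2_eq_square algebra_simps)
    also have "\<dots> = y \<bullet> y"
      unfolding sin_squared_eq by (simp add: power2_eq_square algebra_simps)
    finally show ?thesis by (simp add: power2_norm_eq_inner)
  qed
  then show ?thesis
    using lin by (simp add: orthogonal_transformation power2_eq_iff_nonneg)
qed

lemma rot_0: "rot e 0 y = y"
  by (simp add: rot_def)

lemma has_vector_derivative_rot:
  assumes e: "norm e = 1"
  shows "((\<lambda>\<tau>. rot e \<tau> y) has_vector_derivative cross3 e (rot e \<tau> y)) (at \<tau> within T)"
proof -
  have *: "cross3 e (rot e \<tau> y) = - sin \<tau> *\<^sub>R y + cos \<tau> *\<^sub>R cross3 e y + (sin \<tau> * (e \<bullet> y)) *\<^sub>R e"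
    by (simp add: rot_def cross3.add_right cross3.diff_right cross3.scaleR_right
        cross3_cross3_unit[OF e] algebra_simps)
  show ?thesis
    unfolding *
    by (unfold rot_def) (auto intro!: derivative_eq_intros simp: has_real_derivative_iff_has_vector_derivative[symmetric]
        algebra_simps)
qed

text \<open>By invariance, the integral of \<Psi> composed with the rotation by \<tau> is constant
  in \<tau>; the claim is its derivative at angle 0. Applied to products, this is integration by
  parts on the sphere, with neither charts nor boundary terms.\<close>

lemma integral_rotation_derivative:
  fixes \<Psi> :: "real^3 \<Rightarrow> real"
  assumes e: "norm e = 1"
    and meas: "\<Psi> \<in> borel_measurable borel" "(\<lambda>y. \<Psi>' y (cross3 e y)) \<in> borel_measurable borel"
    and deriv: "\<And>y. y \<in> S2 \<Longrightarrow> (\<Psi> has_derivative \<Psi>' y) (at y)"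
    and cont: "continuous_on S2 (\<lambda>y. \<Psi>' y (cross3 e y))"
  shows "(LINT y|sg. \<Psi>' y (cross3 e y)) = 0"
proof -
  have normrot: "norm (rot e \<tau> y) = norm y" for \<tau> y
    using orthogonal_rot[OF e] by (simp add: orthogonal_transformation_norm)
  have [measurable]: "rot e \<tau> \<in> borel_measurable borel" for \<tau>
    using orthogonal_transformation_linear[OF orthogonal_rot[OF e]]
    by (intro borel_measurable_continuous_onI linear_continuous_on linear_conv_bounded_linear[THEN iffD1])
  have [measurable]: "\<Psi> \<in> borel_measurable borel" by fact
  have "continuous_on S2 \<Psi>"
    using deriv by (intro continuous_at_imp_continuous_on ballI has_derivative_continuous) blast
  moreover have "continuous_on S2 (rot e \<tau>)" "rot e \<tau> ` S2 \<subseteq> S2" for \<tau>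
    using orthogonal_transformation_linear[OF orthogonal_rot[OF e, of \<tau>]]
    by (auto simp: normrot linear_continuous_on linear_conv_bounded_linear)
  ultimately have int: "integrable sg (\<lambda>y. \<Psi> (rot e \<tau> y))" for \<tau>
    by (intro integrable_sphere_continuous continuous_on_compose2[of S2 \<Psi> S2 "rot e \<tau>"]) auto
  have crot: "continuous_on A (\<lambda>(\<tau>, y). rot e \<tau> y)" for A
    unfolding rot_def case_prod_beta
    by (intro continuous_intros cross3.continuous_on)
  have "((\<lambda>t. LINT y|sg. \<Psi> (rot e t y)) has_real_derivative
      (LINT y|sg. \<Psi>' (rot e 0 y) (cross3 e (rot e 0 y)))) (at 0)"
  proof (rule has_real_derivative_sphere_integral[where a = "-1" and b = 1])
    show "((\<lambda>t. \<Psi> (rot e t y)) has_real_derivative \<Psi>' (rot e t y) (cross3 e (rot e t y))) (at t)"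
      if "y \<in> S2" for t y
    proof -
      have "(\<Psi> has_derivative \<Psi>' (rot e t y)) (at (rot e t y) within range (\<lambda>t. rot e t y))"
        using deriv that by (auto simp: normrot intro: has_derivative_at_withinI)
      from vector_derivative_diff_chain_within[OF has_vector_derivative_rot[OF e] this]
      show ?thesis by (simp add: o_def has_real_derivative_iff_has_vector_derivative)
    qed
    show "continuous_on ({-1<..<1} \<times> S2) (\<lambda>(t, y). \<Psi>' (rot e t y) (cross3 e (rot e t y)))"
      using continuous_on_compose2[OF cont crot, of "{-1<..<1} \<times> S2"]
      by (auto simp: normrot case_prod_beta image_subset_iff)
  qed (use int meas in \<open>auto simp: rot_0\<close>)
  moreover have "(\<lambda>t. LINT y|sg. \<Psi> (rot e t y)) = (\<lambda>t. LINT y|sg. \<Psi> y)"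
    using integral_sphere_orthogonal[OF orthogonal_rot[OF e] meas(1)] by simp
  ultimately show ?thesis
    by (simp add: rot_0 DERIV_unique[OF _ DERIV_const])
qed

subsection \<open>Cauchy and Poisson kernels\<close>

lemma borel_measurable_cross3 [measurable (raw)]:
  assumes "f \<in> borel_measurable M" "g \<in> borel_measurable M"
  shows "(\<lambda>x. cross3 (f x) (g x)) \<in> borel_measurable M"
  using assms by (rule borel_measurable_continuous_Pair)
    (auto intro!: continuous_intros cross3.continuous_on)

lemma borel_measurable_clif [measurable (raw)]:
  assumes "f \<in> borel_measurable M" "g \<in> borel_measurable M"
  shows "(\<lambda>x. clif (f x) (g x)) \<in> borel_measurable M"
  using assms by (rule borel_measurable_continuous_Pair)
    (auto intro!: continuous_intros clif.continuous_on)

definition qd :: "real \<Rightarrow> real^3 \<Rightarrow> real^3 \<Rightarrow> real" where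
  "qd r x y = 1 + r\<^sup>2 - 2 * r * (x \<bullet> y)"

definition kpow :: "real \<Rightarrow> real \<Rightarrow> real^3 \<Rightarrow> real^3 \<Rightarrow> real" where
  "kpow p r x y = qd r x y powr (- p / 2) / (4 * pi)"

text \<open>On the sphere \<open>qd r x y = |r x - y|\<^sup>2\<close>. The kernel \<open>kA\<close> is \<open>clif x\<close> times the Cauchy kernel
  \<open>w (r x - y)\<close>, and \<open>kB\<close> is its conjugate \<open>v \<mapsto> - clif x (kA r x y (clif y v))\<close>, see \<open>kB_clif\<close> below.\<close>

definition kA :: "real \<Rightarrow> real^3 \<Rightarrow> real^3 \<Rightarrow> spinor \<Rightarrow> spinor" where
  "kA r x y v = kpow 3 r x y *\<^sub>R ((x \<bullet> y - r) *\<^sub>R v + clif (cross3 x y) v)"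

definition kB :: "real \<Rightarrow> real^3 \<Rightarrow> real^3 \<Rightarrow> spinor \<Rightarrow> spinor" where
  "kB r x y v = kpow 3 r x y *\<^sub>R ((1 - r * (x \<bullet> y)) *\<^sub>R v - r *\<^sub>R clif (cross3 x y) v)"

text \<open>The Poisson kernel of the unit ball between the interior point r x and the boundary
  point y; the factor 1 / (4 * pi) inside \<open>kpow\<close> gives it total mass one.\<close>

definition kP :: "real \<Rightarrow> real^3 \<Rightarrow> real^3 \<Rightarrow> real" where
  "kP r x y = (1 - r\<^sup>2) * kpow 3 r x y"

text \<open>The terms with \<open>clif (cross3 x y)\<close> have opposite coefficients and cancel,
  so the scalar Poisson kernel splits into two spinor kernels. Through this identity, positivity and
  mass one of \<open>kP\<close> enter the estimates for \<open>kA\<close> and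
  \<open>kB\<close>.\<close>

lemma kP_eq: "kP r x y *\<^sub>R v = r *\<^sub>R kA r x y v + kB r x y v"
  by (simp add: kP_def kA_def kB_def algebra_simps power2_eq_square)

text \<open>For positive r this form is increasing in |x - y|. It gives lower bounds for
  \<open>qd\<close>, and it makes the level sets of the Poisson kernel spherical caps.\<close>

lemma qd_sphere:
  assumes "x \<in> S2" "y \<in> S2"
  shows "qd r x y = (1 - r)\<^sup>2 + r * (norm (x - y))\<^sup>2"
proof -
  have *: "(norm (x - y))\<^sup>2 = 2 - 2 * (x \<bullet> y)"
    using assms by (simp add: power2_norm_eq_inner inner_diff_left inner_diff_right
      inner_commute norm_eq_1)
  show ?thesis unfolding qd_def * by (simp add: power2_diff algebra_simps)
qed

lemma abs_inner_sphere: "x \<in> S2 \<Longrightarrow> y \<in> S2 \<Longrightarrow> \<bar>x \<bullet> y\<bar> \<le> 1"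
  using Cauchy_Schwarz_ineq2[of x y] by simp

lemma qd_pos:
  assumes "x \<in> S2" "y \<in> S2" "\<bar>r\<bar> < 1"
  shows "qd r x y > 0"
proof -
  have "\<bar>r * (x \<bullet> y)\<bar> \<le> \<bar>r\<bar> * 1"
    using abs_inner_sphere[OF assms(1,2)] unfolding abs_mult by (intro mult_left_mono) auto
  then have "(1 - \<bar>r\<bar>)\<^sup>2 \<le> qd r x y"
    by (simp add: qd_def power2_eq_square algebra_simps)
  moreover have "(1 - \<bar>r\<bar>)\<^sup>2 > 0" using assms by simp
  ultimately show ?thesis by linarith
qed

lemma qd_commute: "qd r x y = qd r y x"
  by (simp add: qd_def inner_commute)

lemma kpow_commute: "kpow p r x y = kpow p r y x"
  by (simp add: kpow_def qd_commute[of r x y])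

lemma kP_commute: "kP r x y = kP r y x"
  by (simp add: kP_def kpow_commute[of 3 r x y])

lemma kpow_nonneg [simp]: "kpow p r x y \<ge> 0"
  by (simp add: kpow_def)

lemma kP_nonneg: "\<bar>r\<bar> \<le> 1 \<Longrightarrow> kP r x y \<ge> 0"
  by (simp add: kP_def abs_square_le_1)

lemma kA_adjoint: "kA r y x a \<bullet> b = a \<bullet> kA r x y b"
  by (simp add: kA_def kpow_commute[of 3 r x y] inner_commute[of x y] inner_add_left inner_add_right
      inner_diff_left inner_diff_right
      cross_skew[of x y] clif.minus_left clif_skew)

lemma kB_adjoint: "kB r y x a \<bullet> b = a \<bullet> kB r x y b"
  by (simp add: kB_def kpow_commute[of 3 r x y] inner_commute[of x y] inner_add_left inner_add_right
      inner_diff_left inner_diff_right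
      cross_skew[of x y] clif.minus_left clif_skew)

lemma qd_kpow_5:
  assumes "qd r x y > 0" shows "qd r x y * kpow 5 r x y = kpow 3 r x y"
proof -
  have "qd r x y powr 1 * qd r x y powr (- 5 / 2) = qd r x y powr (- 3 / 2)"
    using assms by (subst powr_add[symmetric]) simp
  then show ?thesis using assms by (simp add: kpow_def)
qed

lemma kpow_deriv_r:
  assumes "qd r x y > 0"
  shows "((\<lambda>r. kpow 3 r x y) has_real_derivative 3 * (x \<bullet> y - r) * kpow 5 r x y) (at r within T)"
  using assms unfolding kpow_def qd_def
  by (auto intro!: derivative_eq_intros simp: field_simps)

lemma kpow_deriv_y:
  assumes "qd r y x > 0"
  shows "((\<lambda>y. kpow 3 r y x) has_derivative (\<lambda>h. (h \<bullet> x) * (3 * r * kpow 5 r y x))) (at y within T)"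
proof -
  have 1: "((\<lambda>y. qd r y x) has_derivative (\<lambda>h. - (2 * r * (h \<bullet> x)))) (at y within T)"
    unfolding qd_def by (auto intro!: derivative_eq_intros)
  have 2: "((\<lambda>q. q powr (- 3 / 2)) has_real_derivative (- 3 / 2) * qd r y x powr (- 5 / 2))
      (at (qd r y x) within (\<lambda>y. qd r y x) ` T)"
    using assms by (auto intro!: derivative_eq_intros)
  have "((\<lambda>y. qd r y x powr (- 3 / 2)) has_derivative
      (\<lambda>h. - (2 * r * (h \<bullet> x)) * ((- 3 / 2) * qd r y x powr (- 5 / 2)))) (at y within T)"
    using has_derivative_in_compose[OF 1 2[unfolded has_field_derivative_def]]
    by (simp add: mult.commute)
  from has_derivative_divide'[OF this has_derivative_const, of "4 * pi"]
  show ?thesis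
    unfolding kpow_def by (simp add: field_simps)
qed

lemma kA_deriv_r:
  assumes "qd r x y > 0"
  shows "((\<lambda>r. kA r x y v) has_vector_derivative
    (3 * (x \<bullet> y - r) * kpow 5 r x y) *\<^sub>R ((x \<bullet> y - r) *\<^sub>R v + clif (cross3 x y) v)
      - kpow 3 r x y *\<^sub>R v) (at r within T)"
proof -
  have "((\<lambda>r. (x \<bullet> y - r) *\<^sub>R v + clif (cross3 x y) v) has_vector_derivative - v) (at r within T)"
    by (auto intro!: derivative_eq_intros)
  from has_vector_derivative_scaleR[OF kpow_deriv_r[OF assms] this]
  show ?thesis unfolding kA_def by (simp add: algebra_simps)
qed

lemma kB_deriv_r:
  assumes "qd r x y > 0"
  shows "((\<lambda>r. kB r x y v) has_vector_derivative
    (3 * (x \<bullet> y - r) * kpow 5 r x y) *\<^sub>R ((1 - r * (x \<bullet> y)) *\<^sub>R v - r *\<^sub>R clif (cross3 x y) v)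
      - kpow 3 r x y *\<^sub>R ((x \<bullet> y) *\<^sub>R v + clif (cross3 x y) v)) (at r within T)"
proof -
  have "((\<lambda>r. (1 - r * (x \<bullet> y)) *\<^sub>R v - r *\<^sub>R clif (cross3 x y) v) has_vector_derivative
      - ((x \<bullet> y) *\<^sub>R v + clif (cross3 x y) v)) (at r within T)"
    by (auto intro!: derivative_eq_intros simp: has_real_derivative_iff_has_vector_derivative[symmetric])
  from has_vector_derivative_scaleR[OF kpow_deriv_r[OF assms] this]
  show ?thesis unfolding kB_def by (simp add: algebra_simps)
qed

lemma kA_deriv_y:
  assumes "qd r y x > 0"
  shows "((\<lambda>y. kA r y x v) has_derivative
    (\<lambda>h. (h \<bullet> x) *\<^sub>R ((3 * r * kpow 5 r y x) *\<^sub>R ((y \<bullet> x - r) *\<^sub>R v + clif (cross3 y x) v) + kpow 3 r y x *\<^sub>R v)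
      + kpow 3 r y x *\<^sub>R clif (cross3 h x) v)) (at y within T)"
proof -
  have "((\<lambda>y. (y \<bullet> x - r) *\<^sub>R v + clif (cross3 y x) v) has_derivative
      (\<lambda>h. (h \<bullet> x) *\<^sub>R v + clif (cross3 h x) v)) (at y within T)"
    by (auto intro!: derivative_eq_intros
        bounded_linear.has_derivative[OF clif.bounded_linear_left]
        bounded_linear.has_derivative[OF cross3.bounded_linear_left])
  from has_derivative_scaleR[OF kpow_deriv_y[OF assms] this]
  show ?thesis unfolding kA_def by (simp add: algebra_simps)
qed

lemma kB_deriv_y:
  assumes "qd r y x > 0"
  shows "((\<lambda>y. kB r y x v) has_derivative
    (\<lambda>h. (h \<bullet> x) *\<^sub>R ((3 * r * kpow 5 r y x) *\<^sub>R ((1 - r * (y \<bullet> x)) *\<^sub>R v - r *\<^sub>R clif (cross3 y x) v) - (r * kpow 3 r y x) *\<^sub>R v)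
      + (- r * kpow 3 r y x) *\<^sub>R clif (cross3 h x) v)) (at y within T)"
proof -
  have "((\<lambda>y. (1 - r * (y \<bullet> x)) *\<^sub>R v - r *\<^sub>R clif (cross3 y x) v) has_derivative
      (\<lambda>h. - ((r * (h \<bullet> x)) *\<^sub>R v + r *\<^sub>R clif (cross3 h x) v))) (at y within T)"
    by (auto intro!: derivative_eq_intros
        bounded_linear.has_derivative[OF clif.bounded_linear_left]
        bounded_linear.has_derivative[OF cross3.bounded_linear_left])
  from has_derivative_scaleR[OF kpow_deriv_y[OF assms] this]
  show ?thesis unfolding kB_def by (simp add: algebra_simps)
qed

section \<open>The spherical Dirac operator and its action on the kernels\<close>

text \<open>The operator \<open>\<Gamma>\<close> at the point \<open>y\<close>, where \<open>u'\<close> is the derivative of \<open>u\<close> at \<open>y\<close>.\<close>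

definition dirac :: "(real^3 \<Rightarrow> spinor) \<Rightarrow> real^3 \<Rightarrow> spinor" where
  "dirac u' y = clif (axis 1 1) (u' (cross3 (axis 1 1) y)) + clif (axis 2 1) (u' (cross3 (axis 2 1) y))
     + clif (axis 3 1) (u' (cross3 (axis 3 1) y))"

lemma clif_expand: "clif w v = w$1 *\<^sub>R clif (axis 1 1) v + w$2 *\<^sub>R clif (axis 2 1) v + w$3 *\<^sub>R clif (axis 3 1) v"
proof -
  have "w = w$1 *\<^sub>R axis 1 1 + w$2 *\<^sub>R axis 2 1 + w$3 *\<^sub>R axis 3 1"
    by (simp add: vec_eq_iff forall_3 axis_def)
  then show ?thesis
    by (metis clif.add_left clif.scaleR_left)
qed

text \<open>The derivatives of both kernels in their first point have the shape assumed here.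
  Lagrange's formula expands the double cross product; summed over the three axes, it gives
  \<open>clif x (clif y v)\<close> plus three times (y \<bullet> x) v. One of the three cancels
  against the scalar part of the Clifford product, which leaves the 2.\<close>

lemma dirac_linear:
  assumes "\<And>h. u' h = (h \<bullet> x) *\<^sub>R a + k *\<^sub>R clif (cross3 h x) v"
  shows "dirac u' y = clif (cross3 y x) a + k *\<^sub>R ((2 * (y \<bullet> x)) *\<^sub>R v + clif (cross3 y x) v)"
proof -
  have 1: "cross3 (axis j 1) y \<bullet> x = cross3 y x $ j" for j
    by (metis cross_triple inner_axis' inner_commute mult_1 inner_real_def)
  have 2: "cross3 (cross3 (axis j 1) y) x = (x $ j) *\<^sub>R y - (y \<bullet> x) *\<^sub>R axis j 1" for j
  proof -
    have "cross3 (cross3 (axis j 1) y) x = - cross3 x (cross3 (axis j 1) y)" by (rule cross_skew)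
    then show ?thesis by (simp add: Lagrange inner_axis inner_commute)
  qed
  have 3: "clif (axis j 1) (clif (cross3 (cross3 (axis j 1) y) x) v)
      = (x $ j) *\<^sub>R clif (axis j 1) (clif y v) + (y \<bullet> x) *\<^sub>R v" for j
    by (simp add: 2 clif.diff_left clif.diff_right clif.scaleR_left clif.scaleR_right clif_self norm_axis_1)
  have "dirac u' y = clif (cross3 y x) a + k *\<^sub>R (clif x (clif y v) + (3 * (y \<bullet> x)) *\<^sub>R v)"
    unfolding dirac_def assms clif_expand[of "cross3 y x" a] clif_expand[of x "clif y v"]
    by (simp add: 1 3 clif.add_right clif.scaleR_right algebra_simps)
      (simp add: vec_eq_iff scaleR_conv_of_real[where 'a=complex] algebra_simps)
  also have "clif x (clif y v) = - ((y \<bullet> x) *\<^sub>R v) + clif (cross3 y x) v"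
    by (simp add: clif_clif inner_commute cross_skew[of x y] clif.minus_left)
  also have "(3 * (y \<bullet> x)) *\<^sub>R v = (y \<bullet> x) *\<^sub>R v + (2 * (y \<bullet> x)) *\<^sub>R v"
    by (simp flip: scaleR_add_left)
  finally show ?thesis by simp
qed

lemma clif_cross_self:
  assumes "x \<in> S2" "y \<in> S2"
  shows "clif (cross3 y x) (clif (cross3 y x) v) = ((y \<bullet> x)\<^sup>2 - 1) *\<^sub>R v"
proof -
  have *: "(norm (cross3 y x))\<^sup>2 = 1 - (y \<bullet> x)\<^sup>2"
    using assms by (simp add: norm_cross)
  show ?thesis unfolding clif_self * by (simp add: algebra_simps)
qed

definition kA_r :: "real \<Rightarrow> real^3 \<Rightarrow> real^3 \<Rightarrow> spinor \<Rightarrow> spinor" where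
  "kA_r r x y v = (3 * (x \<bullet> y - r) * kpow 5 r x y) *\<^sub>R ((x \<bullet> y - r) *\<^sub>R v + clif (cross3 x y) v)
      - kpow 3 r x y *\<^sub>R v"

definition kB_r :: "real \<Rightarrow> real^3 \<Rightarrow> real^3 \<Rightarrow> spinor \<Rightarrow> spinor" where
  "kB_r r x y v = (3 * (x \<bullet> y - r) * kpow 5 r x y) *\<^sub>R ((1 - r * (x \<bullet> y)) *\<^sub>R v - r *\<^sub>R clif (cross3 x y) v)
      - kpow 3 r x y *\<^sub>R ((x \<bullet> y) *\<^sub>R v + clif (cross3 x y) v)"

definition kA_y :: "real \<Rightarrow> real^3 \<Rightarrow> spinor \<Rightarrow> real^3 \<Rightarrow> real^3 \<Rightarrow> spinor" where
  "kA_y r x v y h = (h \<bullet> x) *\<^sub>R ((3 * r * kpow 5 r y x) *\<^sub>R ((y \<bullet> x - r) *\<^sub>R v + clif (cross3 y x) v) + kpow 3 r y x *\<^sub>R v)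
      + kpow 3 r y x *\<^sub>R clif (cross3 h x) v"

definition kB_y :: "real \<Rightarrow> real^3 \<Rightarrow> spinor \<Rightarrow> real^3 \<Rightarrow> real^3 \<Rightarrow> spinor" where
  "kB_y r x v y h = (h \<bullet> x) *\<^sub>R ((3 * r * kpow 5 r y x) *\<^sub>R ((1 - r * (y \<bullet> x)) *\<^sub>R v - r *\<^sub>R clif (cross3 y x) v) - (r * kpow 3 r y x) *\<^sub>R v)
      + (- r * kpow 3 r y x) *\<^sub>R clif (cross3 h x) v"

text \<open>Both sides are combinations of v and \<open>clif (cross3 y x) v\<close> whose
  coefficients are \<open>kpow 5\<close> times polynomials in r and t = y \<bullet> x:
  \<open>kpow 3\<close> is rewritten as \<open>qd\<close> times \<open>kpow 5\<close>, and the
  square of \<open>clif (cross3 y x)\<close> is t^2 - 1. What remains is a polynomial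
  identity.\<close>

lemma dirac_kA:
  assumes xy: "x \<in> S2" "y \<in> S2" and r: "\<bar>r\<bar> < 1"
  shows "dirac (kA_y r x v y) y = r *\<^sub>R kA_r r y x v + 2 *\<^sub>R kA r y x v"
proof -
  define t K c where "t = y \<bullet> x" and "K = kpow 5 r y x" and "c = clif (cross3 y x) v"
  have k3: "kpow 3 r y x = (1 + r\<^sup>2 - 2 * r * t) * K"
    using qd_kpow_5[OF qd_pos[OF xy(2,1) r]] by (simp add: qd_def K_def t_def)
  have cc: "clif (cross3 y x) c = (t\<^sup>2 - 1) *\<^sub>R v"
    using clif_cross_self[OF xy] by (simp add: c_def t_def)
  note dirac_linear[of "kA_y r x v y", OF kA_y_def, of y]
  also have "clif (cross3 y x) ((3 * r * kpow 5 r y x) *\<^sub>R ((y \<bullet> x - r) *\<^sub>R v + clif (cross3 y x) v) + kpow 3 r y x *\<^sub>R v)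
    = (3 * r * K) *\<^sub>R ((t - r) *\<^sub>R c + (t\<^sup>2 - 1) *\<^sub>R v) + kpow 3 r y x *\<^sub>R c"
    by (simp add: clif.add_right clif.scaleR_right cc flip: c_def K_def t_def)
  finally have "dirac (kA_y r x v y) y = (3 * r * K * (t\<^sup>2 - 1) + 2 * (1 + r\<^sup>2 - 2 * r * t) * K * t) *\<^sub>R v
      + (3 * r * K * (t - r) + 2 * (1 + r\<^sup>2 - 2 * r * t) * K) *\<^sub>R c"
    unfolding k3 by (simp add: vec_eq_iff algebra_simps scaleR_conv_of_real[where 'a=complex] flip: t_def c_def)
  also have "\<dots> = r *\<^sub>R kA_r r y x v + 2 *\<^sub>R kA r y x v"
    unfolding kA_r_def kA_def k3 c_def[symmetric] K_def[symmetric] t_def[symmetric]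
    by (simp add: vec_eq_iff algebra_simps power2_eq_square scaleR_conv_of_real[where 'a=complex])
  finally show ?thesis .
qed

lemma dirac_kB:
  assumes xy: "x \<in> S2" "y \<in> S2" and r: "\<bar>r\<bar> < 1"
  shows "dirac (kB_y r x v y) y = - (r *\<^sub>R kB_r r y x v)"
proof -
  define t K c where "t = y \<bullet> x" and "K = kpow 5 r y x" and "c = clif (cross3 y x) v"
  have k3: "kpow 3 r y x = (1 + r\<^sup>2 - 2 * r * t) * K"
    using qd_kpow_5[OF qd_pos[OF xy(2,1) r]] by (simp add: qd_def K_def t_def)
  have cc: "clif (cross3 y x) c = (t\<^sup>2 - 1) *\<^sub>R v"
    using clif_cross_self[OF xy] by (simp add: c_def t_def)
  note dirac_linear[of "kB_y r x v y", OF kB_y_def, of y]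
  also have "clif (cross3 y x) ((3 * r * kpow 5 r y x) *\<^sub>R ((1 - r * (y \<bullet> x)) *\<^sub>R v - r *\<^sub>R clif (cross3 y x) v) - (r * kpow 3 r y x) *\<^sub>R v)
    = (3 * r * K) *\<^sub>R ((1 - r * t) *\<^sub>R c - r *\<^sub>R (t\<^sup>2 - 1) *\<^sub>R v) - (r * kpow 3 r y x) *\<^sub>R c"
    by (simp only: clif.add_right clif.diff_right clif.scaleR_right cc flip: c_def K_def t_def)
  finally have "dirac (kB_y r x v y) y = (3 * r * K * r * (1 - t\<^sup>2) - 2 * r * (1 + r\<^sup>2 - 2 * r * t) * K * t) *\<^sub>R v
      + (3 * r * K * (1 - r * t) - 2 * r * (1 + r\<^sup>2 - 2 * r * t) * K) *\<^sub>R c"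
    unfolding k3 by (simp add: vec_eq_iff algebra_simps scaleR_conv_of_real[where 'a=complex] flip: t_def c_def)
  also have "\<dots> = - (r *\<^sub>R kB_r r y x v)"
    unfolding kB_r_def k3 c_def[symmetric] K_def[symmetric] t_def[symmetric]
    by (simp add: vec_eq_iff algebra_simps power2_eq_square scaleR_conv_of_real[where 'a=complex])
  finally show ?thesis .
qed

text \<open>The derivative is taken in the ambient space, but measurability and continuity are asked
  only in the directions \<open>cross3 e y\<close>. These are the tangential directions along which
  \<open>dirac\<close> evaluates it.\<close>

definition sphere_smooth :: "(real^3 \<Rightarrow> spinor) \<Rightarrow> (real^3 \<Rightarrow> real^3 \<Rightarrow> spinor) \<Rightarrow> bool" where
  "sphere_smooth u u' \<longleftrightarrow> u \<in> borel_measurable borel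
     \<and> (\<forall>y\<in>S2. (u has_derivative u' y) (at y))
     \<and> (\<forall>e. (\<lambda>y. u' y (cross3 e y)) \<in> borel_measurable borel \<and> continuous_on S2 (\<lambda>y. u' y (cross3 e y)))"

lemma sphere_smooth_continuous:
  assumes "sphere_smooth u u'" shows "continuous_on S2 u"
  using assms unfolding sphere_smooth_def
  by (intro continuous_at_imp_continuous_on ballI has_derivative_continuous) blast

text \<open>Each summand of \<Gamma> composes two skew operators, \<open>clif\<close> of an axis and
  the derivative along the rotations about that axis, and the two commute because the axis is fixed.
  \<open>F j\<close> is the rotational derivative of a scalar product, so it integrates to
  zero.\<close>

lemma dirac_symmetric:
  assumes u: "sphere_smooth u u'" and v: "sphere_smooth v v'"
  shows "(LINT y|sg. dirac (u' y) y \<bullet> v y) = (LINT y|sg. u y \<bullet> dirac (v' y) y)"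
    and "integrable sg (\<lambda>y. dirac (u' y) y \<bullet> v y)"
proof -
  have [measurable]: "u \<in> borel_measurable borel" "v \<in> borel_measurable borel"
    "(\<lambda>y. u' y (cross3 e y)) \<in> borel_measurable borel" "(\<lambda>y. v' y (cross3 e y)) \<in> borel_measurable borel" for e
    using u v by (auto simp: sphere_smooth_def)
  note cont [continuous_intros] = sphere_smooth_continuous[OF u] sphere_smooth_continuous[OF v]
  have cont' [continuous_intros]: "continuous_on S2 (\<lambda>y. u' y (cross3 e y))" "continuous_on S2 (\<lambda>y. v' y (cross3 e y))" for e
    using u v by (auto simp: sphere_smooth_def)
  define F where "F j y = clif (axis j 1) (u' y (cross3 (axis j 1) y)) \<bullet> v y
      + clif (axis j 1) (u y) \<bullet> v' y (cross3 (axis j 1) y)" for j :: 3 and y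
  have F: "(LINT y|sg. F j y) = 0" for j
    unfolding F_def
    by (rule integral_rotation_derivative[where \<Psi> = "\<lambda>y. clif (axis j 1) (u y) \<bullet> v y"
          and \<Psi>' = "\<lambda>y h. clif (axis j 1) (u' y h) \<bullet> v y + clif (axis j 1) (u y) \<bullet> v' y h"])
      (use u v in \<open>auto simp: norm_axis_1 sphere_smooth_def
         intro!: continuous_intros clif.continuous_on derivative_eq_intros
           bounded_linear.has_derivative[OF clif.bounded_linear_right] bounded_linear.continuous_on[OF clif.bounded_linear_right]\<close>)
  have intF: "integrable sg (F j)" for j
    unfolding F_def by (intro integrable_sphere_continuous) (auto intro!: continuous_intros clif.continuous_on)
  show int1: "integrable sg (\<lambda>y. dirac (u' y) y \<bullet> v y)"
    unfolding dirac_def by (intro integrable_sphere_continuous) (auto intro!: continuous_intros clif.continuous_on)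
  have int2: "integrable sg (\<lambda>y. u y \<bullet> dirac (v' y) y)"
    unfolding dirac_def by (intro integrable_sphere_continuous) (auto intro!: continuous_intros clif.continuous_on)
  have "(LINT y|sg. dirac (u' y) y \<bullet> v y) - (LINT y|sg. u y \<bullet> dirac (v' y) y)
      = (LINT y|sg. dirac (u' y) y \<bullet> v y - u y \<bullet> dirac (v' y) y)"
    using int1 int2 by simp
  also have "\<dots> = (LINT y|sg. F 1 y + F 2 y + F 3 y)"
    by (intro Bochner_Integration.integral_cong refl)
      (simp add: F_def dirac_def inner_add_left inner_add_right clif_skew)
  also have "\<dots> = 0"
    using intF F by simp
  finally show "(LINT y|sg. dirac (u' y) y \<bullet> v y) = (LINT y|sg. u y \<bullet> dirac (v' y) y)" by simp
qed

lemma continuous_on_kpow [continuous_intros]: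
  assumes "continuous_on T r" "continuous_on T f" "continuous_on T g"
    and "\<And>t. t \<in> T \<Longrightarrow> f t \<in> S2 \<and> g t \<in> S2 \<and> \<bar>r t\<bar> < 1"
  shows "continuous_on T (\<lambda>t. kpow p (r t) (f t) (g t))"
  unfolding kpow_def
proof (intro continuous_intros)
  show "continuous_on T (\<lambda>t. qd (r t) (f t) (g t))"
    unfolding qd_def by (intro continuous_intros assms)
  show "\<forall>x\<in>T. qd (r x) (f x) (g x) \<noteq> 0"
    using assms(4) qd_pos by (metis less_irrefl)
qed auto

lemma borel_measurable_kpow [measurable (raw)]:
  assumes [measurable]: "r \<in> borel_measurable M" "f \<in> borel_measurable M" "g \<in> borel_measurable M"
  shows "(\<lambda>t. kpow p (r t) (f t) (g t)) \<in> borel_measurable M"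
  unfolding kpow_def qd_def by measurable

lemma borel_measurable_kernels [measurable (raw)]:
  assumes [measurable]: "r \<in> borel_measurable M" "f \<in> borel_measurable M" "g \<in> borel_measurable M" "v \<in> borel_measurable M"
  shows "(\<lambda>t. kA (r t) (f t) (g t) (v t)) \<in> borel_measurable M"
    "(\<lambda>t. kB (r t) (f t) (g t) (v t)) \<in> borel_measurable M"
    "(\<lambda>t. kA_r (r t) (f t) (g t) (v t)) \<in> borel_measurable M"
    "(\<lambda>t. kB_r (r t) (f t) (g t) (v t)) \<in> borel_measurable M"
    "(\<lambda>t. kP (r t) (f t) (g t)) \<in> borel_measurable M"
  unfolding kA_def kB_def kA_r_def kB_r_def kP_def by measurable

lemma continuous_on_kernels [continuous_intros]:
  assumes "continuous_on T r" "continuous_on T f" "continuous_on T g" "continuous_on T v"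
    and "\<And>t. t \<in> T \<Longrightarrow> f t \<in> S2 \<and> g t \<in> S2 \<and> \<bar>r t\<bar> < 1"
  shows "continuous_on T (\<lambda>t. kA (r t) (f t) (g t) (v t))"
    "continuous_on T (\<lambda>t. kB (r t) (f t) (g t) (v t))"
    "continuous_on T (\<lambda>t. kA_r (r t) (f t) (g t) (v t))"
    "continuous_on T (\<lambda>t. kB_r (r t) (f t) (g t) (v t))"
    "continuous_on T (\<lambda>t. kP (r t) (f t) (g t))"
  unfolding kA_def kB_def kA_r_def kB_r_def kP_def
  by (intro continuous_intros clif.continuous_on cross3.continuous_on assms | (use assms(5) in blast))+

lemma sphere_smooth_kA:
  assumes "x \<in> S2" "\<bar>r\<bar> < 1"
  shows "sphere_smooth (\<lambda>y. kA r y x v) (kA_y r x v)"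
  unfolding sphere_smooth_def
proof (intro conjI ballI allI)
  show "continuous_on S2 (\<lambda>y. kA_y r x v y (cross3 e y))" for e
    unfolding kA_y_def using assms by (intro continuous_intros clif.continuous_on cross3.continuous_on) auto
  show "((\<lambda>y. kA r y x v) has_derivative kA_y r x v y) (at y)" if "y \<in> S2" for y
    using kA_deriv_y[OF qd_pos[OF that assms]] unfolding kA_y_def .
qed (unfold kA_y_def, measurable)

lemma sphere_smooth_kB:
  assumes "x \<in> S2" "\<bar>r\<bar> < 1"
  shows "sphere_smooth (\<lambda>y. kB r y x v) (kB_y r x v)"
  unfolding sphere_smooth_def
proof (intro conjI ballI allI)
  show "continuous_on S2 (\<lambda>y. kB_y r x v y (cross3 e y))" for e
    unfolding kB_y_def using assms by (intro continuous_intros clif.continuous_on cross3.continuous_on) auto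
  show "((\<lambda>y. kB r y x v) has_derivative kB_y r x v y) (at y)" if "y \<in> S2" for y
    using kB_deriv_y[OF qd_pos[OF that assms]] unfolding kB_y_def .
qed (unfold kB_y_def, measurable)

lemma sphere_smooth_const: "sphere_smooth (\<lambda>y. v) (\<lambda>y h. 0)"
  by (simp add: sphere_smooth_def)

subsection \<open>Integral identities for the kernels\<close>

definition radial_family :: "(real \<Rightarrow> real^3 \<Rightarrow> spinor) \<Rightarrow> (real \<Rightarrow> real^3 \<Rightarrow> spinor) \<Rightarrow> bool" where
  "radial_family u u' \<longleftrightarrow> (\<forall>r. u r \<in> borel_measurable borel \<and> u' r \<in> borel_measurable borel)
     \<and> (\<forall>r\<in>{-1<..<1}. \<forall>y\<in>S2. ((\<lambda>r. u r y) has_vector_derivative u' r y) (at r))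
     \<and> continuous_on ({-1<..<1} \<times> S2) (\<lambda>(r, y). u r y)
     \<and> continuous_on ({-1<..<1} \<times> S2) (\<lambda>(r, y). u' r y)"

lemma radial_family_kA:
  assumes "x \<in> S2"
  shows "radial_family (\<lambda>r y. kA r y x v) (\<lambda>r y. kA_r r y x v)"
  unfolding radial_family_def
proof (intro conjI allI ballI)
  show "((\<lambda>r. kA r y x v) has_vector_derivative kA_r r y x v) (at r)"
    if "r \<in> {-1<..<1}" "y \<in> S2" for r y
    unfolding kA_r_def by (rule kA_deriv_r[OF qd_pos[OF that(2) assms]]) (use that in auto)
  show "continuous_on ({-1<..<1} \<times> S2) (\<lambda>(r, y). kA r y x v)"
    "continuous_on ({-1<..<1} \<times> S2) (\<lambda>(r, y). kA_r r y x v)"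
    unfolding case_prod_beta using assms by (intro continuous_intros; auto)+
qed measurable

lemma radial_family_kB:
  assumes "x \<in> S2"
  shows "radial_family (\<lambda>r y. kB r y x v) (\<lambda>r y. kB_r r y x v)"
  unfolding radial_family_def
proof (intro conjI allI ballI)
  show "((\<lambda>r. kB r y x v) has_vector_derivative kB_r r y x v) (at r)"
    if "r \<in> {-1<..<1}" "y \<in> S2" for r y
    unfolding kB_r_def by (rule kB_deriv_r[OF qd_pos[OF that(2) assms]]) (use that in auto)
  show "continuous_on ({-1<..<1} \<times> S2) (\<lambda>(r, y). kB r y x v)"
    "continuous_on ({-1<..<1} \<times> S2) (\<lambda>(r, y). kB_r r y x v)"
    unfolding case_prod_beta using assms by (intro continuous_intros; auto)+
qed measurable

lemma radial_family_const: "radial_family (\<lambda>r y. v) (\<lambda>r y. 0)"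
  by (simp add: radial_family_def)

lemma radial_family_slice:
  assumes "radial_family u u'" "\<bar>r\<bar> < 1"
  shows "continuous_on S2 (u r)" "continuous_on S2 (u' r)"
    "u r \<in> borel_measurable borel" "u' r \<in> borel_measurable borel"
proof -
  have "continuous_on S2 (\<lambda>y. case (r, y) of (r, y) \<Rightarrow> u r y)"
    "continuous_on S2 (\<lambda>y. case (r, y) of (r, y) \<Rightarrow> u' r y)"
    by (rule continuous_on_compose2[of "{-1<..<1} \<times> S2" _ S2 "Pair r"];
      use assms in \<open>force simp: radial_family_def intro!: continuous_intros\<close>)+
  then show "continuous_on S2 (u r)" "continuous_on S2 (u' r)" by auto
qed (use assms in \<open>auto simp: radial_family_def\<close>)

text \<open>The two radii move along arbitrary curves. The orthogonality of \<open>kA\<close> and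
  \<open>kB\<close> uses rays through the origin, the semigroup law uses hyperbolas of constant
  product.\<close>

lemma radial_family_pairing_deriv:
  assumes u: "radial_family u u'" and v: "radial_family v v'"
    and t: "t \<in> {a<..<b}"
    and \<rho>: "\<And>t. t \<in> {a<..<b} \<Longrightarrow> (\<rho> has_real_derivative \<rho>' t) (at t)"
      "continuous_on {a<..<b} \<rho>'" "\<And>t. t \<in> {a<..<b} \<Longrightarrow> \<bar>\<rho> t\<bar> < 1"
    and \<sigma>: "\<And>t. t \<in> {a<..<b} \<Longrightarrow> (\<sigma> has_real_derivative \<sigma>' t) (at t)"
      "continuous_on {a<..<b} \<sigma>'" "\<And>t. t \<in> {a<..<b} \<Longrightarrow> \<bar>\<sigma> t\<bar> < 1"
  shows "((\<lambda>t. LINT y|sg. u (\<rho> t) y \<bullet> v (\<sigma> t) y) has_real_derivative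
     (\<rho>' t * (LINT y|sg. u' (\<rho> t) y \<bullet> v (\<sigma> t) y) + \<sigma>' t * (LINT y|sg. u (\<rho> t) y \<bullet> v' (\<sigma> t) y))) (at t)"
proof -
  have meas [measurable]: "u r \<in> borel_measurable borel" "u' r \<in> borel_measurable borel"
    "v r \<in> borel_measurable borel" "v' r \<in> borel_measurable borel" for r
    using u v by (auto simp: radial_family_def)
  have cont\<rho>: "continuous_on {a<..<b} \<rho>" "continuous_on {a<..<b} \<sigma>"
    using \<rho>(1) \<sigma>(1) by (meson DERIV_isCont continuous_at_imp_continuous_on)+
  have cont: "continuous_on ({a<..<b} \<times> S2) (\<lambda>p. w (\<tau> (fst p)) (snd p))"
    if "continuous_on ({-1<..<1} \<times> S2) (\<lambda>(r, y). w r y)" "continuous_on {a<..<b} \<tau>"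
      "\<And>t. t \<in> {a<..<b} \<Longrightarrow> \<bar>\<tau> t\<bar> < 1" for w :: "real \<Rightarrow> real^3 \<Rightarrow> spinor" and \<tau>
  proof -
    have "continuous_on ({a<..<b} \<times> S2) (\<lambda>p. case (\<tau> (fst p), snd p) of (r, y) \<Rightarrow> w r y)"
    proof (rule continuous_on_compose2[OF that(1)])
      show "continuous_on ({a<..<b} \<times> S2) (\<lambda>p. (\<tau> (fst p), snd p))"
        by (intro continuous_intros continuous_on_compose2[OF that(2)]) auto
    qed (use that(3) in \<open>auto simp: abs_less_iff\<close>)
    then show ?thesis by simp
  qed
  have "((\<lambda>t. LINT y|sg. u (\<rho> t) y \<bullet> v (\<sigma> t) y) has_real_derivative
     (LINT y|sg. \<rho>' t * (u' (\<rho> t) y \<bullet> v (\<sigma> t) y) + \<sigma>' t * (u (\<rho> t) y \<bullet> v' (\<sigma> t) y))) (at t)"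
  proof (rule has_real_derivative_sphere_integral[OF _ _ t])
    show "integrable sg (\<lambda>y. u (\<rho> t) y \<bullet> v (\<sigma> t) y)" if "t \<in> {a<..<b}" for t
      using radial_family_slice(1)[OF u \<rho>(3)[OF that]] radial_family_slice(1)[OF v \<sigma>(3)[OF that]]
      by (intro integrable_sphere_continuous) (auto intro!: continuous_intros)
    show "((\<lambda>t. u (\<rho> t) y \<bullet> v (\<sigma> t) y) has_real_derivative
        \<rho>' t * (u' (\<rho> t) y \<bullet> v (\<sigma> t) y) + \<sigma>' t * (u (\<rho> t) y \<bullet> v' (\<sigma> t) y)) (at t)"
      if t: "t \<in> {a<..<b}" and y: "y \<in> S2" for t y
    proof -
      have 1: "((\<lambda>r. u r y) has_vector_derivative u' (\<rho> t) y) (at (\<rho> t))"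
        using u y \<rho>(3)[OF t] by (auto simp: radial_family_def abs_less_iff)
      have 2: "((\<lambda>r. v r y) has_vector_derivative v' (\<sigma> t) y) (at (\<sigma> t))"
        using v y \<sigma>(3)[OF t] by (auto simp: radial_family_def abs_less_iff)
      have 3: "(\<rho> has_vector_derivative \<rho>' t) (at t)" "(\<sigma> has_vector_derivative \<sigma>' t) (at t)"
        using \<rho>(1)[OF t] \<sigma>(1)[OF t] by (simp_all add: has_real_derivative_iff_has_vector_derivative)
      from bounded_bilinear.has_vector_derivative[OF bounded_bilinear_inner
          vector_diff_chain_at[OF 3(1) 1] vector_diff_chain_at[OF 3(2) 2]]
      show ?thesis
        by (simp add: has_real_derivative_iff_has_vector_derivative o_def add.commute)
    qed
    show "continuous_on ({a<..<b} \<times> S2)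
      (\<lambda>(t, y). \<rho>' t * (u' (\<rho> t) y \<bullet> v (\<sigma> t) y) + \<sigma>' t * (u (\<rho> t) y \<bullet> v' (\<sigma> t) y))"
      unfolding case_prod_beta
      using u v \<rho>(3) \<sigma>(3) cont\<rho>
      by (intro continuous_intros cont continuous_on_compose2[OF \<rho>(2)] continuous_on_compose2[OF \<sigma>(2)])
        (auto simp: radial_family_def)
  qed auto
  also have "(LINT y|sg. \<rho>' t * (u' (\<rho> t) y \<bullet> v (\<sigma> t) y) + \<sigma>' t * (u (\<rho> t) y \<bullet> v' (\<sigma> t) y))
      = \<rho>' t * (LINT y|sg. u' (\<rho> t) y \<bullet> v (\<sigma> t) y) + \<sigma>' t * (LINT y|sg. u (\<rho> t) y \<bullet> v' (\<sigma> t) y)"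
  proof -
    note sl = radial_family_slice(1,2)[OF u \<rho>(3)[OF t]] radial_family_slice(1,2)[OF v \<sigma>(3)[OF t]]
    have "integrable sg (\<lambda>y. u' (\<rho> t) y \<bullet> v (\<sigma> t) y)" "integrable sg (\<lambda>y. u (\<rho> t) y \<bullet> v' (\<sigma> t) y)"
      using sl by (auto intro!: integrable_sphere_continuous continuous_intros)
    then show ?thesis by simp
  qed
  finally show ?thesis .
qed

lemma LINT_inner_sphere_linear:
  fixes f g h :: "real^3 \<Rightarrow> spinor"
  assumes "continuous_on S2 f" "continuous_on S2 g" "continuous_on S2 h"
    "f \<in> borel_measurable borel" "g \<in> borel_measurable borel" "h \<in> borel_measurable borel"
  shows "(LINT y|sg. (c *\<^sub>R f y + d *\<^sub>R g y) \<bullet> h y) = c * (LINT y|sg. f y \<bullet> h y) + d * (LINT y|sg. g y \<bullet> h y)"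
proof -
  have "integrable sg (\<lambda>y. f y \<bullet> h y)" "integrable sg (\<lambda>y. g y \<bullet> h y)"
    using assms(1-3) by (auto intro!: integrable_sphere_continuous continuous_intros borel_measurable_inner assms(4-6))
  then show ?thesis by (simp add: inner_add_left)
qed

text \<open>A radial derivative of one factor is traded for \<Gamma> acting on the other factor. If
  that factor is a kernel too, this becomes a radial derivative again, which is how differential
  equations in the radii arise.\<close>

lemma dirac_kA_integral:
  assumes x: "x \<in> S2" and r: "\<bar>r\<bar> < 1" and v: "sphere_smooth v v'"
  shows "r * (LINT y|sg. kA_r r y x a \<bullet> v y) + 2 * (LINT y|sg. kA r y x a \<bullet> v y)
      = (LINT y|sg. kA r y x a \<bullet> dirac (v' y) y)"
proof -
  have [measurable]: "v \<in> borel_measurable borel" using v by (simp add: sphere_smooth_def)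
  have "r * (LINT y|sg. kA_r r y x a \<bullet> v y) + 2 * (LINT y|sg. kA r y x a \<bullet> v y)
    = (LINT y|sg. (r *\<^sub>R kA_r r y x a + 2 *\<^sub>R kA r y x a) \<bullet> v y)"
    using x r sphere_smooth_continuous[OF v]
    by (intro LINT_inner_sphere_linear[symmetric]) (auto intro!: continuous_intros)
  also have "\<dots> = (LINT y|sg. dirac (kA_y r x a y) y \<bullet> v y)"
    using dirac_kA[OF x _ r] dirac_symmetric(2)[OF sphere_smooth_kA[OF x r] v, of a]
    by (intro integral_sphere_cong) (auto dest: borel_measurable_integrable)
  also have "\<dots> = (LINT y|sg. kA r y x a \<bullet> dirac (v' y) y)"
    by (rule dirac_symmetric(1)[OF sphere_smooth_kA[OF x r] v])
  finally show ?thesis .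
qed

lemma dirac_kB_integral:
  assumes x: "x \<in> S2" and r: "\<bar>r\<bar> < 1" and v: "sphere_smooth v v'"
  shows "- r * (LINT y|sg. kB_r r y x a \<bullet> v y) = (LINT y|sg. kB r y x a \<bullet> dirac (v' y) y)"
proof -
  have [measurable]: "v \<in> borel_measurable borel" using v by (simp add: sphere_smooth_def)
  have "- r * (LINT y|sg. kB_r r y x a \<bullet> v y) = (LINT y|sg. (- (r *\<^sub>R kB_r r y x a)) \<bullet> v y)"
    by simp
  also have "\<dots> = (LINT y|sg. dirac (kB_y r x a y) y \<bullet> v y)"
    using dirac_kB[OF x _ r] dirac_symmetric(2)[OF sphere_smooth_kB[OF x r] v, of a]
    by (intro integral_sphere_cong) (auto dest: borel_measurable_integrable)
  also have "\<dots> = (LINT y|sg. kB r y x a \<bullet> dirac (v' y) y)"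
    by (rule dirac_symmetric(1)[OF sphere_smooth_kB[OF x r] v])
  finally show ?thesis .
qed

text \<open>\<open>\<tau>\<^sup>2\<close> times the pairing with radii \<open>\<tau> r\<close> and \<open>\<tau> s\<close> is constant in \<open>\<tau>\<close> and vanishes at \<open>\<tau> = 0\<close>.\<close>

lemma kA_kB_orthogonal:
  assumes x: "x \<in> S2" and z: "z \<in> S2" and r: "\<bar>r\<bar> < 1" and s: "\<bar>s\<bar> < 1"
  shows "(LINT y|sg. kA r y x a \<bullet> kB s y z b) = 0"
proof -
  \<comment> \<open>M lies strictly between both |r|, |s| and 1. The radii \<tau> r / M and \<tau> s
    / M thus stay below one in absolute value for all |\<tau>| < 1, the pair (r, s) is reached at
    the interior parameter \<tau> = M, and \<tau> = 0 is interior as well.\<close>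
  define M where "M = (1 + max \<bar>r\<bar> \<bar>s\<bar>) / 2"
  have M: "0 < M" "M < 1" "\<bar>r\<bar> < M" "\<bar>s\<bar> < M" using r s by (auto simp: M_def)
  define I where "I \<tau> = (LINT y|sg. kA (\<tau> * (r / M)) y x a \<bullet> kB (\<tau> * (s / M)) y z b)" for \<tau>
  have small: "\<bar>\<tau> * (r / M)\<bar> < 1" "\<bar>\<tau> * (s / M)\<bar> < 1" if "\<tau> \<in> {-1<..<1}" for \<tau>
  proof -
    have "\<bar>\<tau>\<bar> * \<bar>c / M\<bar> < 1" if "\<bar>c\<bar> < M" for c
      using mult_strict_mono[of "\<bar>\<tau>\<bar>" 1 "\<bar>c / M\<bar>" 1] \<open>\<tau> \<in> {-1<..<1}\<close> that M by (auto simp: abs_less_iff)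
    then show "\<bar>\<tau> * (r / M)\<bar> < 1" "\<bar>\<tau> * (s / M)\<bar> < 1" using M by (auto simp only: abs_mult)
  qed
  have D0: "((\<lambda>\<tau>. \<tau>\<^sup>2 * I \<tau>) has_real_derivative 0) (at \<tau>)" if \<tau>: "\<tau> \<in> {-1<..<1}" for \<tau>
  proof -
    let ?r = "\<tau> * (r / M)" and ?s = "\<tau> * (s / M)"
    let ?I1 = "LINT y|sg. kA_r ?r y x a \<bullet> kB ?s y z b" and ?I2 = "LINT y|sg. kA ?r y x a \<bullet> kB_r ?s y z b"
    have "(I has_real_derivative (r / M) * ?I1 + (s / M) * ?I2) (at \<tau>)"
      unfolding I_def
      by (rule radial_family_pairing_deriv[OF radial_family_kA[OF x] radial_family_kB[OF z] \<tau>])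
        (use small M in \<open>auto intro!: derivative_eq_intros\<close>)
    from DERIV_mult[OF DERIV_power[OF DERIV_ident, of 2] this]
    have D: "((\<lambda>\<tau>. \<tau>\<^sup>2 * I \<tau>) has_real_derivative \<tau> * (2 * I \<tau> + ?r * ?I1 + ?s * ?I2)) (at \<tau>)"
      by (simp add: power2_eq_square algebra_simps add_divide_distrib)
    have "?r * ?I1 + 2 * I \<tau> = (LINT y|sg. kA ?r y x a \<bullet> dirac (kB_y ?s z b y) y)"
      unfolding I_def by (rule dirac_kA_integral[OF x small(1)[OF \<tau>] sphere_smooth_kB[OF z small(2)[OF \<tau>]]])
    also have "\<dots> = (LINT y|sg. dirac (kB_y ?s z b y) y \<bullet> kA ?r y x a)"
      by (simp add: inner_commute)
    also have "\<dots> = (LINT y|sg. kB ?s y z b \<bullet> dirac (kA_y ?r x a y) y)"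
      by (rule dirac_symmetric(1)[OF sphere_smooth_kB[OF z small(2)[OF \<tau>]] sphere_smooth_kA[OF x small(1)[OF \<tau>]]])
    also have "\<dots> = - ?s * (LINT y|sg. kB_r ?s y z b \<bullet> kA ?r y x a)"
      by (rule dirac_kB_integral[OF z small(2)[OF \<tau>] sphere_smooth_kA[OF x small(1)[OF \<tau>]], symmetric])
    \<comment> \<open>The pairing with \<Gamma> has been evaluated once on each factor. The opposite
      signs of the radial derivatives in the laws for \<open>kA\<close> and \<open>kB\<close> make
      the total derivative cancel.\<close>
    finally have "2 * I \<tau> + ?r * ?I1 + ?s * ?I2 = 0"
      by (simp add: inner_commute[of "kB_r _ _ _ _"])
    with D show ?thesis by simp
  qed
  have "M\<^sup>2 * I M = 0\<^sup>2 * I 0"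
    using M by (intro DERIV_isconst_end[of 0 M "\<lambda>\<tau>. \<tau>\<^sup>2 * I \<tau>"])
      (auto intro!: continuous_at_imp_continuous_on DERIV_isCont[OF D0] D0)
  then show ?thesis using M by (simp add: I_def)
qed

text \<open>Constants are annihilated by \<Gamma>, so the integral does not depend on the radius. At
  radius 0 the kernel is the constant 1 / (4 * pi), and the sphere has area 4 * pi.\<close>

lemma kB_integral_inner:
  assumes x: "x \<in> S2" and r: "0 \<le> r" "r < 1"
  shows "(LINT y|sg. kB r y x a \<bullet> b) = a \<bullet> b"
proof -
  define I where "I t = (LINT y|sg. kB t y x a \<bullet> b)" for t
  have D: "(I has_real_derivative (LINT y|sg. kB_r t y x a \<bullet> b)) (at t)" if "t \<in> {-1<..<1}" for t
    using radial_family_pairing_deriv[OF radial_family_kB[OF x] radial_family_const that,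
        of id "\<lambda>_. 1" id "\<lambda>_. 1" a b]
    by (auto simp: I_def[abs_def] id_def abs_less_iff)
  have t0: "t * (LINT y|sg. kB_r t y x a \<bullet> b) = 0" if "t \<in> {-1<..<1}" for t
    using dirac_kB_integral[OF x _ sphere_smooth_const[of b], of t a] that
    by (auto simp: dirac_def clif.zero_right)
  \<comment> \<open>The Dirac identity carries a factor t and gives no information at t = 0; the
    endpoint is reached by continuity.\<close>
  have D0: "(I has_real_derivative 0) (at t)" if "t \<in> {0<..<1}" for t
    using D[of t] t0[of t] that by simp
  have "I r = I 0"
  proof (cases "r = 0")
    case False
    then show ?thesis
      using r D by (intro DERIV_isconst_end[of 0 r I] D0)
       (auto intro!: continuous_at_imp_continuous_on DERIV_isCont[OF D])
  qed simp
  also have "I 0 = a \<bullet> b"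
    by (simp add: I_def kB_def kpow_def qd_def measure_sphere_UNIV)
  finally show ?thesis by (simp add: I_def)
qed

lemma integrable_kernels:
  assumes "x \<in> S2" "\<bar>r\<bar> < 1"
  shows "integrable sg (\<lambda>y. kA r y x a)" "integrable sg (\<lambda>y. kB r y x a)" "integrable sg (\<lambda>y. kP r y x)"
    "integrable sg (\<lambda>y. kA r x y a)" "integrable sg (\<lambda>y. kB r x y a)" "integrable sg (\<lambda>y. kP r x y)"
  using assms by (auto intro!: integrable_sphere_continuous continuous_intros)

lemma kA_integral:
  assumes x: "x \<in> S2" and r: "\<bar>r\<bar> < 1"
  shows "(LINT y|sg. kA r y x a) = 0"
proof (rule vector_eq_rdot[THEN iffD1], rule allI)
  fix b
  have "(LINT y|sg. kA r y x a) \<bullet> b = (LINT y|sg. kA r y x a \<bullet> b)"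
    using integrable_kernels(1)[OF x r] by simp
  \<comment> \<open>A constant spinor is a multiple of \<open>kB\<close> at radius 0, so the
    vanishing of the mean is a case of orthogonality.\<close>
  also have "\<dots> = (LINT y|sg. kA r y x a \<bullet> kB 0 y x ((4 * pi) *\<^sub>R b))"
    by (simp add: kB_def kpow_def qd_def)
  also have "\<dots> = 0" by (rule kA_kB_orthogonal) (use x r in auto)
  finally show "(LINT y|sg. kA r y x a) \<bullet> b = 0 \<bullet> b" by simp
qed

lemma kB_integral:
  assumes x: "x \<in> S2" and r: "0 \<le> r" "r < 1"
  shows "(LINT y|sg. kB r y x a) = a"
proof (rule vector_eq_rdot[THEN iffD1], rule allI)
  fix b
  have "(LINT y|sg. kB r y x a) \<bullet> b = (LINT y|sg. kB r y x a \<bullet> b)"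
    using integrable_kernels(2)[OF x, of r] r by simp
  also have "\<dots> = a \<bullet> b" by (rule kB_integral_inner[OF assms])
  finally show "(LINT y|sg. kB r y x a) \<bullet> b = a \<bullet> b" .
qed

lemma kP_integral:
  assumes x: "x \<in> S2" and r: "0 \<le> r" "r < 1"
  shows "(LINT y|sg. kP r x y) = 1"
proof -
  define a :: spinor where "a = axis 1 1"
  have [simp]: "a \<noteq> 0" by (simp add: a_def axis_eq_0_iff)
  have "(LINT y|sg. kP r y x) *\<^sub>R a = (LINT y|sg. kP r y x *\<^sub>R a)"
    using integrable_kernels[OF x, of r] r by simp
  also have "\<dots> = (LINT y|sg. r *\<^sub>R kA r y x a + kB r y x a)"
    by (simp add: kP_eq)
  also have "\<dots> = 1 *\<^sub>R a"
    using integrable_kernels[OF x, of r] kA_integral[OF x, of r] kB_integral[OF x, of r] r by simp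
  finally have "(LINT y|sg. kP r y x) = 1"
    unfolding scaleR_cancel_right by simp
  then show ?thesis by (simp add: kP_commute[of r x])
qed

lemma kP_le:
  assumes "x \<in> S2" "y \<in> S2" "0 < r" "r < 1" "d > 0" "d \<le> norm (x - y)"
  shows "kP r x y \<le> (1 - r\<^sup>2) * ((r * d\<^sup>2) powr (- 3 / 2) / (4 * pi))"
proof -
  have "r * d\<^sup>2 \<le> r * (norm (x - y))\<^sup>2"
    using assms by (intro mult_left_mono power_mono) auto
  then have "r * d\<^sup>2 \<le> qd r x y"
    unfolding qd_sphere[OF assms(1,2)] by (simp add: add_increasing)
  then have "qd r x y powr (- 3 / 2) \<le> (r * d\<^sup>2) powr (- 3 / 2)"
    using assms by (intro powr_mono2') auto
  then show ?thesis
    unfolding kP_def kpow_def using assms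
    by (intro mult_left_mono divide_right_mono) (auto simp: abs_square_le_1)
qed

lemma kP_tendsto:
  fixes g :: "real^3 \<Rightarrow> real"
  assumes x: "x \<in> S2" and g: "g \<in> borel_measurable borel" "continuous_on S2 g"
  shows "((\<lambda>r. LINT y|sg. kP r x y * g y) \<longlongrightarrow> g x) (at_left 1)"
proof (rule tendstoI)
  fix e :: real assume e: "e > 0"
  have [measurable]: "g \<in> borel_measurable borel" by fact
  obtain d where d: "d > 0" "\<And>y. y \<in> S2 \<Longrightarrow> norm (x - y) < d \<Longrightarrow> \<bar>g y - g x\<bar> < e / 2"
    using g(2) x e unfolding continuous_on_iff by (metis dist_norm half_gt_zero norm_minus_commute real_norm_def)
  obtain M where "\<forall>y\<in>S2. \<bar>g y\<bar> \<le> M"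
    using compact_imp_bounded[OF compact_continuous_image[OF g(2)]] by (auto simp: bounded_iff)
  then have M: "\<And>y. y \<in> S2 \<Longrightarrow> \<bar>g y\<bar> \<le> M" by blast
  have M0: "M \<ge> 0" using M[OF x] by simp
  define K where "K r = (1 - r\<^sup>2) * ((r * d\<^sup>2) powr (- 3 / 2) / (4 * pi))" for r
  have "(K \<longlongrightarrow> (1 - 1\<^sup>2) * ((1 * d\<^sup>2) powr (- 3 / 2) / (4 * pi))) (at_left 1)"
    unfolding K_def using d by (intro tendsto_intros) auto
  \<comment> \<open>Away from the cap of radius d the integrand is at most
    \<open>2 * M * K r\<close>, and integration over the sphere contributes its area 4 * pi.\<close>
  then have "((\<lambda>r. 8 * pi * M * K r) \<longlongrightarrow> 8 * pi * M * 0) (at_left 1)"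
    by (intro tendsto_intros) auto
  then have ev: "\<forall>\<^sub>F r in at_left 1. 8 * pi * M * K r < e / 2"
    using e by (intro order_tendstoD) auto
  have ev2: "\<forall>\<^sub>F r in at_left 1. r \<in> {0<..<1::real}"
    by (rule eventually_at_left_real) simp
  show "\<forall>\<^sub>F r in at_left 1. dist (LINT y|sg. kP r x y * g y) (g x) < e"
    using ev ev2
  proof eventually_elim
    case (elim r)
    then have r: "0 < r" "r < 1" by auto
    have K0: "0 \<le> K r" using r by (simp add: K_def abs_square_le_1)
    have int: "integrable sg (\<lambda>y. kP r x y)" using integrable_kernels[OF x] r by auto
    have int2: "integrable sg (\<lambda>y. kP r x y * g y)"
      by (intro integrable_sphere_continuous) (use x r g in \<open>auto intro!: continuous_intros\<close>)
    have "(LINT y|sg. kP r x y * g y) - g x = (LINT y|sg. kP r x y * g y) - (LINT y|sg. kP r x y) * g x"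
      using kP_integral[OF x, of r] r by simp
    also have "\<dots> = (LINT y|sg. kP r x y * (g y - g x))"
      using int int2 by (simp add: right_diff_distrib)
    finally have eq: "(LINT y|sg. kP r x y * g y) - g x = (LINT y|sg. kP r x y * (g y - g x))" .
    have "\<bar>LINT y|sg. kP r x y * (g y - g x)\<bar> \<le> (LINT y|sg. \<bar>kP r x y * (g y - g x)\<bar>)"
      by (rule integral_abs_bound)
    also have "\<dots> \<le> (LINT y|sg. e / 2 * kP r x y + 2 * M * K r)"
    proof (rule integral_mono_AE)
      show "integrable sg (\<lambda>y. \<bar>kP r x y * (g y - g x)\<bar>)"
        using int int2 by (simp add: right_diff_distrib)
      show "AE y in sg. \<bar>kP r x y * (g y - g x)\<bar> \<le> e / 2 * kP r x y + 2 * M * K r"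
        using AE_sphere_measure_sphere
      proof eventually_elim
        case (elim y)
        have P0: "kP r x y \<ge> 0" using r by (intro kP_nonneg) auto
        show ?case
        proof (cases "norm (x - y) < d")
          case True
          then have "kP r x y * \<bar>g y - g x\<bar> \<le> kP r x y * (e / 2)"
            using d(2)[OF elim] P0 by (intro mult_left_mono) (auto simp: less_imp_le)
          moreover have "0 \<le> 2 * M * K r" using M0 K0 by simp
          ultimately show ?thesis unfolding abs_mult abs_of_nonneg[OF P0] by (simp add: algebra_simps)
        next
          case False
          have "kP r x y * \<bar>g y - g x\<bar> \<le> K r * (2 * M)"
            using kP_le[OF x elim r d(1)] False M[OF x] M[OF elim] K0 P0
            by (intro mult_mono) (auto simp: K_def)
          moreover have "0 \<le> e / 2 * kP r x y" using P0 e by simp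
          ultimately show ?thesis unfolding abs_mult abs_of_nonneg[OF P0] by (simp add: algebra_simps)
        qed
      qed
    qed (use int in auto)
    also have "\<dots> = e / 2 + 8 * pi * M * K r"
      using int kP_integral[OF x, of r] r by (simp add: measure_sphere_UNIV)
    also have "\<dots> < e" using elim by simp
    finally show ?case unfolding dist_real_def eq .
  qed
qed

lemma kA_kA_inner:
  assumes x: "x \<in> S2" and z: "z \<in> S2" and r: "0 < r" "r < 1" and s: "0 < s" "s < 1"
  shows "(LINT y|sg. kA r y x a \<bullet> kA s y z b) = kA (r * s) z x a \<bullet> b"
proof -
  define I where "I r s = (LINT y|sg. kA r y x a \<bullet> kA s y z b)" for r s
  \<comment> \<open>\<open>I\<close> depends on the product of its arguments only, and \<open>s * I r s\<close> is a Poisson integral up to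
    the vanishing pairing with \<open>kB\<close>.\<close>
  have const: "I r s = I t (r * s / t)" if r: "0 < r" "r < 1" and s: "0 < s" "s < 1" and t: "r * s < t" "t < 1" for r s t
  proof -
    have q: "0 < r * s" "r * s < r" using r s by auto
    \<comment> \<open>Both radii of the hyperbola \<tau>, r s / \<tau> stay below one exactly for
      \<tau> between r s and 1.\<close>
    have \<sigma>: "((\<lambda>\<tau>. r * s / \<tau>) has_real_derivative - (r * s / k\<^sup>2)) (at k)" if "k \<in> {r * s<..<1}" for k
      using q that by (auto intro!: derivative_eq_intros simp: power2_eq_square)
    have "(I \<tau> (r * s / \<tau>)) = I t (r * s / t)" if \<tau>: "\<tau> \<in> {r * s<..<1}" for \<tau>
    proof (rule DERIV_isconst3[of "r * s" 1 \<tau> t "\<lambda>\<tau>. I \<tau> (r * s / \<tau>)"])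
      fix m assume m: "m \<in> {r * s<..<1}"
      have m0: "0 < m" using q m by auto
      have rng: "\<bar>k\<bar> < 1" "\<bar>r * s / k\<bar> < 1" if "k \<in> {r * s<..<1}" for k
        using that q by auto
      let ?I1 = "LINT y|sg. kA_r m y x a \<bullet> kA (r * s / m) y z b"
      let ?I2 = "LINT y|sg. kA m y x a \<bullet> kA_r (r * s / m) y z b"
      have D: "((\<lambda>\<tau>. I \<tau> (r * s / \<tau>)) has_real_derivative 1 * ?I1 + (- (r * s / m\<^sup>2)) * ?I2) (at m)"
        unfolding I_def
        by (rule radial_family_pairing_deriv[OF radial_family_kA[OF x] radial_family_kA[OF z] m])
          (use rng q \<sigma> in \<open>auto intro!: continuous_intros\<close>)
      have "m * ?I1 + 2 * I m (r * s / m) = (LINT y|sg. kA m y x a \<bullet> dirac (kA_y (r * s / m) z b y) y)"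
        unfolding I_def by (rule dirac_kA_integral[OF x rng(1)[OF m] sphere_smooth_kA[OF z rng(2)[OF m]]])
      also have "\<dots> = (LINT y|sg. dirac (kA_y (r * s / m) z b y) y \<bullet> kA m y x a)"
        by (simp add: inner_commute)
      also have "\<dots> = (LINT y|sg. kA (r * s / m) y z b \<bullet> dirac (kA_y m x a y) y)"
        by (rule dirac_symmetric(1)[OF sphere_smooth_kA[OF z rng(2)[OF m]] sphere_smooth_kA[OF x rng(1)[OF m]]])
      also have "\<dots> = (r * s / m) * (LINT y|sg. kA_r (r * s / m) y z b \<bullet> kA m y x a)
          + 2 * (LINT y|sg. kA (r * s / m) y z b \<bullet> kA m y x a)"
        by (rule dirac_kA_integral[OF z rng(2)[OF m] sphere_smooth_kA[OF x rng(1)[OF m]], symmetric])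
      also have "(LINT y|sg. kA (r * s / m) y z b \<bullet> kA m y x a) = I m (r * s / m)"
        by (simp add: I_def inner_commute)
      \<comment> \<open>Both factors are of type \<open>kA\<close>, so the zero order terms
        \<open>2 * I\<close> on the two sides cancel.\<close>
      finally have "m * ?I1 = (r * s / m) * ?I2"
        by (simp add: inner_commute[of "kA_r (r * s / m) _ _ _"])
      then have "1 * ?I1 + (- (r * s / m\<^sup>2)) * ?I2 = 0"
        using m0 by (simp add: field_simps power2_eq_square)
      with D show "((\<lambda>\<tau>. I \<tau> (r * s / \<tau>)) has_real_derivative 0) (at m)" by simp
    qed (use t \<tau> r q in auto)
    from this[of r] show ?thesis using r s q by simp
  qed
  \<comment> \<open>Letting the second radius of \<open>I r \<tau>\<close> tend to 1 produces a
    Poisson integral that converges to the kernel, but at the boundary of the admissible radii.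
    Moving along the hyperbola to the pair (t, r \<tau> / t) makes the limit point (t, r / t)
    interior, where \<open>I\<close> is continuous.\<close>
  have lim: "I t (r / t) = kA r z x a \<bullet> b" if r: "0 < r" "r < t" "t < 1" for r t
  proof -
    have cont: "isCont (\<lambda>\<tau>. I t (r * \<tau> / t)) 1"
    proof (rule DERIV_isCont)
      show "((\<lambda>\<tau>. I t (r * \<tau> / t)) has_real_derivative
          0 * (LINT y|sg. kA_r t y x a \<bullet> kA (r * 1 / t) y z b) + (r / t) * (LINT y|sg. kA t y x a \<bullet> kA_r (r * 1 / t) y z b)) (at 1)"
        unfolding I_def
        by (rule radial_family_pairing_deriv[OF radial_family_kA[OF x] radial_family_kA[OF z], where a = 0 and b = "t / r"])
          (use r in \<open>auto intro!: derivative_eq_intros simp: field_simps\<close>)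
    qed
    have "((\<lambda>\<tau>. \<tau> * I t (r * \<tau> / t)) \<longlongrightarrow> 1 * I t (r * 1 / t)) (at_left 1)"
      using cont by (intro tendsto_intros filterlim_at_split[THEN iffD1, THEN conjunct1]) (simp add: isCont_def)
    moreover have "((\<lambda>\<tau>. \<tau> * I t (r * \<tau> / t)) \<longlongrightarrow> kA r z x a \<bullet> b) (at_left 1)"
    proof (rule Lim_transform_eventually)
      show "((\<lambda>\<tau>. LINT y|sg. kP \<tau> z y * (kA r y x a \<bullet> b)) \<longlongrightarrow> kA r z x a \<bullet> b) (at_left 1)"
        by (rule kP_tendsto[OF z]) (use r x in \<open>auto intro!: continuous_intros\<close>)
      show "\<forall>\<^sub>F \<tau> in at_left 1. (LINT y|sg. kP \<tau> z y * (kA r y x a \<bullet> b)) = \<tau> * I t (r * \<tau> / t)"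
      proof (rule eventually_mono[OF eventually_at_left_real[of 0 1]])
        fix \<tau> :: real assume \<tau>: "\<tau> \<in> {0<..<1}"
        have "r * \<tau> < t" using r \<tau> mult_strict_mono[of r t \<tau> 1] by auto
        then have eq: "I t (r * \<tau> / t) = I r \<tau>" using const[of r \<tau> t] r \<tau> by auto
        have "(LINT y|sg. kP \<tau> z y * (kA r y x a \<bullet> b)) = (LINT y|sg. (\<tau> *\<^sub>R kA \<tau> y z b + 1 *\<^sub>R kB \<tau> y z b) \<bullet> kA r y x a)"
          using kP_eq[of \<tau> _ z b]
          by (intro Bochner_Integration.integral_cong refl) (metis inner_commute inner_scaleR_left kP_commute scaleR_one)
        also have "\<dots> = \<tau> * (LINT y|sg. kA \<tau> y z b \<bullet> kA r y x a) + 1 * (LINT y|sg. kB \<tau> y z b \<bullet> kA r y x a)"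
          by (rule LINT_inner_sphere_linear) (use \<tau> r x z in \<open>auto intro!: continuous_intros\<close>)
        also have "\<dots> = \<tau> * I r \<tau>"
          using kA_kB_orthogonal[OF x z, of r \<tau> a b] \<tau> r by (simp add: I_def inner_commute)
        finally show "(LINT y|sg. kP \<tau> z y * (kA r y x a \<bullet> b)) = \<tau> * I t (r * \<tau> / t)" by (simp add: eq)
      qed simp
    qed
    ultimately show ?thesis
      using tendsto_unique[OF trivial_limit_at_left_real] by fastforce
  qed
  have "r * s < r" using r s by simp
  then show ?thesis
    using lim[of "r * s" r] r s by (simp add: I_def)
qed

lemma bounded_linear_kernels:
  "bounded_linear (kA r x y)" "bounded_linear (kB r x y)"
  unfolding kA_def[abs_def] kB_def[abs_def]
  by (intro bounded_linear_intros clif.bounded_linear_right bounded_linear_scaleR_right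
      bounded_linear_const_scaleR bounded_linear_ident bounded_linear_compose[OF bounded_linear_scaleR_right])+

lemma kB_clif:
  assumes "x \<in> S2" "y \<in> S2"
  shows "kB r x y v = - clif x (kA r x y (clif y v))"
proof -
  have "clif x (clif (cross3 x y) (clif y v)) = - clif x (clif x (clif y (clif y v))) - (x \<bullet> y) *\<^sub>R clif x (clif y v)"
    by (simp add: clif_clif[of x y] clif.diff_right clif.minus_right clif.scaleR_right)
  also have "\<dots> = - v - (x \<bullet> y) *\<^sub>R clif x (clif y v)"
    using assms by (simp add: clif_self clif.minus_right)
  finally have *: "clif x (clif (cross3 x y) (clif y v)) = - v - (x \<bullet> y) *\<^sub>R clif x (clif y v)" .
  show ?thesis
    unfolding kB_def kA_def clif.scaleR_right clif.add_right *
    by (simp add: clif_clif[of x y] algebra_simps)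
qed

lemma kA_kA:
  assumes x: "x \<in> S2" and z: "z \<in> S2" and r: "0 < r" "r < 1" and s: "0 < s" "s < 1"
  shows "(LINT y|sg. kA r x y (kA s y z b)) = kA (r * s) x z b"
proof (rule vector_eq_ldot[THEN iffD1], rule allI)
  fix a
  have "integrable sg (\<lambda>y. kA r x y (kA s y z b))"
    by (intro integrable_sphere_continuous) (use assms in \<open>auto intro!: continuous_intros\<close>)
  then have "a \<bullet> (LINT y|sg. kA r x y (kA s y z b)) = (LINT y|sg. a \<bullet> kA r x y (kA s y z b))"
    by simp
  also have "\<dots> = (LINT y|sg. kA r y x a \<bullet> kA s y z b)"
    by (simp add: kA_adjoint)
  also have "\<dots> = a \<bullet> kA (r * s) x z b"
    using kA_kA_inner[OF assms] by (simp add: kA_adjoint)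
  finally show "a \<bullet> (LINT y|sg. kA r x y (kA s y z b)) = a \<bullet> kA (r * s) x z b" .
qed

lemma kA_kB:
  assumes x: "x \<in> S2" and z: "z \<in> S2" and r: "0 < r" "r < 1" and s: "0 < s" "s < 1"
  shows "(LINT y|sg. kA r x y (kB s y z b)) = 0"
proof (rule vector_eq_ldot[THEN iffD1], rule allI)
  fix a
  have "integrable sg (\<lambda>y. kA r x y (kB s y z b))"
    by (intro integrable_sphere_continuous) (use assms in \<open>auto intro!: continuous_intros\<close>)
  then have "a \<bullet> (LINT y|sg. kA r x y (kB s y z b)) = (LINT y|sg. a \<bullet> kA r x y (kB s y z b))"
    by simp
  also have "\<dots> = (LINT y|sg. kA r y x a \<bullet> kB s y z b)"
    by (simp add: kA_adjoint)
  also have "\<dots> = a \<bullet> 0"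
    using kA_kB_orthogonal[OF x z] r s by simp
  finally show "a \<bullet> (LINT y|sg. kA r x y (kB s y z b)) = a \<bullet> 0" .
qed

lemma kB_kA:
  assumes x: "x \<in> S2" and z: "z \<in> S2" and r: "0 < r" "r < 1" and s: "0 < s" "s < 1"
  shows "(LINT y|sg. kB r x y (kA s y z b)) = 0"
proof (rule vector_eq_ldot[THEN iffD1], rule allI)
  fix a
  have "integrable sg (\<lambda>y. kB r x y (kA s y z b))"
    by (intro integrable_sphere_continuous) (use assms in \<open>auto intro!: continuous_intros\<close>)
  then have "a \<bullet> (LINT y|sg. kB r x y (kA s y z b)) = (LINT y|sg. a \<bullet> kB r x y (kA s y z b))"
    by simp
  also have "\<dots> = (LINT y|sg. kA s y z b \<bullet> kB r y x a)"
    by (metis kB_adjoint inner_commute)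
  also have "\<dots> = a \<bullet> 0"
    using kA_kB_orthogonal[OF z x] r s by simp
  finally show "a \<bullet> (LINT y|sg. kB r x y (kA s y z b)) = a \<bullet> 0" .
qed

text \<open>\<open>kB\<close> is \<open>kA\<close> conjugated by Clifford multiplication. In the
  composition the two middle factors \<open>clif y\<close> multiply to -1, which cancels one of the
  two signs, so the law for \<open>kA\<close> carries over.\<close>

lemma kB_kB:
  assumes x: "x \<in> S2" and z: "z \<in> S2" and r: "0 < r" "r < 1" and s: "0 < s" "s < 1"
  shows "(LINT y|sg. kB r x y (kB s y z b)) = kB (r * s) x z b"
proof -
  have "(LINT y|sg. kB r x y (kB s y z b)) = (LINT y|sg. - clif x (kA r x y (kA s y z (clif z b))))"
  proof (intro integral_sphere_cong)
    fix y assume y: "y \<in> S2"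
    then show "kB r x y (kB s y z b) = - clif x (kA r x y (kA s y z (clif z b)))"
      unfolding kB_clif[OF x y] kB_clif[OF y z]
      by (simp add: clif.minus_right clif_self linear_neg[OF bounded_linear.linear[OF bounded_linear_kernels(1)]])
  qed measurable
  also have "\<dots> = - clif x (LINT y|sg. kA r x y (kA s y z (clif z b)))"
  proof -
    have "integrable sg (\<lambda>y. kA r x y (kA s y z (clif z b)))"
      by (intro integrable_sphere_continuous) (use assms in \<open>auto intro!: continuous_intros\<close>)
    then show ?thesis
      using integral_bounded_linear[OF clif.bounded_linear_right[of x]] by simp
  qed
  also have "\<dots> = kB (r * s) x z b"
    by (simp only: kA_kA[OF assms] kB_clif[OF x z])
  finally show ?thesis .
qed

subsection \<open>Maximal function and Lebesgue points\<close>

abbreviation e3 :: "real^3" where "e3 \<equiv> axis 3 1"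

lemma emeasure_box3:
  fixes a b :: "real^3"
  assumes "a$1 \<le> b$1" "a$2 \<le> b$2" "a$3 \<le> b$3"
  shows "emeasure lborel (cbox a b) = ennreal ((b$1 - a$1) * (b$2 - a$2) * (b$3 - a$3))"
proof -
  have "cbox a b \<noteq> {}" unfolding interval_ne_empty_cart forall_3 using assms by blast
  then have "measure lborel (cbox a b) = (\<Prod>i\<in>UNIV. b$i - a$i)"
    by (rule content_cbox_cart)
  also have "\<dots> = (b$1 - a$1) * (b$2 - a$2) * (b$3 - a$3)"
    unfolding UNIV_3 by simp
  finally have 1: "measure lborel (cbox a b) = (b$1 - a$1) * (b$2 - a$2) * (b$3 - a$3)" .
  have "emeasure lborel (cbox a b) \<noteq> top"
    using emeasure_lborel_cbox_finite[of a b] by simp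
  then show ?thesis unfolding 1[symmetric] by (rule emeasure_eq_ennreal_measure)
qed

text \<open>\<open>sphere_measure\<close> is three times the volume of the cone over the set. The
  cone over the cap fits into a box with sides 2 \<rho>, 2 \<rho>, 2, which gives 3 * 8 =
  24.\<close>

lemma emeasure_cap_axis_le:
  assumes "\<rho> \<ge> 0"
  shows "emeasure sg (ball e3 \<rho>) \<le> ennreal (24 * \<rho>\<^sup>2)"
proof -
  let ?b = "vector [\<rho>, \<rho>, 1] :: real^3"
  have "sgn -` ball e3 \<rho> \<inter> cball 0 1 \<subseteq> cbox (- ?b) ?b"
  proof
    fix y :: "real^3" assume y: "y \<in> sgn -` ball e3 \<rho> \<inter> cball 0 1"
    have *: "\<bar>y $ i\<bar> \<le> \<rho>" if "i \<noteq> 3" for i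
    proof -
      have "\<bar>(sgn y - e3) $ i\<bar> \<le> norm (sgn y - e3)" by (rule component_le_norm_cart)
      also have "\<dots> \<le> \<rho>" using y by (simp add: dist_norm norm_minus_commute)
      finally have "\<bar>sgn y $ i\<bar> \<le> \<rho>" using that by (simp add: axis_def)
      moreover have "y $ i = norm y * sgn y $ i" by (cases "y = 0") (simp_all add: sgn_div_norm)
      ultimately have "\<bar>y $ i\<bar> \<le> 1 * \<rho>"
        using y by (simp only: abs_mult) (intro mult_mono; simp)
      then show ?thesis by simp
    qed
    have "\<bar>y $ 3\<bar> \<le> 1" using component_le_norm_cart[of y 3] y by simp
    then show "y \<in> cbox (- ?b) ?b"
      using *[of 1] *[of 2] by (auto simp: mem_box_cart forall_3 abs_le_iff)
  qed
  then have "emeasure lborel (sgn -` ball e3 \<rho> \<inter> cball 0 1) \<le> emeasure lborel (cbox (- ?b) ?b)"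
    by (intro emeasure_mono) auto
  also have "\<dots> = ennreal (8 * \<rho>\<^sup>2)"
    using assms by (subst emeasure_box3) (simp_all add: power2_eq_square)
  finally have "emeasure sg (ball e3 \<rho>) \<le> 3 * ennreal (8 * \<rho>\<^sup>2)"
    by (simp add: emeasure_sphere_measure mult_left_mono)
  also have "\<dots> = ennreal (3 * (8 * \<rho>\<^sup>2))"
    by (subst ennreal_mult') simp_all
  also have "3 * (8 * \<rho>\<^sup>2) = 24 * \<rho>\<^sup>2" by simp
  finally show ?thesis .
qed

text \<open>A box with sides 2 \<rho> / 9, 2 \<rho> / 9, 1 / 4 lies in the cone. On it the norm is
  at least 1 / 2 and the distance to the axis at most 2 \<rho> / 9; hence the radial projection
  moves at most 8 \<rho> / 9 away from the pole. The bound \<rho> \<le> 3 keeps the box inside the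
  unit ball.\<close>

lemma emeasure_cap_axis_ge:
  assumes "0 < \<rho>" "\<rho> \<le> 3"
  shows "ennreal (\<rho>\<^sup>2 / 27) \<le> emeasure sg (ball e3 \<rho>)"
proof -
  let ?a = "vector [- (\<rho> / 9), - (\<rho> / 9), 1 / 2] :: real^3" and ?b = "vector [\<rho> / 9, \<rho> / 9, 3 / 4] :: real^3"
  have sub: "cbox ?a ?b \<subseteq> sgn -` ball e3 \<rho> \<inter> cball 0 1"
  proof
    fix y :: "real^3" assume "y \<in> cbox ?a ?b"
    then have y: "\<bar>y$1\<bar> \<le> \<rho> / 9" "\<bar>y$2\<bar> \<le> \<rho> / 9" "1 / 2 \<le> y$3" "y$3 \<le> 3 / 4"
      by (auto simp: mem_box_cart forall_3 abs_le_iff)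
    have sq: "(y$1)\<^sup>2 \<le> 1 / 9" "(y$2)\<^sup>2 \<le> 1 / 9" "(y$3)\<^sup>2 \<le> 9 / 16"
      using power_mono[of "\<bar>y$1\<bar>" "1/3" 2] power_mono[of "\<bar>y$2\<bar>" "1/3" 2] power_mono[of "y$3" "3/4" 2] y assms
      by (simp_all add: power_divide)
    have "(norm y)\<^sup>2 \<le> 1"
      using sq by (simp add: power2_norm_eq_inner inner_vec_def sum_3 flip: power2_eq_square)
    then have n1: "norm y \<le> 1" using abs_square_le_1[of "norm y"] by simp
    have n2: "1 / 2 \<le> norm y" using component_le_norm_cart[of y 3] y by linarith
    define p where "p = y - (y$3) *\<^sub>R e3"
    have "norm p \<le> \<bar>p$1\<bar> + \<bar>p$2\<bar> + \<bar>p$3\<bar>" using norm_le_l1_cart[of p] by (simp add: sum_3)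
    then have np: "norm p \<le> 2 * \<rho> / 9" using y by (simp add: p_def axis_def)
    have n3: "\<bar>norm y - y$3\<bar> \<le> norm p"
      using norm_triangle_ineq3[of y "(y$3) *\<^sub>R e3"] y by (simp add: p_def norm_axis_1)
    have "norm (y - norm y *\<^sub>R e3) \<le> norm p + norm ((y$3 - norm y) *\<^sub>R e3)"
      using norm_triangle_ineq[of p "(y$3 - norm y) *\<^sub>R e3"] by (simp add: p_def algebra_simps)
    also have "\<dots> \<le> 4 * \<rho> / 9" using n3 np by (simp add: norm_axis_1 abs_minus_commute)
    finally have n4: "norm (y - norm y *\<^sub>R e3) \<le> 4 * \<rho> / 9" .
    have "y \<noteq> 0" using n2 by auto
    then have "sgn y - e3 = (1 / norm y) *\<^sub>R (y - norm y *\<^sub>R e3)"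
      by (simp add: sgn_div_norm scaleR_diff_right divide_inverse)
    then have "norm (sgn y - e3) = norm (y - norm y *\<^sub>R e3) / norm y" by simp
    also have "\<dots> \<le> (4 * \<rho> / 9) / (1 / 2)" using n4 n2 assms by (intro frac_le) auto
    also have "\<dots> < \<rho>" using assms by simp
    finally show "y \<in> sgn -` ball e3 \<rho> \<inter> cball 0 1"
      using n1 by (simp add: dist_norm norm_minus_commute)
  qed
  have m: "sgn -` ball e3 \<rho> \<inter> cball (0 :: real^3) 1 \<in> sets borel"
    using measurable_sets[OF borel_measurable_sgn_vec, of "ball e3 \<rho>"] by simp
  have "ennreal (\<rho>\<^sup>2 / 27) = ennreal (3 * (\<rho>\<^sup>2 / 81))" by simp
  also have "\<dots> = 3 * ennreal (\<rho>\<^sup>2 / 81)"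
    by (subst ennreal_mult') simp_all
  also have "ennreal (\<rho>\<^sup>2 / 81) = emeasure lborel (cbox ?a ?b)"
    using assms by (subst emeasure_box3) (simp_all add: power2_eq_square)
  also have "3 * emeasure lborel (cbox ?a ?b) \<le> emeasure sg (ball e3 \<rho>)"
    unfolding emeasure_sphere_measure[OF borel_open[OF open_ball]]
    by (intro mult_left_mono emeasure_mono sub) (use m in auto)
  finally show ?thesis .
qed

lemma emeasure_cap_rotate:
  assumes "norm x = 1"
  shows "emeasure sg (ball x \<rho>) = emeasure sg (ball e3 \<rho>)"
proof -
  obtain T :: "real^3 \<Rightarrow> real^3" where T: "orthogonal_transformation T" and Tx: "T e3 = x"
    using orthogonal_transformation_exists_1[of e3 x] assms by (auto simp: norm_axis_1)
  have [measurable]: "T \<in> borel_measurable borel"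
    using orthogonal_transformation_linear[OF T]
    by (intro borel_measurable_continuous_onI linear_continuous_on linear_conv_bounded_linear[THEN iffD1])
  have "emeasure sg (ball x \<rho>) = emeasure (distr sg borel T) (ball x \<rho>)"
    by (simp add: distr_sphere_measure_orthogonal[OF T])
  also have "\<dots> = emeasure sg (T -` ball x \<rho>)"
    by (subst emeasure_distr) auto
  also have "T -` ball x \<rho> = ball e3 \<rho>"
    using T Tx by (auto simp: dist_norm linear_diff[OF orthogonal_transformation_linear[OF T], symmetric]
        orthogonal_transformation_norm simp flip: Tx)
  finally show ?thesis .
qed

text \<open>16200 = 24 * 25 * 27 is the quotient of the two cap estimates at radii 5 \<rho> and
  \<rho>. The dilation by five is the one of the Vitali covering lemma.\<close>

lemma sphere_doubling:
  assumes "norm x = 1" "0 < \<rho>" "\<rho> \<le> 3"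
  shows "emeasure sg (ball x (5 * \<rho>)) \<le> 16200 * emeasure sg (ball x \<rho>)"
proof -
  have "emeasure sg (ball x (5 * \<rho>)) \<le> ennreal (24 * (5 * \<rho>)\<^sup>2)"
    unfolding emeasure_cap_rotate[OF assms(1)] using assms by (intro emeasure_cap_axis_le) auto
  also have "\<dots> = ennreal (16200 * (\<rho>\<^sup>2 / 27))"
    by (simp add: power2_eq_square)
  also have "\<dots> = 16200 * ennreal (\<rho>\<^sup>2 / 27)"
    by (subst ennreal_mult') simp_all
  also have "\<dots> \<le> 16200 * emeasure sg (ball x \<rho>)"
    unfolding emeasure_cap_rotate[OF assms(1)] using assms by (intro mult_left_mono emeasure_cap_axis_ge) auto
  finally show ?thesis .
qed

section \<open>Weak type estimate and density of continuous functions\<close>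

lemma emeasure_UN_le_count_space:
  assumes "countable C" and A: "\<And>i. i \<in> C \<Longrightarrow> A i \<in> sets M"
  shows "emeasure M (\<Union>i\<in>C. A i) \<le> (\<integral>\<^sup>+i. emeasure M (A i) \<partial>count_space C)"
proof -
  have [measurable]: "(\<Union>i\<in>C. A i) \<in> sets M" using assms by auto
  have "emeasure M (\<Union>i\<in>C. A i) = (\<integral>\<^sup>+x. indicator (\<Union>i\<in>C. A i) x \<partial>M)" by simp
  also have "\<dots> \<le> (\<integral>\<^sup>+x. (\<integral>\<^sup>+i. indicator (A i) x \<partial>count_space C) \<partial>M)"
  proof (intro nn_integral_mono)
    fix x
    show "indicator (\<Union>i\<in>C. A i) x \<le> (\<integral>\<^sup>+i. indicator (A i) x \<partial>count_space C)"
    proof (cases "x \<in> (\<Union>i\<in>C. A i)")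
      case True
      then obtain j where j: "j \<in> C" "x \<in> A j" by auto
      have "(1::ennreal) = (\<integral>\<^sup>+i. indicator {j} i \<partial>count_space C)"
        using j by (subst nn_integral_indicator) auto
      also have "\<dots> \<le> (\<integral>\<^sup>+i. indicator (A i) x \<partial>count_space C)"
        using j by (intro nn_integral_mono) (auto simp: indicator_def)
      finally show ?thesis using True by simp
    qed simp
  qed
  also have "\<dots> = (\<integral>\<^sup>+i. (\<integral>\<^sup>+x. indicator (A i) x \<partial>M) \<partial>count_space C)"
    using assms by (intro nn_integral_count_space_nn_integral) auto
  also have "\<dots> = (\<integral>\<^sup>+i. emeasure M (A i) \<partial>count_space C)"
    using A by (intro nn_integral_cong) simp
  finally show ?thesis .
qed

text \<open>Vitali's lemma selects disjoint caps with large averages whose fivefold dilates cover E;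
  disjointness bounds the sum of their integrals by the whole integral. The conclusion speaks of a
  Borel superset because no measurability of E is assumed.\<close>

lemma maximal_weak_type:
  fixes h :: "real^3 \<Rightarrow> ennreal"
  assumes [measurable]: "h \<in> borel_measurable borel" and E: "E \<subseteq> S2"
    and big: "\<And>x. x \<in> E \<Longrightarrow> \<exists>\<rho>>0. \<alpha> * emeasure sg (ball x \<rho>) < (\<integral>\<^sup>+y\<in>ball x \<rho>. h y \<partial>sg)"
  shows "\<exists>U\<in>sets borel. E \<subseteq> U \<and> \<alpha> * emeasure sg U \<le> 16200 * (\<integral>\<^sup>+y. h y \<partial>sg)"
proof -
  have "\<exists>\<rho>. 0 < \<rho> \<and> \<rho> \<le> 3 \<and> \<alpha> * emeasure sg (ball x \<rho>) \<le> (\<integral>\<^sup>+y\<in>ball x \<rho>. h y \<partial>sg)" if "x \<in> E" for x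
  proof -
    obtain \<rho> where \<rho>: "\<rho> > 0" "\<alpha> * emeasure sg (ball x \<rho>) < (\<integral>\<^sup>+y\<in>ball x \<rho>. h y \<partial>sg)"
      using big[OF \<open>x \<in> E\<close>] by auto
    show ?thesis
    proof (cases "\<rho> \<le> 3")
      \<comment> \<open>A ball of radius 3 about a point of the sphere already contains the sphere,
        so larger radii can be shrunk to 3 without losing mass.\<close>
      case False
      have x: "norm x = 1" using that E by auto
      have "\<alpha> * emeasure sg (ball x 3) \<le> \<alpha> * emeasure sg (ball x \<rho>)"
        using False by (intro mult_left_mono emeasure_mono subset_ball) auto
      also have "\<dots> \<le> (\<integral>\<^sup>+y\<in>ball x \<rho>. h y \<partial>sg)" using \<rho> by simp
      also have "\<dots> \<le> (\<integral>\<^sup>+y\<in>ball x 3. h y \<partial>sg)"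
      proof (rule nn_integral_mono_AE)
        show "AE y in sg. h y * indicator (ball x \<rho>) y \<le> h y * indicator (ball x 3) y"
          using AE_sphere_measure_sphere
        proof eventually_elim
          case (elim y)
          then have "dist x y < 3" using dist_triangle[of x y 0] x by simp
          then show ?case by (simp add: indicator_def)
        qed
      qed
      finally show ?thesis by (intro exI[of _ 3]) auto
    qed (use \<rho> in auto)
  qed
  then obtain \<rho> where \<rho>: "\<And>x. x \<in> E \<Longrightarrow> 0 < \<rho> x \<and> \<rho> x \<le> 3"
    and big': "\<And>x. x \<in> E \<Longrightarrow> \<alpha> * emeasure sg (ball x (\<rho> x)) \<le> (\<integral>\<^sup>+y\<in>ball x (\<rho> x). h y \<partial>sg)"
    by metis
  have "E \<subseteq> (\<Union>i\<in>E. ball i (\<rho> i))" using \<rho> by auto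
  then obtain C where C: "countable C" "C \<subseteq> E"
    and disj: "pairwise (\<lambda>i j. disjnt (ball i (\<rho> i)) (ball j (\<rho> j))) C"
    and cov: "E \<subseteq> (\<Union>i\<in>C. ball i (5 * \<rho> i))"
    by (rule Vitali_covering_lemma_balls[where a = "\<lambda>i. i" and B = 3]) (use \<rho> in auto)
  have dens: "(\<integral>\<^sup>+i. emeasure (density sg h) (ball i (\<rho> i)) \<partial>count_space C) \<le> (\<integral>\<^sup>+y. h y \<partial>sg)"
  proof -
    have "(\<integral>\<^sup>+i. emeasure (density sg h) (ball i (\<rho> i)) \<partial>count_space C)
        = emeasure (density sg h) (\<Union>i\<in>C. ball i (\<rho> i))"
      using C disj by (intro emeasure_UN_countable[symmetric])
        (auto simp: disjoint_family_on_def pairwise_def disjnt_def)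
    also have "\<dots> \<le> emeasure (density sg h) UNIV"
      by (intro emeasure_mono) auto
    also have "\<dots> = (\<integral>\<^sup>+y. h y \<partial>sg)"
      by (simp add: emeasure_density)
    finally show ?thesis .
  qed
  define U where "U = (\<Union>i\<in>C. ball i (5 * \<rho> i))"
  have "\<alpha> * emeasure sg U \<le> \<alpha> * (\<integral>\<^sup>+i. emeasure sg (ball i (5 * \<rho> i)) \<partial>count_space C)"
    unfolding U_def using C by (intro mult_left_mono emeasure_UN_le_count_space) auto
  also have "\<dots> = (\<integral>\<^sup>+i. \<alpha> * emeasure sg (ball i (5 * \<rho> i)) \<partial>count_space C)"
    by (simp add: nn_integral_cmult)
  also have "\<dots> \<le> (\<integral>\<^sup>+i. 16200 * (\<integral>\<^sup>+y\<in>ball i (\<rho> i). h y \<partial>sg) \<partial>count_space C)"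
  proof (intro nn_integral_mono)
    fix i assume "i \<in> space (count_space C)"
    then have i: "i \<in> E" "norm i = 1" using C E by auto
    have "\<alpha> * emeasure sg (ball i (5 * \<rho> i)) \<le> \<alpha> * (16200 * emeasure sg (ball i (\<rho> i)))"
      using \<rho>[OF i(1)] i by (intro mult_left_mono sphere_doubling) auto
    also have "\<dots> = 16200 * (\<alpha> * emeasure sg (ball i (\<rho> i)))" by (simp add: mult_ac)
    also have "\<dots> \<le> 16200 * (\<integral>\<^sup>+y\<in>ball i (\<rho> i). h y \<partial>sg)"
      using big'[OF i(1)] by (intro mult_left_mono) auto
    finally show "\<alpha> * emeasure sg (ball i (5 * \<rho> i)) \<le> 16200 * (\<integral>\<^sup>+y\<in>ball i (\<rho> i). h y \<partial>sg)" .
  qed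
  also have "\<dots> = 16200 * (\<integral>\<^sup>+i. emeasure (density sg h) (ball i (\<rho> i)) \<partial>count_space C)"
    by (simp add: nn_integral_cmult emeasure_density)
  also have "\<dots> \<le> 16200 * (\<integral>\<^sup>+y. h y \<partial>sg)"
    by (intro mult_left_mono dens) simp
  finally have "\<alpha> * emeasure sg U \<le> 16200 * (\<integral>\<^sup>+y. h y \<partial>sg)" .
  moreover have "U \<in> sets borel" using C by (auto simp: U_def)
  ultimately show ?thesis using cov by (auto simp: U_def)
qed

text \<open>For an indicator, regularity of the measure encloses the set between a compact and an
  open set of nearly equal measure, and a Urysohn function interpolates. Sums and dominated limits
  then follow from the triangle inequality.\<close>

lemma continuous_L1_approx:
  fixes f :: "real^3 \<Rightarrow> 'b::euclidean_space"
  assumes "integrable sg f" "e > 0"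
  shows "\<exists>g. continuous_on UNIV g \<and> (LINT x|sg. norm (f x - g x)) < e"
  using assms
proof (induction f arbitrary: e rule: integrable_induct)
  case (base A c)
  then have A [measurable]: "A \<in> sets borel" by simp
  \<comment> \<open>Inner and outer regularity each cost d, weighted by \<open>norm c\<close>. The
    added 1 makes the final estimate strict and covers c = 0.\<close>
  define d where "d = e / (2 * (norm c + 1))"
  have "norm c + 1 > 0" by (simp add: add_nonneg_pos)
  then have d: "d > 0" using base by (simp add: d_def)
  obtain K where K: "compact K" "K \<subseteq> A" "measure sg A < measure sg K + d"
  proof -
    have "\<exists>K\<in>{K. K \<subseteq> A \<and> compact K}. emeasure sg A < emeasure sg K + ennreal d"
      using A d by (intro SUP_approx_ennreal inner_regular) (auto simp: sphere.emeasure_eq_measure)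
    then show ?thesis
      using d that by (auto simp: sphere.emeasure_eq_measure ennreal_less_iff simp flip: ennreal_plus)
  qed
  obtain U where U: "open U" "A \<subseteq> U" "measure sg U < measure sg A + d"
  proof -
    have "\<exists>U\<in>{U. A \<subseteq> U \<and> open U}. emeasure sg U < emeasure sg A + ennreal d"
      using A d by (intro INF_approx_ennreal outer_regular) (auto simp: sphere.emeasure_eq_measure)
    then show ?thesis
      using d that by (auto simp: sphere.emeasure_eq_measure ennreal_less_iff simp flip: ennreal_plus)
  qed
  obtain u :: "real^3 \<Rightarrow> real" where u: "continuous_on UNIV u" "\<And>x. u x \<in> closed_segment 0 1"
    "\<And>x. x \<in> - U \<Longrightarrow> u x = 0" "\<And>x. x \<in> K \<Longrightarrow> u x = 1"
  proof (rule Urysohn[of "- U" K 0 1])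
    show "closed K" using K compact_imp_closed by blast
  qed (use U K in auto)
  have u01: "0 \<le> u x" "u x \<le> 1" for x
    using u(2)[of x] by (auto simp: closed_segment_eq_real_ivl)
  have K_meas [measurable]: "K \<in> sets borel" "U \<in> sets borel" using K U by (auto intro: borel_closed compact_imp_closed)
  have "(LINT x|sg. norm (indicator A x *\<^sub>R c - u x *\<^sub>R c)) \<le> (LINT x|sg. indicator (U - K) x * norm c)"
  proof (rule integral_mono)
    show "norm (indicator A x *\<^sub>R c - u x *\<^sub>R c) \<le> indicator (U - K) x * norm c" for x
    proof -
      have "norm (indicator A x *\<^sub>R c - u x *\<^sub>R c) = \<bar>indicator A x - u x\<bar> * norm c"
        by (metis norm_scaleR scaleR_diff_left)
      also have "\<dots> \<le> indicator (U - K) x * norm c"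
        using u(3)[of x] u(4)[of x] u01[of x] K(2) U(2)
        by (intro mult_right_mono) (auto simp: indicator_def)
      finally show ?thesis .
    qed
    have [measurable]: "u \<in> borel_measurable borel" using u by (simp add: borel_measurable_continuous_onI)
    have "integrable sg (\<lambda>x. u x *\<^sub>R c)"
      by (intro integrable_sphere_bounded[where K = "norm c"])
        (use u01 in \<open>auto intro!: mult_left_le_one_le\<close>)
    moreover have "integrable sg (\<lambda>x. indicator A x *\<^sub>R c)"
      using base by (intro integrable_scaleR_left) auto
    ultimately show "integrable sg (\<lambda>x. norm (indicator A x *\<^sub>R c - u x *\<^sub>R c))" by simp
    have "integrable sg (indicator (U - K) :: _ \<Rightarrow> real)"
      by (rule integrable_sphere_bounded[where K = 1]) (auto simp: indicator_def)
    then show "integrable sg (\<lambda>x. indicator (U - K) x * norm c)" by simp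
  qed
  also have "\<dots> = (measure sg U - measure sg K) * norm c"
    using K U by (simp add: sphere.finite_measure_Diff)
  also have "\<dots> \<le> 2 * d * norm c"
    using K U by (intro mult_right_mono) auto
  also have "\<dots> < 2 * d * (norm c + 1)" using d by simp
  also have "\<dots> = d * (2 * (norm c + 1))" by simp
  also have "\<dots> = e"
    using \<open>norm c + 1 > 0\<close> d_def by (metis mult_pos_pos nonzero_eq_divide_eq order_less_irrefl zero_less_numeral)
  finally show ?case
    using u(1) by (intro exI[of _ "\<lambda>x. u x *\<^sub>R c"]) (auto intro!: continuous_intros)
next
  case (add f1 f2)
  obtain g1 g2 where g: "continuous_on UNIV g1" "(LINT x|sg. norm (f1 x - g1 x)) < e / 2"
    "continuous_on UNIV g2" "(LINT x|sg. norm (f2 x - g2 x)) < e / 2"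
    using add.IH(1)[of "e / 2"] add.IH(2)[of "e / 2"] add.prems by auto
  have int: "integrable sg g1" "integrable sg g2"
    using g by (auto intro!: integrable_sphere_continuous borel_measurable_continuous_onI intro: continuous_on_subset)
  have "(LINT x|sg. norm (f1 x + f2 x - (g1 x + g2 x))) \<le> (LINT x|sg. norm (f1 x - g1 x) + norm (f2 x - g2 x))"
    using add.hyps int by (intro integral_mono) (auto simp: add_diff_add norm_triangle_ineq)
  also have "\<dots> < e" using add.hyps int g by simp
  finally show ?case using g by (intro exI[of _ "\<lambda>x. g1 x + g2 x"]) (auto intro!: continuous_intros)
next
  case (lim f s)
  have "(\<lambda>i. LINT x|sg. norm (f x - s i x)) \<longlonglongrightarrow> (LINT x|sg. norm (f x - f x))"
  proof (rule integral_dominated_convergence[where w = "\<lambda>x. 3 * norm (f x)"])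
    show "AE x in sg. (\<lambda>i. norm (f x - s i x)) \<longlonglongrightarrow> norm (f x - f x)"
      by (intro AE_I2 tendsto_intros lim.hyps(2))
    show "AE x in sg. norm (norm (f x - s i x)) \<le> 3 * norm (f x)" for i
    proof (rule AE_I2)
      fix x assume "x \<in> space sg"
      then show "norm (norm (f x - s i x)) \<le> 3 * norm (f x)"
        using lim.hyps(3)[of x i] norm_triangle_ineq4[of "f x" "s i x"] by simp
    qed
  qed (use lim.hyps(1,4) in auto)
  then have "\<forall>\<^sub>F i in sequentially. (LINT x|sg. norm (f x - s i x)) < e / 2"
    using lim.prems by (intro order_tendstoD(2)) auto
  then obtain i where i: "(LINT x|sg. norm (f x - s i x)) < e / 2"
    by (auto simp: eventually_sequentially)
  obtain g where g: "continuous_on UNIV g" "(LINT x|sg. norm (s i x - g x)) < e / 2"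
    using lim.IH[of "e / 2" i] lim.prems by auto
  have int: "integrable sg g"
    using g by (auto intro!: integrable_sphere_continuous borel_measurable_continuous_onI intro: continuous_on_subset)
  have "(LINT x|sg. norm (f x - g x)) \<le> (LINT x|sg. norm (f x - s i x) + norm (s i x - g x))"
  proof (rule integral_mono)
    show "norm (f x - g x) \<le> norm (f x - s i x) + norm (s i x - g x)" for x
      using norm_triangle_ineq[of "f x - s i x" "s i x - g x"] by simp
  qed (use lim.hyps(1,4) int in auto)
  also have "\<dots> < e" using lim.hyps(1,4) int g i by simp
  finally have fin: "(LINT x|sg. norm (f x - g x)) < e" .
  show ?case by (rule exI[of _ g], rule conjI[OF g(1) fin])
qed

section \<open>Poisson maximal function and Lebesgue points\<close>

lemma powr_less_level:
  fixes c q u :: real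
  assumes "q > 0" "c > 0" "u > 0"
  shows "u < c * q powr (- 3 / 2) \<longleftrightarrow> q < (c / u) powr (2 / 3)"
proof -
  have *: "(q powr (3 / 2)) powr (2 / 3) = q" using assms by (simp add: powr_powr)
  have "u < c * q powr (- 3 / 2) \<longleftrightarrow> q powr (3 / 2) < c / u"
    using assms by (simp add: powr_minus field_simps)
  also have "\<dots> \<longleftrightarrow> (q powr (3 / 2)) powr (2 / 3) < (c / u) powr (2 / 3)"
    using assms powr_less_mono2[of "2/3" "q powr (3/2)" "c/u"] powr_mono2[of "2/3" "c/u" "q powr (3/2)"]
    by (cases "q powr (3 / 2) < c / u") auto
  finally show ?thesis by (simp only: *)
qed

text \<open>The superlevel sets of the Poisson kernel are caps, so Poisson integrals are averages of cap averages.\<close>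

lemma kP_maximal:
  fixes h :: "real^3 \<Rightarrow> ennreal"
  assumes x: "x \<in> S2" and r: "0 < r" "r < 1" and [measurable]: "h \<in> borel_measurable borel"
    and le: "\<And>\<rho>. \<rho> > 0 \<Longrightarrow> (\<integral>\<^sup>+y\<in>ball x \<rho>. h y \<partial>sg) \<le> \<alpha> * emeasure sg (ball x \<rho>)"
  shows "(\<integral>\<^sup>+y. ennreal (kP r x y) * h y \<partial>sg) \<le> \<alpha>"
proof -
  interpret P: pair_sigma_finite lborel sg
    by (simp add: pair_sigma_finite_def sphere.sigma_finite_measure_axioms lborel.sigma_finite_measure_axioms)
  have L_meas: "(\<lambda>(u, y). indicator {0<..<kP r x y} u * g y) \<in> borel_measurable (lborel \<Otimes>\<^sub>M sg)"
    if "g \<in> borel_measurable borel" for g :: "real^3 \<Rightarrow> ennreal"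
  proof -
    have [measurable]: "g \<in> borel_measurable sg" using that by (simp cong: measurable_cong_sets)
    have "(\<lambda>p. indicator {0<..<kP r x (snd p)} (fst p) :: ennreal) \<in> borel_measurable (lborel \<Otimes>\<^sub>M sg)"
      unfolding indicator_def greaterThanLessThan_iff by measurable
    then show ?thesis
      unfolding case_prod_beta by measurable
  qed
  \<comment> \<open>Layer cake formula: the kernel value is the length of the interval of levels
    below it, and the order of integration is exchanged.\<close>
  have layer: "(\<integral>\<^sup>+y. ennreal (kP r x y) * g y \<partial>sg)
      = (\<integral>\<^sup>+u. (\<integral>\<^sup>+y. indicator {0<..<kP r x y} u * g y \<partial>sg) \<partial>lborel)"
    if [measurable]: "g \<in> borel_measurable borel" for g :: "real^3 \<Rightarrow> ennreal"
  proof -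
    have "(\<integral>\<^sup>+y. ennreal (kP r x y) * g y \<partial>sg)
        = (\<integral>\<^sup>+y. (\<integral>\<^sup>+u. indicator {0<..<kP r x y} u * g y \<partial>lborel) \<partial>sg)"
    proof (intro nn_integral_cong)
      fix y
      have "kP r x y \<ge> 0" using r by (intro kP_nonneg) auto
      then show "ennreal (kP r x y) * g y = (\<integral>\<^sup>+u. indicator {0<..<kP r x y} u * g y \<partial>lborel)"
        by (simp add: nn_integral_multc)
    qed
    also have "\<dots> = (\<integral>\<^sup>+u. (\<integral>\<^sup>+y. indicator {0<..<kP r x y} u * g y \<partial>sg) \<partial>lborel)"
      by (rule P.Fubini'[OF L_meas[OF that]])
    finally show ?thesis .
  qed
  define c where "c = (1 - r\<^sup>2) / (4 * pi)"
  have c: "c > 0" using r by (simp add: c_def power_less_one_iff)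
  have slice: "(\<integral>\<^sup>+y. indicator {0<..<kP r x y} u * h y \<partial>sg)
      \<le> \<alpha> * (\<integral>\<^sup>+y. indicator {0<..<kP r x y} u * 1 \<partial>sg)" for u
  proof (cases "u > 0")
    case True
    \<comment> \<open>The squared radius of the cap on which the kernel exceeds the level u, from
      solving qd < (c / u)^(2/3) for |x - y|^2. For \<kappa> \<le> 0 the level set misses the
      sphere.\<close>
    define \<kappa> where "\<kappa> = ((c / u) powr (2 / 3) - (1 - r)\<^sup>2) / r"
    have iff: "u < kP r x y \<longleftrightarrow> (norm (x - y))\<^sup>2 < \<kappa>" if y: "y \<in> S2" for y
    proof -
      have "u < kP r x y \<longleftrightarrow> u < c * qd r x y powr (- 3 / 2)"
        by (simp add: kP_def kpow_def c_def)
      also have "\<dots> \<longleftrightarrow> qd r x y < (c / u) powr (2 / 3)"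
        using qd_pos[OF x y, of r] r c True by (intro powr_less_level) auto
      also have "\<dots> \<longleftrightarrow> (norm (x - y))\<^sup>2 < \<kappa>"
        using r by (simp add: \<kappa>_def qd_sphere[OF x y] field_simps)
      finally show ?thesis .
    qed
    show ?thesis
    proof (cases "\<kappa> > 0")
      case True': True
      have "indicator {0<..<kP r x y} u = (indicator (ball x (sqrt \<kappa>)) y :: ennreal)" if "y \<in> S2" for y
      proof -
        have "(norm (x - y))\<^sup>2 < \<kappa> \<longleftrightarrow> norm (x - y) < sqrt \<kappa>"
          using True' by (metis norm_ge_zero real_less_rsqrt real_sqrt_less_iff real_sqrt_unique)
        then show ?thesis using iff[OF that] True by (auto simp: indicator_def dist_norm)
      qed
      then have "AE y in sg. indicator {0<..<kP r x y} u = (indicator (ball x (sqrt \<kappa>)) y :: ennreal)"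
        using AE_sphere_measure_sphere by (auto elim!: AE_mp)
      then have eq: "(\<integral>\<^sup>+y. indicator {0<..<kP r x y} u * g y \<partial>sg) = (\<integral>\<^sup>+y\<in>ball x (sqrt \<kappa>). g y \<partial>sg)" for g :: "real^3 \<Rightarrow> ennreal"
        by (intro nn_integral_cong_AE) (auto simp: mult.commute)
      show ?thesis using le[of "sqrt \<kappa>"] True' unfolding eq by simp
    next
      case False
      have "AE y in sg. indicator {0<..<kP r x y} u = (0 :: ennreal)"
        using AE_sphere_measure_sphere
      proof eventually_elim
        case (elim y)
        have "\<not> (norm (x - y))\<^sup>2 < \<kappa>" using False by (metis less_le_trans not_less zero_le_power2 order_trans)
        then show ?case using iff[OF elim] by (simp add: indicator_def)
      qed
      then have "(\<integral>\<^sup>+y. indicator {0<..<kP r x y} u * h y \<partial>sg) = (\<integral>\<^sup>+y. 0 \<partial>sg)"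
        by (intro nn_integral_cong_AE) auto
      then show ?thesis by simp
    qed
  qed simp
  have "(\<integral>\<^sup>+y. ennreal (kP r x y) * h y \<partial>sg)
      \<le> (\<integral>\<^sup>+u. \<alpha> * (\<integral>\<^sup>+y. indicator {0<..<kP r x y} u * 1 \<partial>sg) \<partial>lborel)"
    unfolding layer[OF assms(4)] by (intro nn_integral_mono slice)
  also have "\<dots> = \<alpha> * (\<integral>\<^sup>+u. (\<integral>\<^sup>+y. indicator {0<..<kP r x y} u * 1 \<partial>sg) \<partial>lborel)"
    using sphere.borel_measurable_nn_integral[OF L_meas[of "\<lambda>_. 1"]]
    by (intro nn_integral_cmult) simp
  also have "(\<integral>\<^sup>+u. (\<integral>\<^sup>+y. indicator {0<..<kP r x y} u * 1 \<partial>sg) \<partial>lborel) = (\<integral>\<^sup>+y. ennreal (kP r x y) * 1 \<partial>sg)"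
    by (rule layer[symmetric]) simp
  also have "\<dots> = ennreal (LINT y|sg. kP r x y)"
    using integrable_kernels(6)[OF x, of r] r kP_nonneg[of r]
    by (subst nn_integral_eq_integral[symmetric]) auto
  also have "\<dots> = 1" using kP_integral[OF x, of r] r by simp
  finally show ?thesis by simp
qed

lemma integrable_kP_mult:
  fixes f :: "real^3 \<Rightarrow> real"
  assumes x: "x \<in> S2" and r: "0 < r" "r < 1" and f: "integrable sg f"
  shows "integrable sg (\<lambda>y. kP r x y * f y)"
proof -
  have [measurable]: "f \<in> borel_measurable borel" using borel_measurable_integrable[OF f] by simp
  have "continuous_on S2 (\<lambda>y. kP r x y)" using x r by (auto intro!: continuous_intros)
  from compact_imp_bounded[OF compact_continuous_image[OF this]]
  obtain K where K: "\<forall>y\<in>S2. \<bar>kP r x y\<bar> \<le> K" by (auto simp: bounded_iff)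
  show ?thesis
  proof (rule Bochner_Integration.integrable_bound)
    show "integrable sg (\<lambda>y. K * f y)" using f by simp
    show "AE y in sg. norm (kP r x y * f y) \<le> norm (K * f y)"
      using AE_sphere_measure_sphere
    proof eventually_elim
      case (elim y)
      then have "\<bar>kP r x y\<bar> \<le> \<bar>K\<bar>" using K by fastforce
      then show ?case by (simp add: abs_mult mult_right_mono)
    qed
  qed measurable
qed

text \<open>f is compared with a continuous g that is close in mean, and h = |f - g|. The Poisson
  integral of |f - f x| is at most that of h, plus that of |g - g x|, plus h x. The first is small
  off a set controlled by the maximal function, the second by continuity, the third off a set
  controlled by Markov's inequality.\<close>

theorem kP_lebesgue_points:
  fixes f :: "real^3 \<Rightarrow> 'b::euclidean_space"
  assumes f: "integrable sg f"
  shows "AE x in sg. ((\<lambda>r. LINT y|sg. kP r x y * norm (f y - f x)) \<longlongrightarrow> 0) (at_left 1)"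
proof -
  define \<Phi> where "\<Phi> r x = (LINT y|sg. kP r x y * norm (f y - f x))" for r x
  have [measurable]: "f \<in> borel_measurable borel" using borel_measurable_integrable[OF f] by simp
  have cover: "\<exists>V\<in>sets borel. {x \<in> S2. \<not> (\<forall>\<^sub>F r in at_left 1. \<Phi> r x \<le> 3 * e)} \<subseteq> V \<and> emeasure sg V \<le> ennreal d"
    if e: "e > 0" and d: "d > 0" for e d
  proof -
    \<comment> \<open>Any denominator of at least 32400 works: the weak type set then has measure at
      most 16200 \<eta> / e \<le> d / 2, and Markov's inequality leaves the other half of d.\<close>
    define \<eta> where "\<eta> = e * d / 40000"
    have \<eta>: "\<eta> > 0" using e d by (simp add: \<eta>_def)
    obtain g where g: "continuous_on UNIV g" "(LINT x|sg. norm (f x - g x)) < \<eta>"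
      using continuous_L1_approx[OF f \<eta>] by blast
    have [measurable]: "g \<in> borel_measurable borel" using g by (simp add: borel_measurable_continuous_onI)
    have gint: "integrable sg g" using g
      by (auto intro!: integrable_sphere_continuous intro: continuous_on_subset)
    define h where "h x = norm (f x - g x)" for x
    have [measurable]: "h \<in> borel_measurable borel" unfolding h_def by measurable
    have hint: "integrable sg h" unfolding h_def using f gint by auto
    have h0: "h x \<ge> 0" for x by (simp add: h_def)
    have hL: "(LINT x|sg. h x) < \<eta>" using g(2) by (simp add: h_def)
    have hI: "(\<integral>\<^sup>+x. ennreal (h x) \<partial>sg) \<le> ennreal \<eta>"
      using hL h0 nn_integral_eq_integral[OF hint] by (simp add: ennreal_leI less_imp_le)
    define N1 where "N1 = {x \<in> space sg. h x \<ge> e}"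
    have N1: "N1 \<in> sets borel" unfolding N1_def by simp
    have "emeasure sg N1 \<le> ennreal (1 / e * (LINT x|sg. h x))"
      unfolding N1_def by (rule integral_Markov_inequality[OF hint]) (use h0 e in auto)
    also have "\<dots> \<le> ennreal (d / 2)"
    proof (intro ennreal_leI)
      have "(LINT x|sg. h x) \<le> e * d / 2"
        using hL mult_pos_pos[OF e d] unfolding \<eta>_def by linarith
      then show "1 / e * (LINT x|sg. h x) \<le> d / 2" using e by (simp add: field_simps)
    qed
    finally have N1': "emeasure sg N1 \<le> ennreal (d / 2)" .
    define E where "E = {x \<in> S2. \<exists>\<rho>>0. ennreal e * emeasure sg (ball x \<rho>) < (\<integral>\<^sup>+y\<in>ball x \<rho>. ennreal (h y) \<partial>sg)}"
    obtain U where U: "U \<in> sets borel" "E \<subseteq> U" "ennreal e * emeasure sg U \<le> 16200 * (\<integral>\<^sup>+y. ennreal (h y) \<partial>sg)"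
    proof -
      have "\<exists>U\<in>sets borel. E \<subseteq> U \<and> ennreal e * emeasure sg U \<le> 16200 * (\<integral>\<^sup>+y. ennreal (h y) \<partial>sg)"
        by (rule maximal_weak_type) (unfold E_def, simp, blast, blast)
      then show ?thesis using that by blast
    qed
    have "ennreal (e * measure sg U) = ennreal e * emeasure sg U"
      using e by (simp add: sphere.emeasure_eq_measure ennreal_mult)
    also have "\<dots> \<le> 16200 * (\<integral>\<^sup>+y. ennreal (h y) \<partial>sg)" by (rule U(3))
    also have "\<dots> \<le> 16200 * ennreal \<eta>" using hI by (rule mult_left_mono) simp
    also have "\<dots> = ennreal (16200 * \<eta>)" by (subst ennreal_mult') simp_all
    finally have "e * measure sg U \<le> 16200 * \<eta>" using \<eta> by (simp add: ennreal_le_iff)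
    then have U': "emeasure sg U \<le> ennreal (d / 2)"
      using e d by (simp add: \<eta>_def field_simps sphere.emeasure_eq_measure)
    have "{x \<in> S2. \<not> (\<forall>\<^sub>F r in at_left 1. \<Phi> r x \<le> 3 * e)} \<subseteq> N1 \<union> U"
    proof (rule subsetI, rule ccontr)
      fix x assume "x \<in> {x \<in> S2. \<not> (\<forall>\<^sub>F r in at_left 1. \<Phi> r x \<le> 3 * e)}" and nx: "x \<notin> N1 \<union> U"
      then have x: "x \<in> S2" and bad: "\<not> (\<forall>\<^sub>F r in at_left 1. \<Phi> r x \<le> 3 * e)" by auto
      have hx: "h x < e" using nx by (auto simp: N1_def)
      \<comment> \<open>Off U all cap averages of h about x are at most e, which is the hypothesis
        of \<open>kP_maximal\<close>.\<close>
      have mx: "(\<integral>\<^sup>+y\<in>ball x \<rho>. ennreal (h y) \<partial>sg) \<le> ennreal e * emeasure sg (ball x \<rho>)" if "\<rho> > 0" for \<rho>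
      proof (rule ccontr)
        assume "\<not> ?thesis"
        then have "x \<in> E" unfolding E_def not_le using x that by blast
        then show False using nx U(2) by blast
      qed
      have "((\<lambda>r. LINT y|sg. kP r x y * norm (g y - g x)) \<longlongrightarrow> norm (g x - g x)) (at_left 1)"
        by (rule kP_tendsto[OF x]) (use g in \<open>auto intro!: continuous_intros intro: continuous_on_subset\<close>)
      then have ev: "\<forall>\<^sub>F r in at_left 1. (LINT y|sg. kP r x y * norm (g y - g x)) < e"
        using e by (intro order_tendstoD(2)) auto
      have "\<forall>\<^sub>F r in at_left 1. \<Phi> r x \<le> 3 * e"
        using ev eventually_at_left_real[of 0 "1::real", OF zero_less_one]
      proof eventually_elim
        case (elim r)
        then have r: "0 < r" "r < 1" by auto
        have P0: "kP r x y \<ge> 0" for y using r by (intro kP_nonneg) auto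
        note int = integrable_kP_mult[OF x r]
        have i1: "integrable sg (\<lambda>y. kP r x y * h y)" by (rule int[OF hint])
        have i2: "integrable sg (\<lambda>y. kP r x y * norm (g y - g x))" by (rule int) (use gint in auto)
        have i3: "integrable sg (\<lambda>y. kP r x y * norm (f y - f x))" by (rule int) (use f in auto)
        have i4: "integrable sg (\<lambda>y. kP r x y * h x)" by (rule int) auto
        have "\<Phi> r x \<le> (LINT y|sg. kP r x y * h y + kP r x y * norm (g y - g x) + kP r x y * h x)"
          unfolding \<Phi>_def
        proof (rule integral_mono)
          fix y
          have "norm (f y - f x) \<le> h y + norm (g y - g x) + h x"
            unfolding h_def using norm_triangle_ineq[of "f y - g y" "(g y - g x) + (g x - f x)"]
              norm_triangle_ineq[of "g y - g x" "g x - f x"] norm_minus_commute[of "g x" "f x"]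
            by (simp add: algebra_simps)
          then show "kP r x y * norm (f y - f x) \<le> kP r x y * h y + kP r x y * norm (g y - g x) + kP r x y * h x"
            using P0[of y] by (simp add: mult_left_mono flip: distrib_left)
        qed (use i1 i2 i3 i4 in auto)
        also have "\<dots> = (LINT y|sg. kP r x y * h y) + (LINT y|sg. kP r x y * norm (g y - g x)) + h x"
          using i1 i2 i4 kP_integral[OF x, of r] r integrable_kernels(6)[OF x, of r] by simp
        also have "(LINT y|sg. kP r x y * h y) \<le> e"
        proof -
          have "(\<integral>\<^sup>+y. ennreal (kP r x y * h y) \<partial>sg) \<le> ennreal e"
            using kP_maximal[OF x r _ mx] P0 h0 by (simp add: ennreal_mult)
          then show ?thesis
            using nn_integral_eq_integral[OF i1] P0 h0 e by (simp add: ennreal_le_iff)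
        qed
        finally show ?case using elim hx by linarith
      qed
      then show False using bad by simp
    qed
    moreover have "emeasure sg (N1 \<union> U) \<le> ennreal d"
    proof -
      have "emeasure sg (N1 \<union> U) \<le> emeasure sg N1 + emeasure sg U"
        using N1 U(1) by (intro emeasure_subadditive) auto
      also have "\<dots> \<le> ennreal (d / 2) + ennreal (d / 2)" using N1' U' by (rule add_mono)
      also have "\<dots> = ennreal d" using d by (subst ennreal_plus[symmetric]) auto
      finally show ?thesis .
    qed
    ultimately show ?thesis using N1 U(1) by blast
  qed
  have ae: "AE x in sg. \<forall>\<^sub>F r in at_left 1. \<Phi> r x \<le> 3 * e" if e: "e > 0" for e
  proof -
    \<comment> \<open>The exceptional set is known only through Borel covers of small measure. The
      intersection of a sequence of such covers is a Borel null set containing it.\<close>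
    have "\<exists>V. \<forall>n. V n \<in> sets borel \<and> {x \<in> S2. \<not> (\<forall>\<^sub>F r in at_left 1. \<Phi> r x \<le> 3 * e)} \<subseteq> V n
        \<and> emeasure sg (V n) \<le> ennreal (1 / Suc n)"
      using cover[OF e, of "1 / Suc n" for n] by (intro choice) (auto simp: Bex_def)
    then obtain V where V: "\<And>n::nat. V n \<in> sets borel" "\<And>n. {x \<in> S2. \<not> (\<forall>\<^sub>F r in at_left 1. \<Phi> r x \<le> 3 * e)} \<subseteq> V n"
        "\<And>n. emeasure sg (V n) \<le> ennreal (1 / Suc n)" by blast
    have "emeasure sg (\<Inter>n. V n) \<le> 0"
    proof (rule LIMSEQ_le_const)
      show "(\<lambda>n. ennreal (1 / Suc n)) \<longlonglongrightarrow> 0"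
        using tendsto_ennrealI[OF LIMSEQ_inverse_real_of_nat] by (simp add: divide_inverse)
      have "emeasure sg (\<Inter>n. V n) \<le> emeasure sg (V n)" for n
        using V(1) by (intro emeasure_mono) auto
      then show "\<exists>N. \<forall>n\<ge>N. emeasure sg (\<Inter>n. V n) \<le> ennreal (1 / Suc n)"
        using V(3) order_trans by blast
    qed
    then have "AE x in sg. x \<notin> (\<Inter>n. V n)"
      using V(1) by (intro AE_not_in null_setsI) auto
    then show ?thesis
      using AE_sphere_measure_sphere by eventually_elim (use V(2) in blast)
  qed
  have "AE x in sg. \<forall>k::nat. \<forall>\<^sub>F r in at_left 1. \<Phi> r x \<le> 3 * (1 / Suc k)"
    unfolding AE_all_countable by (intro allI ae) simp
  then show ?thesis
  proof eventually_elim
    case (elim x)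
    show ?case unfolding \<Phi>_def[symmetric]
    proof (rule tendstoI)
      fix e :: real assume "e > 0"
      then obtain k where k: "1 / Suc k < e / 3"
        using reals_Archimedean[of "e / 3"] by (auto simp: inverse_eq_divide)
      have "\<forall>\<^sub>F r in at_left 1. \<Phi> r x \<le> 3 * (1 / Suc k)" using elim by blast
      then show "\<forall>\<^sub>F r in at_left 1. dist (\<Phi> r x) 0 < e"
        using eventually_at_left_real[of 0 "1::real", OF zero_less_one]
      proof eventually_elim
        case (elim r)
        have "\<Phi> r x \<ge> 0"
          unfolding \<Phi>_def using elim by (intro integral_nonneg_AE AE_I2 mult_nonneg_nonneg kP_nonneg) auto
        then show ?case using elim k by simp
      qed
    qed
  qed
qed

subsection \<open>Integral operators on the sphere\<close>

lemma sphere_Fubini: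
  fixes F :: "real^3 \<Rightarrow> real^3 \<Rightarrow> 'b::euclidean_space"
  assumes F [measurable]: "(\<lambda>p. F (fst p) (snd p)) \<in> borel_measurable borel"
    and le: "\<And>y z. y \<in> S2 \<Longrightarrow> z \<in> S2 \<Longrightarrow> norm (F y z) \<le> g y * h z"
    and g: "integrable sg g" and h: "integrable sg h"
  shows "(LINT y|sg. (LINT z|sg. F y z)) = (LINT z|sg. (LINT y|sg. F y z))"
proof -
  interpret P: pair_sigma_finite sg sg
    by (simp add: pair_sigma_finite_def sphere.sigma_finite_measure_axioms)
  have sets: "sets (sg \<Otimes>\<^sub>M sg) = sets (borel :: ((real^3) \<times> (real^3)) measure)"
    by (simp add: borel_prod[symmetric] cong: sets_pair_measure_cong)
  have F': "(\<lambda>(y, z). F y z) \<in> borel_measurable (sg \<Otimes>\<^sub>M sg)"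
    using F by (simp add: case_prod_beta measurable_cong_sets[OF sets refl])
  have "integrable (sg \<Otimes>\<^sub>M sg) (\<lambda>(y, z). F y z)"
  proof (rule P.Fubini_integrable[OF F'])
    have [measurable]: "(\<lambda>z. F y z) \<in> borel_measurable borel" for y
      using measurable_compose[OF _ F, of "Pair y"] by simp
    have le': "norm (LINT z|sg. norm (F y z)) \<le> \<bar>g y\<bar> * (LINT z|sg. \<bar>h z\<bar>)" if y: "y \<in> S2" for y
    proof -
      have "(LINT z|sg. norm (F y z)) \<le> (LINT z|sg. \<bar>g y\<bar> * \<bar>h z\<bar>)"
      proof (rule integral_mono_AE')
        show "AE z in sg. norm (F y z) \<le> \<bar>g y\<bar> * \<bar>h z\<bar>"
          using AE_sphere_measure_sphere
        proof eventually_elim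
          case (elim z)
          have "norm (F y z) \<le> g y * h z" using le[OF y elim] .
          also have "\<dots> \<le> \<bar>g y\<bar> * \<bar>h z\<bar>" by (metis abs_ge_self abs_mult)
          finally show ?case .
        qed
      qed (use h in auto)
      also have "\<dots> = \<bar>g y\<bar> * (LINT z|sg. \<bar>h z\<bar>)" by simp
      finally show ?thesis by simp
    qed
    show "integrable sg (\<lambda>x. LINT y|sg. norm (case (x, y) of (y, z) \<Rightarrow> F y z))"
    proof (rule Bochner_Integration.integrable_bound)
      show "integrable sg (\<lambda>y. \<bar>g y\<bar> * (LINT z|sg. \<bar>h z\<bar>))" using g by simp
      show "(\<lambda>x. LINT y|sg. norm (case (x, y) of (y, z) \<Rightarrow> F y z)) \<in> borel_measurable sg"
        using F' by (intro sphere.borel_measurable_lebesgue_integral) (auto simp: case_prod_beta)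
      show "AE x in sg. norm (LINT y|sg. norm (case (x, y) of (y, z) \<Rightarrow> F y z)) \<le> norm (\<bar>g x\<bar> * (LINT z|sg. \<bar>h z\<bar>))"
        using AE_sphere_measure_sphere
      proof eventually_elim
        case (elim x)
        then show ?case using le'[OF elim] by (simp add: abs_mult)
      qed
    qed
    show "AE x in sg. integrable sg (\<lambda>y. case (x, y) of (y, z) \<Rightarrow> F y z)"
      using AE_sphere_measure_sphere
    proof eventually_elim
      case (elim y)
      have "integrable sg (F y)"
      proof (rule Bochner_Integration.integrable_bound)
        show "integrable sg (\<lambda>z. g y * h z)" using h by simp
        show "AE z in sg. norm (F y z) \<le> norm (g y * h z)"
          using AE_sphere_measure_sphere
          by eventually_elim (use le[OF elim] in \<open>auto intro: order_trans[OF _ abs_ge_self]\<close>)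
      qed simp
      then show ?case by simp
    qed
  qed
  from P.Fubini_integral[OF this] show ?thesis by simp
qed

text \<open>Measurability is joint in both points and the spinor, so that arbitrary measurable
  functions can be substituted. The bound is asked on the sphere only, since off it
  \<open>qd\<close> has no positive lower bound.\<close>

definition kernel :: "(real^3 \<Rightarrow> real^3 \<Rightarrow> spinor \<Rightarrow> spinor) \<Rightarrow> bool" where
  "kernel K \<longleftrightarrow> (\<forall>x y. bounded_linear (K x y))
     \<and> (\<lambda>p. K (fst p) (fst (snd p)) (snd (snd p))) \<in> borel_measurable borel
     \<and> (\<exists>C. \<forall>x\<in>S2. \<forall>y\<in>S2. \<forall>v. norm (K x y v) \<le> C * norm v)"

definition kop :: "(real^3 \<Rightarrow> real^3 \<Rightarrow> spinor \<Rightarrow> spinor) \<Rightarrow> (real^3 \<Rightarrow> spinor) \<Rightarrow> real^3 \<Rightarrow> spinor" where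
  "kop K f x = (LINT y|sg. K x y (f y))"

lemma kernel_measurable:
  assumes "kernel K" "f \<in> borel_measurable M" "g \<in> borel_measurable M" "v \<in> borel_measurable M"
  shows "(\<lambda>t. K (f t) (g t) (v t)) \<in> borel_measurable M"
proof -
  have "(\<lambda>t. (f t, g t, v t)) \<in> borel_measurable M"
    using assms(2-4) by (intro borel_measurable_Pair)
  from measurable_compose[OF this, of "\<lambda>p. K (fst p) (fst (snd p)) (snd (snd p))"] assms(1)
  show ?thesis by (simp add: kernel_def)
qed

lemma kernel_bound:
  assumes "kernel K"
  shows "\<exists>C\<ge>0. \<forall>x\<in>S2. \<forall>y\<in>S2. \<forall>v. norm (K x y v) \<le> C * norm v"
proof -
  obtain C where C: "\<forall>x\<in>S2. \<forall>y\<in>S2. \<forall>v. norm (K x y v) \<le> C * norm v"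
    using assms by (auto simp: kernel_def)
  show ?thesis
  proof (intro exI[of _ "\<bar>C\<bar>"] conjI ballI allI)
    fix x y v assume "x \<in> S2" "y \<in> S2"
    then have "norm (K x y v) \<le> C * norm v" using C by blast
    also have "\<dots> \<le> \<bar>C\<bar> * norm v" by (intro mult_right_mono) auto
    finally show "norm (K x y v) \<le> \<bar>C\<bar> * norm v" .
  qed simp
qed

lemma kernel_integrable:
  assumes K: "kernel K" and x: "x \<in> S2" and f: "integrable sg f"
  shows "integrable sg (\<lambda>y. K x y (f y))"
proof -
  have [measurable]: "f \<in> borel_measurable borel" using borel_measurable_integrable[OF f] by simp
  obtain C where C: "C \<ge> 0" "\<And>x y v. x \<in> S2 \<Longrightarrow> y \<in> S2 \<Longrightarrow> norm (K x y v) \<le> C * norm v"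
    using kernel_bound[OF K] by blast
  show ?thesis
  proof (rule Bochner_Integration.integrable_bound)
    show "integrable sg (\<lambda>y. C *\<^sub>R f y)" using f by simp
    show "(\<lambda>y. K x y (f y)) \<in> borel_measurable sg" by (intro kernel_measurable[OF K]) auto
    show "AE y in sg. norm (K x y (f y)) \<le> norm (C *\<^sub>R f y)"
      using AE_sphere_measure_sphere by eventually_elim (use C x in auto)
  qed
qed

lemma kop_measurable:
  assumes K: "kernel K" and f: "f \<in> borel_measurable borel"
  shows "kop K f \<in> borel_measurable borel"
proof -
  have [measurable]: "f \<in> borel_measurable borel" by fact
  have "kop K f \<in> borel_measurable sg"
    unfolding kop_def[abs_def]
  proof (rule sphere.borel_measurable_lebesgue_integral)
    have "(\<lambda>p. K (fst p) (snd p) (f (snd p))) \<in> borel_measurable (sg \<Otimes>\<^sub>M sg)"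
      by (intro kernel_measurable[OF K]) measurable
    then show "(\<lambda>(x, y). K x y (f y)) \<in> borel_measurable (sg \<Otimes>\<^sub>M sg)"
      by (simp add: case_prod_beta)
  qed
  then show ?thesis by simp
qed

lemma kop_bound:
  assumes K: "\<And>y v. y \<in> S2 \<Longrightarrow> norm (K x y v) \<le> C * norm v"
    and f: "integrable sg f"
  shows "norm (kop K f x) \<le> C * (LINT y|sg. norm (f y))"
proof -
  have "norm (kop K f x) \<le> (LINT y|sg. norm (K x y (f y)))"
    unfolding kop_def by (rule integral_norm_bound)
  also have "\<dots> \<le> (LINT y|sg. C * norm (f y))"
  proof (rule integral_mono_AE')
    show "AE y in sg. norm (K x y (f y)) \<le> C * norm (f y)"
      using AE_sphere_measure_sphere by eventually_elim (rule K)
    show "AE y in sg. 0 \<le> C * norm (f y)"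
      using AE_sphere_measure_sphere by eventually_elim (use K norm_ge_zero order_trans in blast)
  qed (use f in auto)
  finally show ?thesis by simp
qed

lemma kop_bounded:
  assumes K: "kernel K" and f: "integrable sg f"
  shows "\<exists>B. \<forall>x\<in>S2. norm (kop K f x) \<le> B"
proof -
  obtain C where C: "C \<ge> 0" "\<And>x y v. x \<in> S2 \<Longrightarrow> y \<in> S2 \<Longrightarrow> norm (K x y v) \<le> C * norm v"
    using kernel_bound[OF K] by blast
  show ?thesis using kop_bound[of K _ C f] C f by blast
qed

lemma kop_integrable:
  assumes K: "kernel K" and f: "integrable sg f"
  shows "integrable sg (kop K f)"
proof -
  obtain B where "\<And>x. x \<in> S2 \<Longrightarrow> norm (kop K f x) \<le> B" using kop_bounded[OF assms] by blast
  then show ?thesis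
    using kop_measurable[OF K, of f] borel_measurable_integrable[OF f]
    by (intro integrable_sphere_bounded) auto
qed

text \<open>Fubini lifts composition identities for kernels, known on fixed spinors, to operators on
  integrable functions. The result holds at every point of the sphere, not merely almost
  everywhere.\<close>

lemma kop_kop:
  assumes K: "kernel K" and L: "kernel L" and M: "kernel M"
    and comp: "\<And>z b. z \<in> S2 \<Longrightarrow> (LINT y|sg. K x y (L y z b)) = M x z b"
    and x: "x \<in> S2" and f: "integrable sg f"
  shows "kop K (kop L f) x = kop M f x"
proof -
  have [measurable]: "f \<in> borel_measurable borel" using borel_measurable_integrable[OF f] by simp
  obtain C where C: "C \<ge> 0" "\<And>x y v. x \<in> S2 \<Longrightarrow> y \<in> S2 \<Longrightarrow> norm (K x y v) \<le> C * norm v"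
    using kernel_bound[OF K] by blast
  obtain D where D: "D \<ge> 0" "\<And>x y v. x \<in> S2 \<Longrightarrow> y \<in> S2 \<Longrightarrow> norm (L x y v) \<le> D * norm v"
    using kernel_bound[OF L] by blast
  have "kop K (kop L f) x = (LINT y|sg. (LINT z|sg. K x y (L y z (f z))))"
    unfolding kop_def
  proof (rule integral_sphere_cong)
    show "K x y (LINT z|sg. L y z (f z)) = (LINT z|sg. K x y (L y z (f z)))" if "y \<in> S2" for y
      using kernel_integrable[OF L that f] K
      by (intro integral_bounded_linear[symmetric]) (auto simp: kernel_def)
    have "kop L f \<in> borel_measurable borel" by (rule kop_measurable[OF L]) simp
    then have [measurable]: "(\<lambda>y. LINT z|sg. L y z (f z)) \<in> borel_measurable borel"
      by (simp add: kop_def[abs_def])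
    show "(\<lambda>y. K x y (LINT z|sg. L y z (f z))) \<in> borel_measurable borel"
      by (intro kernel_measurable[OF K]) auto
    have "(\<lambda>y. LINT z|sg. K x y (L y z (f z))) \<in> borel_measurable sg"
      by (rule sphere.borel_measurable_lebesgue_integral, unfold case_prod_beta,
        intro kernel_measurable[OF K] kernel_measurable[OF L]) measurable
    then show "(\<lambda>y. LINT z|sg. K x y (L y z (f z))) \<in> borel_measurable borel" by simp
  qed
  also have "\<dots> = (LINT z|sg. (LINT y|sg. K x y (L y z (f z))))"
  proof (rule sphere_Fubini[where g = "\<lambda>_. C * D" and h = "\<lambda>z. norm (f z)"])
    show "(\<lambda>p. K x (fst p) (L (fst p) (snd p) (f (snd p)))) \<in> borel_measurable borel"
      by (intro kernel_measurable[OF K] kernel_measurable[OF L]) (auto simp: borel_prod[symmetric])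
    show "norm (K x y (L y z (f z))) \<le> C * D * norm (f z)" if "y \<in> S2" "z \<in> S2" for y z
    proof -
      have "norm (K x y (L y z (f z))) \<le> C * norm (L y z (f z))" by (rule C(2)[OF x that(1)])
      also have "\<dots> \<le> C * (D * norm (f z))" using D(2)[OF that] C(1) by (rule mult_left_mono)
      finally show ?thesis by (simp add: mult.assoc)
    qed
  qed (use f in auto)
  also have "\<dots> = kop M f x"
    unfolding kop_def
  proof (rule integral_sphere_cong)
    have "(\<lambda>z. LINT y|sg. K x y (L y z (f z))) \<in> borel_measurable sg"
      by (rule sphere.borel_measurable_lebesgue_integral, unfold case_prod_beta,
        intro kernel_measurable[OF K] kernel_measurable[OF L]) measurable
    then show "(\<lambda>z. LINT y|sg. K x y (L y z (f z))) \<in> borel_measurable borel" by simp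
    show "(\<lambda>z. M x z (f z)) \<in> borel_measurable borel"
      by (intro kernel_measurable[OF M]) auto
  qed (rule comp)
  finally show ?thesis .
qed

lemma kop_adjoint:
  assumes K: "kernel K" and sym: "\<And>x y a b. K x y a \<bullet> b = a \<bullet> K y x b"
    and f: "integrable sg f" and g: "integrable sg g"
  shows "(LINT x|sg. kop K f x \<bullet> g x) = (LINT x|sg. f x \<bullet> kop K g x)"
proof -
  have [measurable]: "f \<in> borel_measurable borel" "g \<in> borel_measurable borel"
    using borel_measurable_integrable[OF f] borel_measurable_integrable[OF g] by auto
  obtain C where C: "C \<ge> 0" "\<And>x y v. x \<in> S2 \<Longrightarrow> y \<in> S2 \<Longrightarrow> norm (K x y v) \<le> C * norm v"
    using kernel_bound[OF K] by blast
  have meas: "(\<lambda>p. K (fst p) (snd p) (f (snd p)) \<bullet> g (fst p)) \<in> borel_measurable borel"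
    by (intro borel_measurable_inner kernel_measurable[OF K]) (auto simp: borel_prod[symmetric])
  have meas2: "(\<lambda>x. LINT y|sg. K x y (f y) \<bullet> g x) \<in> borel_measurable borel"
  proof -
    have "(\<lambda>x. LINT y|sg. K x y (f y) \<bullet> g x) \<in> borel_measurable sg"
      by (rule sphere.borel_measurable_lebesgue_integral, unfold case_prod_beta,
        intro borel_measurable_inner kernel_measurable[OF K]) measurable
    then show ?thesis by simp
  qed
  have meas3: "(\<lambda>y. LINT x|sg. K x y (f y) \<bullet> g x) \<in> borel_measurable borel"
  proof -
    have "(\<lambda>y. LINT x|sg. K x y (f y) \<bullet> g x) \<in> borel_measurable sg"
      by (rule sphere.borel_measurable_lebesgue_integral, unfold case_prod_beta,
        intro borel_measurable_inner kernel_measurable[OF K]) measurable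
    then show ?thesis by simp
  qed
  note [measurable] = kop_measurable[OF K]
  have "(LINT x|sg. kop K f x \<bullet> g x) = (LINT x|sg. (LINT y|sg. K x y (f y) \<bullet> g x))"
  proof (rule integral_sphere_cong)
    show "kop K f x \<bullet> g x = (LINT y|sg. K x y (f y) \<bullet> g x)" if "x \<in> S2" for x
      unfolding kop_def using kernel_integrable[OF K that f] by simp
  qed (use meas2 in auto)
  also have "\<dots> = (LINT y|sg. (LINT x|sg. K x y (f y) \<bullet> g x))"
  proof (rule sphere_Fubini[where g = "\<lambda>x. C * norm (g x)" and h = "\<lambda>y. norm (f y)"])
    show "norm (K y z (f z) \<bullet> g y) \<le> C * norm (g y) * norm (f z)" if "y \<in> S2" "z \<in> S2" for y z
    proof -
      have "norm (K y z (f z) \<bullet> g y) \<le> norm (K y z (f z)) * norm (g y)"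
        by (simp add: Cauchy_Schwarz_ineq2)
      also have "\<dots> \<le> (C * norm (f z)) * norm (g y)" using C(2)[OF that] by (intro mult_right_mono) auto
      finally show ?thesis by (simp add: mult_ac)
    qed
  qed (use f g meas in auto)
  also have "\<dots> = (LINT y|sg. f y \<bullet> kop K g y)"
  proof (rule integral_sphere_cong)
    show "(LINT x|sg. K x y (f y) \<bullet> g x) = f y \<bullet> kop K g y" if "y \<in> S2" for y
      unfolding kop_def using kernel_integrable[OF K that g] by (simp add: sym)
  qed (use meas3 in auto)
  finally show ?thesis .
qed

section \<open>The Cauchy kernels as bounded operators at fixed radius\<close>

lemma kpow_bound:
  assumes "x \<in> S2" "y \<in> S2" "0 < r" "r < 1"
  shows "kpow 3 r x y \<le> ((1 - r)\<^sup>2) powr (- 3 / 2)"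
proof -
  have "(1 - r)\<^sup>2 \<le> qd r x y" unfolding qd_sphere[OF assms(1,2)] using assms by simp
  then have "qd r x y powr (- 3 / 2) \<le> ((1 - r)\<^sup>2) powr (- 3 / 2)"
    using assms by (intro powr_mono2') auto
  moreover have "qd r x y powr (- 3 / 2) / (4 * pi) \<le> qd r x y powr (- 3 / 2)"
    using pi_gt3 divide_left_mono[of 1 "4 * pi" "qd r x y powr (- 3 / 2)"] by simp
  ultimately show ?thesis unfolding kpow_def by simp
qed

lemma norm_cross3_sphere:
  assumes "x \<in> S2" "y \<in> S2" shows "norm (cross3 x y) \<le> 1"
proof -
  have "(norm (cross3 x y))\<^sup>2 = 1 - (x \<bullet> y)\<^sup>2" using assms by (simp add: norm_cross)
  then have "(norm (cross3 x y))\<^sup>2 \<le> 1" by simp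
  then show ?thesis by (simp add: abs_square_le_1)
qed

lemma kernels_bound:
  assumes xy: "x \<in> S2" "y \<in> S2" and r: "0 < r" "r < 1"
  shows "norm (kA r x y v) \<le> 3 * ((1 - r)\<^sup>2) powr (- 3 / 2) * norm v"
    "norm (kB r x y v) \<le> 3 * ((1 - r)\<^sup>2) powr (- 3 / 2) * norm v"
proof -
  have c: "norm (clif (cross3 x y) v) \<le> norm v"
    using norm_cross3_sphere[OF xy] by (simp add: norm_clif mult_left_le_one_le)
  have t: "\<bar>x \<bullet> y\<bar> \<le> 1" by (rule abs_inner_sphere[OF xy])
  have "\<bar>r * (x \<bullet> y)\<bar> \<le> 1 * 1" unfolding abs_mult using t r by (intro mult_mono) auto
  then have rt: "\<bar>r * (x \<bullet> y)\<bar> \<le> 1" by simp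
  have *: "norm (kpow 3 r x y *\<^sub>R (a *\<^sub>R v + b *\<^sub>R clif (cross3 x y) v)) \<le> 3 * ((1 - r)\<^sup>2) powr (- 3 / 2) * norm v"
    if "\<bar>a\<bar> \<le> 2" "\<bar>b\<bar> \<le> 1" for a b
  proof -
    have "norm (a *\<^sub>R v + b *\<^sub>R clif (cross3 x y) v) \<le> \<bar>a\<bar> * norm v + \<bar>b\<bar> * norm (clif (cross3 x y) v)"
      using norm_triangle_ineq[of "a *\<^sub>R v" "b *\<^sub>R clif (cross3 x y) v"] by simp
    also have "\<dots> \<le> 2 * norm v + 1 * norm v"
      using that c by (intro add_mono mult_mono) auto
    finally have "norm (a *\<^sub>R v + b *\<^sub>R clif (cross3 x y) v) \<le> 3 * norm v" by simp
    then have "kpow 3 r x y * norm (a *\<^sub>R v + b *\<^sub>R clif (cross3 x y) v) \<le> ((1 - r)\<^sup>2) powr (- 3 / 2) * (3 * norm v)"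
      using kpow_bound[OF xy r] by (intro mult_mono) auto
    then show ?thesis by (simp add: mult_ac)
  qed
  show "norm (kA r x y v) \<le> 3 * ((1 - r)\<^sup>2) powr (- 3 / 2) * norm v"
    using *[of "x \<bullet> y - r" 1] t r by (simp add: kA_def)
  show "norm (kB r x y v) \<le> 3 * ((1 - r)\<^sup>2) powr (- 3 / 2) * norm v"
    using *[of "1 - r * (x \<bullet> y)" "- r"] rt r by (simp add: kB_def abs_le_iff)
qed

lemma kernel_kA_kB:
  assumes "0 < r" "r < 1"
  shows "kernel (kA r)" "kernel (kB r)"
  unfolding kernel_def
  by (intro conjI allI bounded_linear_kernels exI[of _ "3 * ((1 - r)\<^sup>2) powr (- 3 / 2)"] ballI
      kernels_bound assms; simp add: borel_prod[symmetric])+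

lemma kA_kB_kop:
  assumes r: "0 < r" "r < 1" and s: "0 < s" "s < 1" and x: "x \<in> S2" and f: "integrable sg f"
  shows "kop (kA r) (kop (kA s) f) x = kop (kA (r * s)) f x"
    "kop (kB r) (kop (kB s) f) x = kop (kB (r * s)) f x"
    "kop (kA r) (kop (kB s) f) x = 0"
    "kop (kB r) (kop (kA s) f) x = 0"
proof -
  have rs: "0 < r * s" "r * s < 1" using r s mult_strict_mono[of r 1 s 1] by auto
  note k = kernel_kA_kB[OF r] kernel_kA_kB[OF s] kernel_kA_kB[OF rs]
  \<comment> \<open>The mixed products compose to the zero kernel, which has to qualify as a
    \<open>kernel\<close> itself.\<close>
  have k0: "kernel (\<lambda>x y v. 0)" by (auto simp: kernel_def intro!: exI[of _ 0])
  show "kop (kA r) (kop (kA s) f) x = kop (kA (r * s)) f x"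
    by (rule kop_kop[OF k(1,3,5) kA_kA[OF x _ r s] x f])
  show "kop (kB r) (kop (kB s) f) x = kop (kB (r * s)) f x"
    by (rule kop_kop[OF k(2,4,6) kB_kB[OF x _ r s] x f])
  show "kop (kA r) (kop (kB s) f) x = 0"
    using kop_kop[OF k(1,4) k0 kA_kB[OF x _ r s] x f] by (simp add: kop_def)
  show "kop (kB r) (kop (kA s) f) x = 0"
    using kop_kop[OF k(2,3) k0 kB_kA[OF x _ r s] x f] by (simp add: kop_def)
qed

section \<open>Square integrable functions\<close>

lemma L2_iff: "f \<in> L2 sg \<longleftrightarrow> f \<in> borel_measurable borel \<and> integrable sg (\<lambda>x. (norm (f x))\<^sup>2)"
  by (simp add: L2_def cong: measurable_cong_sets)

lemma L2_imp_integrable: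
  fixes f :: "real^3 \<Rightarrow> 'b::euclidean_space"
  assumes "f \<in> L2 sg"
  shows "integrable sg f"
proof (rule Bochner_Integration.integrable_bound)
  show "integrable sg (\<lambda>x. 1 + (norm (f x))\<^sup>2)" using assms by (simp add: L2_iff)
  show "AE x in sg. norm (f x) \<le> norm (1 + (norm (f x))\<^sup>2)"
  proof (rule AE_I2)
    fix x
    have "norm (f x) \<le> 1 + (norm (f x))\<^sup>2"
      using sum_squares_bound[of "norm (f x)" 1] norm_ge_zero[of "f x"] unfolding one_power2 by linarith
    then show "norm (f x) \<le> norm (1 + (norm (f x))\<^sup>2)" by simp
  qed
qed (use assms in \<open>simp add: L2_iff cong: measurable_cong_sets\<close>)

lemma L2_inner_integrable:
  fixes f g :: "real^3 \<Rightarrow> 'b::euclidean_space"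
  assumes f: "f \<in> L2 sg" and g: "g \<in> L2 sg"
  shows "integrable sg (\<lambda>x. f x \<bullet> g x)"
proof (rule Bochner_Integration.integrable_bound)
  have [measurable]: "f \<in> borel_measurable borel" "g \<in> borel_measurable borel" using assms by (auto simp: L2_iff)
  show "integrable sg (\<lambda>x. (norm (f x))\<^sup>2 + (norm (g x))\<^sup>2)" using assms by (simp add: L2_iff)
  show "AE x in sg. norm (f x \<bullet> g x) \<le> norm ((norm (f x))\<^sup>2 + (norm (g x))\<^sup>2)"
  proof (rule AE_I2)
    fix x
    have "norm (f x \<bullet> g x) \<le> norm (f x) * norm (g x)" by (simp add: Cauchy_Schwarz_ineq2)
    also have "\<dots> \<le> (norm (f x))\<^sup>2 + (norm (g x))\<^sup>2"
      using sum_squares_bound[of "norm (f x)" "norm (g x)"] mult_nonneg_nonneg[OF norm_ge_zero norm_ge_zero, of "f x" "g x"] by linarith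
    finally show "norm (f x \<bullet> g x) \<le> norm ((norm (f x))\<^sup>2 + (norm (g x))\<^sup>2)" by simp
  qed
  show "(\<lambda>x. f x \<bullet> g x) \<in> borel_measurable sg" by simp
qed

lemma kop_L2:
  assumes K: "kernel K" and f: "integrable sg f"
  shows "kop K f \<in> L2 sg"
proof -
  have [measurable]: "kop K f \<in> borel_measurable borel"
    using kop_measurable[OF K] borel_measurable_integrable[OF f] by simp
  obtain B where B: "\<forall>x\<in>S2. norm (kop K f x) \<le> B" using kop_bounded[OF assms] by blast
  show ?thesis
    unfolding L2_iff
    by (intro conjI integrable_sphere_bounded[where K = "B\<^sup>2"]) (use B in \<open>auto intro!: power_mono\<close>)
qed

lemma L2_add:
  fixes f g :: "real^3 \<Rightarrow> 'b::euclidean_space"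
  assumes f: "f \<in> L2 sg" and g: "g \<in> L2 sg"
  shows "(\<lambda>x. a *\<^sub>R f x + b *\<^sub>R g x) \<in> L2 sg"
    and "(LINT x|sg. (norm (a *\<^sub>R f x + b *\<^sub>R g x))\<^sup>2)
      = a\<^sup>2 * (LINT x|sg. (norm (f x))\<^sup>2) + 2 * a * b * (LINT x|sg. f x \<bullet> g x) + b\<^sup>2 * (LINT x|sg. (norm (g x))\<^sup>2)"
proof -
  have eq: "(norm (a *\<^sub>R f x + b *\<^sub>R g x))\<^sup>2 = a\<^sup>2 * (norm (f x))\<^sup>2 + 2 * a * b * (f x \<bullet> g x) + b\<^sup>2 * (norm (g x))\<^sup>2" for x
    unfolding power2_norm_eq_inner inner_add_left inner_add_right inner_scaleR_left inner_scaleR_right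
    by (simp add: inner_commute[of "g x" "f x"] power2_eq_square algebra_simps)
  have int: "integrable sg (\<lambda>x. (norm (f x))\<^sup>2)" "integrable sg (\<lambda>x. (norm (g x))\<^sup>2)" "integrable sg (\<lambda>x. f x \<bullet> g x)"
    using f g L2_inner_integrable[OF f g] by (auto simp: L2_iff)
  show "(\<lambda>x. a *\<^sub>R f x + b *\<^sub>R g x) \<in> L2 sg"
    unfolding L2_iff eq using f g int by (auto simp: L2_iff)
  show "(LINT x|sg. (norm (a *\<^sub>R f x + b *\<^sub>R g x))\<^sup>2)
      = a\<^sup>2 * (LINT x|sg. (norm (f x))\<^sup>2) + 2 * a * b * (LINT x|sg. f x \<bullet> g x) + b\<^sup>2 * (LINT x|sg. (norm (g x))\<^sup>2)"
    unfolding eq using int by simp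
qed

section \<open>Sum and difference of the two families and their quadratic form\<close>

definition opS :: "real \<Rightarrow> (real^3 \<Rightarrow> spinor) \<Rightarrow> real^3 \<Rightarrow> spinor" where
  "opS r f x = kop (kA r) f x + kop (kB r) f x"

definition opD :: "real \<Rightarrow> (real^3 \<Rightarrow> spinor) \<Rightarrow> real^3 \<Rightarrow> spinor" where
  "opD r f x = kop (kA r) f x - kop (kB r) f x"

text \<open>The quadratic form of \<open>opS t\<close> at f, written out in its two parts. It is the
  common value of the pairings of \<open>opS\<close> and of \<open>opD\<close>, and its limit at t =
  1 carries the isometry.\<close>

definition chi :: "(real^3 \<Rightarrow> spinor) \<Rightarrow> real \<Rightarrow> real" where
  "chi f t = (LINT x|sg. f x \<bullet> kop (kA t) f x) + (LINT x|sg. f x \<bullet> kop (kB t) f x)"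

lemma kop_pairing:
  assumes r: "0 < r" "r < 1" and s: "0 < s" "s < 1" and f: "integrable sg f" and g: "integrable sg g"
  shows "(LINT x|sg. kop (kA r) f x \<bullet> kop (kA s) g x) = (LINT x|sg. f x \<bullet> kop (kA (r * s)) g x)"
    "(LINT x|sg. kop (kB r) f x \<bullet> kop (kB s) g x) = (LINT x|sg. f x \<bullet> kop (kB (r * s)) g x)"
    "(LINT x|sg. kop (kA r) f x \<bullet> kop (kB s) g x) = 0"
proof -
  have rs: "0 < r * s" "r * s < 1" using r s mult_strict_mono[of r 1 s 1] by auto
  note k = kernel_kA_kB[OF r] kernel_kA_kB[OF s] kernel_kA_kB[OF rs]
  have [measurable]: "f \<in> borel_measurable borel" "g \<in> borel_measurable borel"
    using borel_measurable_integrable[OF f] borel_measurable_integrable[OF g] by auto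
  note [measurable] = k[THEN kop_measurable]
  show "(LINT x|sg. kop (kA r) f x \<bullet> kop (kA s) g x) = (LINT x|sg. f x \<bullet> kop (kA (r * s)) g x)"
    unfolding kop_adjoint[OF k(1) kA_adjoint f kop_integrable[OF k(3) g]]
    by (rule integral_sphere_cong) (simp_all add: kA_kB_kop[OF r s _ g])
  show "(LINT x|sg. kop (kB r) f x \<bullet> kop (kB s) g x) = (LINT x|sg. f x \<bullet> kop (kB (r * s)) g x)"
    unfolding kop_adjoint[OF k(2) kB_adjoint f kop_integrable[OF k(4) g]]
    by (rule integral_sphere_cong) (simp_all add: kA_kB_kop[OF r s _ g])
  have "(LINT x|sg. kop (kA r) f x \<bullet> kop (kB s) g x) = (LINT x|sg. f x \<bullet> (0::spinor))"
    unfolding kop_adjoint[OF k(1) kA_adjoint f kop_integrable[OF k(4) g]]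
    by (rule integral_sphere_cong) (simp_all add: kA_kB_kop[OF r s _ g])
  then show "(LINT x|sg. kop (kA r) f x \<bullet> kop (kB s) g x) = 0" by simp
qed

lemma opS_opD_L2:
  assumes r: "0 < r" "r < 1" and f: "integrable sg f"
  shows "opS r f \<in> L2 sg" "opD r f \<in> L2 sg"
  using L2_add(1)[OF kop_L2[OF kernel_kA_kB(1)[OF r] f] kop_L2[OF kernel_kA_kB(2)[OF r] f], of 1 1]
    L2_add(1)[OF kop_L2[OF kernel_kA_kB(1)[OF r] f] kop_L2[OF kernel_kA_kB(2)[OF r] f], of 1 "-1"]
  by (simp_all add: opS_def[abs_def] opD_def[abs_def])

text \<open>The mixed terms vanish, and the sign in front of the \<open>kB\<close> part disappears
  when two such parts are paired; hence sum and difference cannot be told apart by these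
  pairings.\<close>

lemma opD_pairing:
  assumes r: "0 < r" "r < 1" and s: "0 < s" "s < 1" and f: "integrable sg f"
  shows "(LINT x|sg. opD r f x \<bullet> opD s f x) = chi f (r * s)"
    and "(LINT x|sg. opS r f x \<bullet> opS s f x) = chi f (r * s)"
proof -
  note k = kernel_kA_kB[OF r] kernel_kA_kB[OF s]
  note int = L2_inner_integrable[OF kop_L2[OF k(1) f] kop_L2[OF k(3) f]] L2_inner_integrable[OF kop_L2[OF k(1) f] kop_L2[OF k(4) f]]
    L2_inner_integrable[OF kop_L2[OF k(2) f] kop_L2[OF k(3) f]] L2_inner_integrable[OF kop_L2[OF k(2) f] kop_L2[OF k(4) f]]
  note p = kop_pairing[OF r s f f] kop_pairing[OF s r f f, unfolded mult.commute[of s r]]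
  have BA: "(LINT x|sg. kop (kB r) f x \<bullet> kop (kA s) f x) = 0"
    using p(6) by (simp add: inner_commute)
  show "(LINT x|sg. opD r f x \<bullet> opD s f x) = chi f (r * s)"
    unfolding opD_def chi_def inner_diff_left inner_diff_right using int p BA by simp
  show "(LINT x|sg. opS r f x \<bullet> opS s f x) = chi f (r * s)"
    unfolding opS_def chi_def inner_add_left inner_add_right using int p BA by simp
qed

lemma chi_square:
  assumes r: "0 < r" "r < 1" and f: "integrable sg f"
  shows "(LINT x|sg. (norm (opS r f x))\<^sup>2) = chi f (r * r)" "(LINT x|sg. (norm (opD r f x))\<^sup>2) = chi f (r * r)"
  using opD_pairing[OF r r f] by (simp_all add: power2_norm_eq_inner)

lemma kP_kop:
  assumes x: "x \<in> S2" and r: "0 < r" "r < 1" and f: "integrable sg f"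
  shows "(LINT y|sg. kP r x y *\<^sub>R f y) = r *\<^sub>R kop (kA r) f x + kop (kB r) f x"
  unfolding kP_eq kop_def
  using kernel_integrable[OF kernel_kA_kB(1)[OF r] x f] kernel_integrable[OF kernel_kA_kB(2)[OF r] x f] by simp

lemma kP_jensen:
  assumes x: "x \<in> S2" and r: "0 < r" "r < 1" and h: "integrable sg h" "integrable sg (\<lambda>y. (h y)\<^sup>2)"
  shows "(LINT y|sg. kP r x y * h y)\<^sup>2 \<le> (LINT y|sg. kP r x y * (h y)\<^sup>2)"
proof -
  define m where "m = (LINT y|sg. kP r x y * h y)"
  note int = integrable_kP_mult[OF x r h(1)] integrable_kP_mult[OF x r h(2)] integrable_kernels(6)[OF x, of r]
  have "0 \<le> (LINT y|sg. kP r x y * (h y - m)\<^sup>2)"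
    using r by (intro integral_nonneg_AE AE_I2 mult_nonneg_nonneg kP_nonneg) auto
  also have "\<dots> = (LINT y|sg. kP r x y * (h y)\<^sup>2 - 2 * m * (kP r x y * h y) + m\<^sup>2 * kP r x y)"
    by (intro Bochner_Integration.integral_cong refl) (simp add: power2_eq_square algebra_simps)
  also have "\<dots> = (LINT y|sg. kP r x y * (h y)\<^sup>2) - m\<^sup>2"
    using int r kP_integral[OF x, of r] by (simp add: m_def[symmetric] power2_eq_square)
  finally show ?thesis by (simp add: m_def)
qed

text \<open>Jensen's inequality bounds the squared Poisson integral by the Poisson integral of the
  square. Integrating in x first, symmetry and total mass one of the kernel give the norm of
  f.\<close>

lemma kP_contraction:
  assumes r: "0 < r" "r < 1" and f: "f \<in> L2 sg"
  shows "(LINT x|sg. (norm (r *\<^sub>R kop (kA r) f x + kop (kB r) f x))\<^sup>2) \<le> (LINT x|sg. (norm (f x))\<^sup>2)"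
proof -
  have fi: "integrable sg f" and f2: "integrable sg (\<lambda>x. (norm (f x))\<^sup>2)"
    using f L2_imp_integrable by (auto simp: L2_iff)
  have [measurable]: "f \<in> borel_measurable borel" using f by (simp add: L2_iff)
  note kop = kop_L2[OF kernel_kA_kB(1)[OF r] fi] kop_L2[OF kernel_kA_kB(2)[OF r] fi]
  obtain C where C: "\<And>x y. x \<in> S2 \<Longrightarrow> y \<in> S2 \<Longrightarrow> \<bar>kP r x y\<bar> \<le> C"
  proof (rule that)
    fix x y :: "real^3" assume xy: "x \<in> S2" "y \<in> S2"
    have "\<bar>kP r x y\<bar> = (1 - r\<^sup>2) * kpow 3 r x y"
      using r by (simp add: kP_def abs_mult abs_square_le_1)
    also have "\<dots> \<le> 1 * ((1 - r)\<^sup>2) powr (- 3 / 2)"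
      using kpow_bound[OF xy r] r by (intro mult_mono) auto
    finally show "\<bar>kP r x y\<bar> \<le> 1 * ((1 - r)\<^sup>2) powr (- 3 / 2)" .
  qed
  have fub: "(\<lambda>p. kP r (fst p) (snd p) * (norm (f (snd p)))\<^sup>2) \<in> borel_measurable borel"
    by (simp add: borel_prod[symmetric])
  have swap: "(LINT x|sg. (LINT y|sg. kP r x y * (norm (f y))\<^sup>2)) = (LINT y|sg. (LINT x|sg. kP r x y * (norm (f y))\<^sup>2))"
    by (rule sphere_Fubini[OF fub, where g = "\<lambda>_. C" and h = "\<lambda>y. (norm (f y))\<^sup>2"])
      (use C f2 in \<open>auto simp: abs_mult intro!: mult_right_mono\<close>)
  have meas [measurable]: "(\<lambda>x. LINT y|sg. kP r x y * (norm (f y))\<^sup>2) \<in> borel_measurable borel"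
    "(\<lambda>y. LINT x|sg. kP r x y * (norm (f y))\<^sup>2) \<in> borel_measurable borel"
  proof -
    have "(\<lambda>x. LINT y|sg. kP r x y * (norm (f y))\<^sup>2) \<in> borel_measurable sg"
      by (rule sphere.borel_measurable_lebesgue_integral) simp
    then show "(\<lambda>x. LINT y|sg. kP r x y * (norm (f y))\<^sup>2) \<in> borel_measurable borel" by simp
    have "(\<lambda>y. LINT x|sg. kP r x y * (norm (f y))\<^sup>2) \<in> borel_measurable sg"
      by (rule sphere.borel_measurable_lebesgue_integral) simp
    then show "(\<lambda>y. LINT x|sg. kP r x y * (norm (f y))\<^sup>2) \<in> borel_measurable borel" by simp
  qed
  have "(LINT x|sg. (norm (r *\<^sub>R kop (kA r) f x + kop (kB r) f x))\<^sup>2)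
      \<le> (LINT x|sg. (LINT y|sg. kP r x y * (norm (f y))\<^sup>2))"
  proof (rule integral_mono_AE)
    show "integrable sg (\<lambda>x. (norm (r *\<^sub>R kop (kA r) f x + kop (kB r) f x))\<^sup>2)"
      using L2_add(1)[OF kop, of r 1] by (simp add: L2_iff)
    show "integrable sg (\<lambda>x. LINT y|sg. kP r x y * (norm (f y))\<^sup>2)"
    proof (rule integrable_sphere_bounded)
      fix x :: "real^3" assume x: "x \<in> S2"
      have "norm (LINT y|sg. kP r x y * (norm (f y))\<^sup>2) \<le> (LINT y|sg. norm (kP r x y * (norm (f y))\<^sup>2))"
        by (rule integral_norm_bound)
      also have "\<dots> \<le> (LINT y|sg. \<bar>C\<bar> * (norm (f y))\<^sup>2)"
      proof (rule integral_mono_AE')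
        show "AE y in sg. norm (kP r x y * (norm (f y))\<^sup>2) \<le> \<bar>C\<bar> * (norm (f y))\<^sup>2"
          using AE_sphere_measure_sphere
        proof eventually_elim
          case (elim y)
          have "\<bar>kP r x y\<bar> \<le> \<bar>C\<bar>" using C[OF x elim] by simp
          then show ?case by (simp add: abs_mult mult_right_mono)
        qed
      qed (use f2 in auto)
      finally show "norm (LINT y|sg. kP r x y * (norm (f y))\<^sup>2) \<le> (LINT y|sg. \<bar>C\<bar> * (norm (f y))\<^sup>2)" .
    qed simp
    show "AE x in sg. (norm (r *\<^sub>R kop (kA r) f x + kop (kB r) f x))\<^sup>2 \<le> (LINT y|sg. kP r x y * (norm (f y))\<^sup>2)"
      using AE_sphere_measure_sphere
    proof eventually_elim
      case (elim x)
      have P0: "kP r x y \<ge> 0" for y using r by (intro kP_nonneg) auto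
      have "norm (r *\<^sub>R kop (kA r) f x + kop (kB r) f x) \<le> (LINT y|sg. norm (kP r x y *\<^sub>R f y))"
        unfolding kP_kop[OF elim r fi, symmetric] by (rule integral_norm_bound)
      then have "norm (r *\<^sub>R kop (kA r) f x + kop (kB r) f x) \<le> (LINT y|sg. kP r x y * norm (f y))"
        using P0 by simp
      then have "(norm (r *\<^sub>R kop (kA r) f x + kop (kB r) f x))\<^sup>2 \<le> (LINT y|sg. kP r x y * norm (f y))\<^sup>2"
        by (intro power_mono) auto
      also have "\<dots> \<le> (LINT y|sg. kP r x y * (norm (f y))\<^sup>2)"
        using fi f2 by (intro kP_jensen[OF elim r]) auto
      finally show ?case .
    qed
  qed
  also have "\<dots> = (LINT y|sg. (LINT x|sg. kP r x y * (norm (f y))\<^sup>2))" by (rule swap)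
  also have "\<dots> = (LINT y|sg. (norm (f y))\<^sup>2)"
  proof (rule integral_sphere_cong)
    show "(LINT x|sg. kP r x y * (norm (f y))\<^sup>2) = (norm (f y))\<^sup>2" if "y \<in> S2" for y
    proof -
      have "(LINT x|sg. kP r x y * (norm (f y))\<^sup>2) = (LINT x|sg. kP r y x * (norm (f y))\<^sup>2)"
        by (subst kP_commute) simp
      also have "\<dots> = (norm (f y))\<^sup>2"
        using integrable_kernels(6)[OF that, of r] kP_integral[OF that, of r] r by simp
      finally show ?thesis .
    qed
  qed simp_all
  finally show ?thesis .
qed

text \<open>The two parts are orthogonal, so the squared norm of the Poisson integral is r^2 |A f|^2
  + |B f|^2, while \<open>chi f (r * r)\<close> is |A f|^2 + |B f|^2. The weight r on the first part
  costs the factor r^2.\<close>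

lemma chi_upper:
  assumes r: "0 < r" "r < 1" and f: "f \<in> L2 sg"
  shows "r\<^sup>2 * chi f (r * r) \<le> (LINT x|sg. (norm (f x))\<^sup>2)"
proof -
  have fi: "integrable sg f" using f by (rule L2_imp_integrable)
  note kop = kop_L2[OF kernel_kA_kB(1)[OF r] fi] kop_L2[OF kernel_kA_kB(2)[OF r] fi]
  let ?a = "LINT x|sg. (norm (kop (kA r) f x))\<^sup>2" and ?b = "LINT x|sg. (norm (kop (kB r) f x))\<^sup>2"
  have "r\<^sup>2 \<le> 1" using r by (simp add: abs_square_le_1)
  moreover have "?b \<ge> 0" by simp
  ultimately have "r\<^sup>2 * ?b \<le> 1 * ?b" by (intro mult_right_mono) auto
  moreover have "chi f (r * r) = ?a + ?b"
    using kop_pairing[OF r r fi fi] by (simp add: chi_def power2_norm_eq_inner)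
  moreover have "r\<^sup>2 * ?a + ?b \<le> (LINT x|sg. (norm (f x))\<^sup>2)"
    using kP_contraction[OF r f] L2_add(2)[OF kop, of r 1] kop_pairing(3)[OF r r fi fi] by simp
  ultimately show ?thesis by (simp add: distrib_left)
qed

text \<open>In the sum both the scalar and the bivector coefficient contain the factor 1 - r, which
  neither kernel has by itself. This places \<open>opS\<close>, unlike \<open>opD\<close>, under the
  control of the Poisson kernel; 3 is 2 for the scalar and 1 for the bivector part.\<close>

lemma kS_bound:
  assumes xy: "x \<in> S2" "y \<in> S2" and r: "0 < r" "r < 1"
  shows "norm (kA r x y v + kB r x y v) \<le> 3 * (kP r x y * norm v)"
proof -
  have c: "norm (clif (cross3 x y) v) \<le> norm v"
    using norm_cross3_sphere[OF xy] by (simp add: norm_clif mult_left_le_one_le)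
  have "kA r x y v + kB r x y v = (kpow 3 r x y * (1 - r)) *\<^sub>R ((1 + x \<bullet> y) *\<^sub>R v + clif (cross3 x y) v)"
    by (simp add: kA_def kB_def algebra_simps)
  then have "norm (kA r x y v + kB r x y v)
      = (kpow 3 r x y * (1 - r)) * norm ((1 + x \<bullet> y) *\<^sub>R v + clif (cross3 x y) v)"
    using r by (simp add: abs_mult)
  also have "\<dots> \<le> (kpow 3 r x y * (1 - r\<^sup>2)) * (3 * norm v)"
  proof (intro mult_mono)
    have "norm ((1 + x \<bullet> y) *\<^sub>R v) \<le> 2 * norm v"
      using abs_inner_sphere[OF xy] by (auto intro!: mult_right_mono)
    then show "norm ((1 + x \<bullet> y) *\<^sub>R v + clif (cross3 x y) v) \<le> 3 * norm v"
      using norm_triangle_ineq[of "(1 + x \<bullet> y) *\<^sub>R v" "clif (cross3 x y) v"] c by linarith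
    show "1 - r \<le> 1 - r\<^sup>2" using r by (simp add: power2_eq_square mult_left_le)
  qed (use r in \<open>auto simp: abs_square_le_1\<close>)
  finally show ?thesis by (simp add: kP_def mult_ac)
qed

lemma kA_kB_integral_right:
  assumes x: "x \<in> S2" and r: "0 < r" "r < 1"
  shows "(LINT y|sg. kA r x y a) = 0" "(LINT y|sg. kB r x y a) = a"
proof -
  have int: "integrable sg (\<lambda>y. kA r x y a)" "integrable sg (\<lambda>y. kB r x y a)"
    "integrable sg (\<lambda>y. kA r y x b)" "integrable sg (\<lambda>y. kB r y x b)" for a b
    using integrable_kernels[OF x, of r] r by auto
  show "(LINT y|sg. kA r x y a) = 0"
  proof (rule vector_eq_ldot[THEN iffD1], rule allI)
    fix b
    have "b \<bullet> (LINT y|sg. kA r x y a) = (LINT y|sg. kA r y x b \<bullet> a)"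
      using int by (simp add: kA_adjoint)
    also have "\<dots> = b \<bullet> 0"
      using int kA_integral[OF x, of r b] r by simp
    finally show "b \<bullet> (LINT y|sg. kA r x y a) = b \<bullet> 0" .
  qed
  show "(LINT y|sg. kB r x y a) = a"
  proof (rule vector_eq_ldot[THEN iffD1], rule allI)
    fix b
    have "b \<bullet> (LINT y|sg. kB r x y a) = (LINT y|sg. kB r y x b \<bullet> a)"
      using int by (simp add: kB_adjoint)
    also have "\<dots> = b \<bullet> a"
      using int kB_integral[OF x, of r b] r by simp
    finally show "b \<bullet> (LINT y|sg. kB r x y a) = b \<bullet> a" .
  qed
qed

lemma kop_diff:
  assumes "kernel K" "x \<in> S2" "integrable sg f" "integrable sg g"
  shows "kop K (\<lambda>y. f y - g y) x = kop K f x - kop K g x"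
proof -
  have "linear (K x y)" for y using assms(1) by (simp add: kernel_def bounded_linear.linear)
  then show ?thesis
    unfolding kop_def using kernel_integrable[OF assms(1,2)] assms(3,4) by (simp add: linear_diff)
qed

text \<open>The \<open>kA\<close> operator annihilates constants and the \<open>kB\<close> operator
  reproduces them, so the error at x is \<open>opS\<close> applied to f - f x, and the kernel bound
  reduces it to Lebesgue points.\<close>

lemma opS_tendsto_AE:
  assumes f: "integrable sg f"
  shows "AE x in sg. ((\<lambda>r. opS r f x) \<longlongrightarrow> f x) (at_left 1)"
  using kP_lebesgue_points[OF f] AE_sphere_measure_sphere
proof eventually_elim
  case (elim x)
  let ?\<Phi> = "\<lambda>r. LINT y|sg. kP r x y * norm (f y - f x)"
  have "((\<lambda>r. opS r f x - f x) \<longlongrightarrow> 0) (at_left 1)"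
  proof (rule Lim_null_comparison)
    show "((\<lambda>r. 3 * ?\<Phi> r) \<longlongrightarrow> 0) (at_left 1)"
      using tendsto_mult_left[OF elim(1), of 3] by simp
    show "\<forall>\<^sub>F r in at_left 1. norm (opS r f x - f x) \<le> 3 * ?\<Phi> r"
      using eventually_at_left_real[of 0 "1::real", OF zero_less_one]
    proof eventually_elim
      case (elim r)
      then have r: "0 < r" "r < 1" by auto
      have x: "x \<in> S2" by fact
      note k = kernel_kA_kB[OF r]
      have d: "integrable sg (\<lambda>y. f y - f x)" using f by simp
      have "opS r f x - f x = kop (kA r) (\<lambda>y. f y - f x) x + kop (kB r) (\<lambda>y. f y - f x) x"
        using f by (simp add: kop_diff[OF k(1) x] kop_diff[OF k(2) x] opS_def)
          (simp add: kop_def kA_kB_integral_right[OF x r])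
      also have "\<dots> = (LINT y|sg. kA r x y (f y - f x) + kB r x y (f y - f x))"
        unfolding kop_def using kernel_integrable[OF k(1) x d] kernel_integrable[OF k(2) x d] by simp
      also have "norm \<dots> \<le> (LINT y|sg. norm (kA r x y (f y - f x) + kB r x y (f y - f x)))"
        by (rule integral_norm_bound)
      also have "\<dots> \<le> (LINT y|sg. 3 * (kP r x y * norm (f y - f x)))"
      proof (rule integral_mono_AE)
        show "AE y in sg. norm (kA r x y (f y - f x) + kB r x y (f y - f x)) \<le> 3 * (kP r x y * norm (f y - f x))"
          using AE_sphere_measure_sphere by eventually_elim (rule kS_bound[OF x _ r])
        show "integrable sg (\<lambda>y. norm (kA r x y (f y - f x) + kB r x y (f y - f x)))"
          using kernel_integrable[OF k(1) x d] kernel_integrable[OF k(2) x d] by simp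
        show "integrable sg (\<lambda>y. 3 * (kP r x y * norm (f y - f x)))"
          using integrable_kP_mult[OF x r] d by simp
      qed
      finally show ?case by simp
    qed
  qed
  then show ?case by (simp add: LIM_zero_iff)
qed

lemma chi_nonneg:
  assumes t: "0 < t" "t < 1" and f: "integrable sg f"
  shows "0 \<le> chi f t"
proof -
  have "0 < sqrt t" "sqrt t < 1" using t by auto
  from chi_square(1)[OF this f] have "chi f t = (LINT x|sg. (norm (opS (sqrt t) f x))\<^sup>2)"
    using t by simp
  then show ?thesis by simp
qed

lemma nn_integral_norm_square:
  assumes "f \<in> L2 sg"
  shows "(\<integral>\<^sup>+x. ennreal ((norm (f x))\<^sup>2) \<partial>sg) = ennreal (LINT x|sg. (norm (f x))\<^sup>2)"
  using assms by (intro nn_integral_eq_integral) (auto simp: L2_iff)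

lemma fatou_tendsto:
  fixes u :: "nat \<Rightarrow> real^3 \<Rightarrow> real"
  assumes u: "\<And>n. u n \<in> borel_measurable borel" and lim: "AE x in sg. (\<lambda>n. u n x) \<longlonglongrightarrow> v x"
  shows "(\<integral>\<^sup>+x. ennreal (v x) \<partial>sg) \<le> liminf (\<lambda>n. \<integral>\<^sup>+x. ennreal (u n x) \<partial>sg)"
proof -
  have [measurable]: "u n \<in> borel_measurable borel" for n by (rule u)
  have "(\<integral>\<^sup>+x. ennreal (v x) \<partial>sg) = (\<integral>\<^sup>+x. liminf (\<lambda>n. ennreal (u n x)) \<partial>sg)"
  proof (rule nn_integral_cong_AE)
    show "AE x in sg. ennreal (v x) = liminf (\<lambda>n. ennreal (u n x))"
      using lim
    proof eventually_elim
      case (elim x)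
      show ?case using lim_imp_Liminf[OF _ tendsto_ennrealI[OF elim]] by simp
    qed
  qed
  also have "\<dots> \<le> liminf (\<lambda>n. \<integral>\<^sup>+x. ennreal (u n x) \<partial>sg)"
    by (rule nn_integral_liminf) simp
  finally show ?thesis .
qed

text \<open>The upper bound comes from the contractivity of the Poisson semigroup, the lower one from Fatou's lemma.\<close>

lemma chi_tendsto:
  assumes f: "f \<in> L2 sg"
  shows "(chi f \<longlongrightarrow> (LINT x|sg. (norm (f x))\<^sup>2)) (at_left 1)"
proof (rule tendsto_at_left_sequentially[of 0])
  fix S :: "nat \<Rightarrow> real"
  assume S: "\<And>n. S n < 1" "\<And>n. 0 < S n" "S \<longlonglongrightarrow> 1"
  let ?N = "LINT x|sg. (norm (f x))\<^sup>2"
  have fi: "integrable sg f" using f by (rule L2_imp_integrable)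
  \<comment> \<open>\<open>chi f (S n)\<close> is the squared norm of \<open>opS\<close> at radius
    \<open>sqrt (S n)\<close>, the form to which Fatou's lemma applies.\<close>
  define s where "s n = sqrt (S n)" for n
  have s: "0 < s n" "s n < 1" "s n * s n = S n" "(s n)\<^sup>2 = S n" for n
    using S(1,2)[of n] by (auto simp: s_def)
  have "s \<longlonglongrightarrow> sqrt 1" unfolding s_def by (intro tendsto_intros S(3))
  then have slim: "filterlim s (at_left 1) sequentially"
    using s(2) by (simp add: filterlim_at less_imp_neq)
  show "(\<lambda>n. chi f (S n)) \<longlonglongrightarrow> ?N"
  proof (rule order_tendstoI)
    fix a assume a: "?N < a"
    have "(\<lambda>n. ?N / S n) \<longlonglongrightarrow> ?N / 1" by (intro tendsto_intros S(3)) simp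
    then have "\<forall>\<^sub>F n in sequentially. ?N / S n < a" using a by (intro order_tendstoD) auto
    then show "\<forall>\<^sub>F n in sequentially. chi f (S n) < a"
    proof eventually_elim
      case (elim n)
      have "S n * chi f (S n) \<le> ?N" using chi_upper[OF s(1,2) f, of n] by (simp add: s)
      then have "chi f (S n) \<le> ?N / S n" using S(2)[of n] by (simp add: field_simps)
      then show ?case using elim by simp
    qed
  next
    fix a assume a: "a < ?N"
    have c0: "chi f (S n) \<ge> 0" for n by (rule chi_nonneg[OF S(2,1) fi])
    show "\<forall>\<^sub>F n in sequentially. a < chi f (S n)"
    proof (cases "a < 0")
      case True
      show ?thesis by (intro always_eventually allI less_le_trans[OF True c0])
    next
      case False
      have L2n: "opS (s n) f \<in> L2 sg" for n by (rule opS_opD_L2(1)[OF s(1,2) fi])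
      have "ennreal ?N = (\<integral>\<^sup>+x. ennreal ((norm (f x))\<^sup>2) \<partial>sg)" using nn_integral_norm_square[OF f] by simp
      also have "\<dots> \<le> liminf (\<lambda>n. \<integral>\<^sup>+x. ennreal ((norm (opS (s n) f x))\<^sup>2) \<partial>sg)"
      proof (rule fatou_tendsto)
        show "(\<lambda>x. (norm (opS (s n) f x))\<^sup>2) \<in> borel_measurable borel" for n
          using L2n[of n] by (auto simp: L2_iff)
        show "AE x in sg. (\<lambda>n. (norm (opS (s n) f x))\<^sup>2) \<longlonglongrightarrow> (norm (f x))\<^sup>2"
          using opS_tendsto_AE[OF fi]
          by eventually_elim (intro tendsto_intros filterlim_compose[OF _ slim])
      qed
      also have "(\<lambda>n. \<integral>\<^sup>+x. ennreal ((norm (opS (s n) f x))\<^sup>2) \<partial>sg) = (\<lambda>n. ennreal (chi f (S n)))"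
        using nn_integral_norm_square[OF L2n] chi_square(1)[OF s(1,2) fi] by (simp add: s)
      finally have le: "ennreal ?N \<le> liminf (\<lambda>n. ennreal (chi f (S n)))" .
      have "ennreal a < ennreal ?N" using a False by (simp add: ennreal_less_iff)
      then have "ennreal a < liminf (\<lambda>n. ennreal (chi f (S n)))" using le by (rule less_le_trans)
      from less_LiminfD[OF this] show ?thesis
        by eventually_elim (use False c0 in \<open>simp add: ennreal_less_iff\<close>)
    qed
  qed
qed simp

lemma square_integral_le:
  assumes h: "integrable sg h" "integrable sg (\<lambda>x. (h x)\<^sup>2)"
  shows "(LINT x|sg. h x)\<^sup>2 \<le> 4 * pi * (LINT x|sg. (h x)\<^sup>2)"
proof -
  define m where "m = (LINT x|sg. h x) / (4 * pi)"
  have hm: "(LINT x|sg. h x) = 4 * pi * m" by (simp add: m_def)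
  have "0 \<le> (LINT x|sg. (h x - m)\<^sup>2)" by simp
  also have "\<dots> = (LINT x|sg. (h x)\<^sup>2 - 2 * m * h x + m\<^sup>2)"
    by (intro Bochner_Integration.integral_cong refl) (simp add: power2_eq_square algebra_simps)
  also have "\<dots> = (LINT x|sg. (h x)\<^sup>2) - 2 * m * (4 * pi * m) + m\<^sup>2 * (4 * pi)"
    using h by (simp add: measure_sphere_UNIV hm)
  also have "\<dots> = (LINT x|sg. (h x)\<^sup>2) - 4 * pi * m\<^sup>2" by (simp add: power2_eq_square)
  finally have "4 * pi * (4 * pi * m\<^sup>2) \<le> 4 * pi * (LINT x|sg. (h x)\<^sup>2)" by simp
  then show ?thesis unfolding hm by (simp add: power2_eq_square mult_ac)
qed

text \<open>Radii approach s from below, so the kernel bound at s, which grows with the radius,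
  dominates the whole sequence.\<close>

lemma kop_continuous:
  assumes x: "x \<in> S2" and s: "0 < s" "s < 1" and f: "integrable sg f"
    and r: "\<And>n. 0 < r n" "\<And>n. r n \<le> s" "r \<longlonglongrightarrow> s"
  shows "(\<lambda>n. kop (kA (r n)) f x) \<longlonglongrightarrow> kop (kA s) f x" "(\<lambda>n. kop (kB (r n)) f x) \<longlonglongrightarrow> kop (kB s) f x"
proof -
  have [measurable]: "f \<in> borel_measurable borel" using borel_measurable_integrable[OF f] by simp
  have r1: "r n < 1" for n using r(2)[of n] s by simp
  have le: "3 * ((1 - r n)\<^sup>2) powr (- 3 / 2) * norm v \<le> 3 * ((1 - s)\<^sup>2) powr (- 3 / 2) * norm v" for n and v :: spinor
    using r(2)[of n] s by (intro mult_right_mono mult_left_mono powr_mono2' power_mono) auto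
  have contA: "(\<lambda>n. kA (r n) x y v) \<longlonglongrightarrow> kA s x y v" and contB: "(\<lambda>n. kB (r n) x y v) \<longlonglongrightarrow> kB s x y v"
    if y: "y \<in> S2" for y v
  proof -
    have q: "qd s x y > 0" using s by (intro qd_pos[OF x y]) auto
    show "(\<lambda>n. kA (r n) x y v) \<longlonglongrightarrow> kA s x y v"
      using has_vector_derivative_continuous[OF kA_deriv_r[OF q, of v UNIV]] r(3)
      by (rule isCont_tendsto_compose)
    show "(\<lambda>n. kB (r n) x y v) \<longlonglongrightarrow> kB s x y v"
      using has_vector_derivative_continuous[OF kB_deriv_r[OF q, of v UNIV]] r(3)
      by (rule isCont_tendsto_compose)
  qed
  show "(\<lambda>n. kop (kA (r n)) f x) \<longlonglongrightarrow> kop (kA s) f x"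
    unfolding kop_def
  proof (rule integral_dominated_convergence[where w = "\<lambda>y. 3 * ((1 - s)\<^sup>2) powr (- 3 / 2) * norm (f y)"])
    show "AE y in sg. (\<lambda>n. kA (r n) x y (f y)) \<longlonglongrightarrow> kA s x y (f y)"
      using AE_sphere_measure_sphere by eventually_elim (rule contA)
    show "AE y in sg. norm (kA (r n) x y (f y)) \<le> 3 * ((1 - s)\<^sup>2) powr (- 3 / 2) * norm (f y)" for n
      using AE_sphere_measure_sphere
      by eventually_elim (use kernels_bound(1)[OF x _ r(1) r1] le order_trans in blast)
  qed (use f in auto)
  show "(\<lambda>n. kop (kB (r n)) f x) \<longlonglongrightarrow> kop (kB s) f x"
    unfolding kop_def
  proof (rule integral_dominated_convergence[where w = "\<lambda>y. 3 * ((1 - s)\<^sup>2) powr (- 3 / 2) * norm (f y)"])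
    show "AE y in sg. (\<lambda>n. kB (r n) x y (f y)) \<longlonglongrightarrow> kB s x y (f y)"
      using AE_sphere_measure_sphere by eventually_elim (rule contB)
    show "AE y in sg. norm (kB (r n) x y (f y)) \<le> 3 * ((1 - s)\<^sup>2) powr (- 3 / 2) * norm (f y)" for n
      using AE_sphere_measure_sphere
      by eventually_elim (use kernels_bound(2)[OF x _ r(1) r1] le order_trans in blast)
  qed (use f in auto)
qed

lemma opS_opD:
  assumes s: "0 < s" "s < 1" and r: "0 < r" "r < 1" and x: "x \<in> S2" and f: "integrable sg f"
  shows "opS s (opD r f) x = opD (s * r) f x"
proof -
  note k = kernel_kA_kB[OF s] kernel_kA_kB[OF r]
  note i = kop_integrable[OF k(3) f] kop_integrable[OF k(4) f]
  show ?thesis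
    unfolding opS_def opD_def[abs_def] kop_diff[OF k(1) x i] kop_diff[OF k(2) x i]
    by (simp add: kA_kB_kop[OF s r x f])
qed

text \<open>Since \<open>opS s \<circ> opD r = opD (s * r)\<close>, an \<open>L\<^sup>2\<close> limit \<open>g\<close> of \<open>opD r f\<close> satisfies \<open>opD s f = opS s g\<close>, and
  \<open>opS s\<close> is an approximate identity.\<close>

theorem opD_limit:
  assumes f: "f \<in> L2 sg"
  shows "\<exists>g. g \<in> L2 sg \<and> (LINT x|sg. (norm (g x))\<^sup>2) = (LINT x|sg. (norm (f x))\<^sup>2)
     \<and> (AE x in sg. ((\<lambda>r. opD r f x) \<longlongrightarrow> g x) (at_left 1))"
proof -
  let ?N = "LINT x|sg. (norm (f x))\<^sup>2"
  have fi: "integrable sg f" using f by (rule L2_imp_integrable)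
  \<comment> \<open>The sequence starts at 1 / 2, so \<open>chi_upper\<close> bounds all squared
    norms of \<open>D n\<close> by four times that of f.\<close>
  define r where "r n = 1 - inverse (real (Suc (Suc n)))" for n
  have r: "0 < r n" "r n < 1" for n by (auto simp: r_def field_simps)
  have rlim: "r \<longlonglongrightarrow> 1" unfolding r_def
    using tendsto_diff[OF tendsto_const[of 1] LIMSEQ_Suc[OF LIMSEQ_inverse_real_of_nat]] by simp
  define D where "D n = opD (r n) f" for n
  have DL2: "D n \<in> L2 sg" for n unfolding D_def by (rule opS_opD_L2(2)[OF r fi])
  have Dint: "integrable sg (D n)" for n using DL2 by (rule L2_imp_integrable)
  have [measurable]: "D n \<in> borel_measurable borel" for n using DL2 by (simp add: L2_iff)
  have diff: "(LINT x|sg. (norm (D i x - D j x))\<^sup>2) = chi f (r i * r i) + chi f (r j * r j) - 2 * chi f (r i * r j)"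
    and diff_int: "integrable sg (\<lambda>x. (norm (D i x - D j x))\<^sup>2)" for i j
    using L2_add[OF DL2[of i] DL2[of j], of 1 "-1"] chi_square(2)[OF r fi] opD_pairing(1)[OF r r fi, of i j]
    by (simp_all add: D_def L2_iff)
  have cauchy: "\<exists>N. \<forall>i\<ge>N. \<forall>j\<ge>N. (LINT x|sg. norm (D i x - D j x)) < e" if e: "e > 0" for e
  proof -
    have "\<forall>\<^sub>F t in at_left 1. dist (chi f t) ?N < e\<^sup>2 / 64"
      using e by (intro tendstoD[OF chi_tendsto[OF f]]) auto
    then obtain d where d: "d < 1" "\<And>t. d < t \<Longrightarrow> t < 1 \<Longrightarrow> \<bar>chi f t - ?N\<bar> < e\<^sup>2 / 64"
      unfolding eventually_at_left_field dist_real_def by blast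
    define d' where "d' = max d 0"
    have d': "0 \<le> d'" "d' < 1" "d \<le> d'" using d by (auto simp: d'_def)
    have "sqrt d' < 1" using d' by auto
    then have "\<forall>\<^sub>F n in sequentially. sqrt d' < r n" using rlim by (intro order_tendstoD(1)[OF rlim])
    then obtain N where N: "\<And>n. n \<ge> N \<Longrightarrow> sqrt d' < r n" by (auto simp: eventually_sequentially)
    have close: "\<bar>chi f (r i * r j) - ?N\<bar> < e\<^sup>2 / 64" if "i \<ge> N" "j \<ge> N" for i j
    proof (rule d(2))
      have "sqrt d' * sqrt d' < r i * r j" using N[OF that(1)] N[OF that(2)] d' r(1)[of i] by (intro mult_strict_mono) auto
      then show "d < r i * r j" using d' by simp
      show "r i * r j < 1" using r[of i] r[of j] mult_strict_mono[of "r i" 1 "r j" 1] by auto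
    qed
    have "(LINT x|sg. norm (D i x - D j x)) < e" if "i \<ge> N" "j \<ge> N" for i j
    proof -
      \<comment> \<open>The polarised expression contains \<open>chi\<close> with coefficients 1, 1,
        -2, each value within e^2 / 64 of the common limit, hence the bound e^2 / 16. The
        Cauchy-Schwarz factor 4 * pi is absorbed because pi < 4.\<close>
      have "(LINT x|sg. (norm (D i x - D j x))\<^sup>2) < e\<^sup>2 / 16"
        unfolding diff using close[of i i] close[of j j] close[of i j] that by linarith
      then have "4 * pi * (LINT x|sg. (norm (D i x - D j x))\<^sup>2) \<le> 4 * pi * (e\<^sup>2 / 16)"
        by (intro mult_left_mono) auto
      moreover have "(LINT x|sg. norm (D i x - D j x))\<^sup>2 \<le> 4 * pi * (LINT x|sg. (norm (D i x - D j x))\<^sup>2)"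
        using Dint diff_int by (intro square_integral_le) auto
      moreover have "4 * pi * (e\<^sup>2 / 16) < e\<^sup>2" using pi_less_4 e by simp
      ultimately have "(LINT x|sg. norm (D i x - D j x))\<^sup>2 < e\<^sup>2" by linarith
      then show ?thesis using e by (intro power2_less_imp_less[of _ e]) auto
    qed
    then show ?thesis by blast
  qed
  \<comment> \<open>Mean distance suffices to extract an almost everywhere convergent subsequence,
    and it is also the distance in which operators with bounded kernels are continuous
    pointwise.\<close>
  obtain \<rho> where \<rho>: "strict_mono \<rho>" "AE x in sg. Cauchy (\<lambda>i. D (\<rho> i) x)"
    by (rule cauchy_L1_AE_cauchy_subseq[of sg D, OF Dint cauchy]) auto
  define g where "g x = lim (\<lambda>n. D (\<rho> n) x)" for x
  have [measurable]: "g \<in> borel_measurable borel" unfolding g_def by measurable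
  have glim: "AE x in sg. (\<lambda>n. D (\<rho> n) x) \<longlonglongrightarrow> g x"
    using \<rho>(2) by eventually_elim (simp add: g_def Cauchy_convergent convergent_LIMSEQ_iff[symmetric])
  have gL2: "g \<in> L2 sg"
  proof -
    have "(\<integral>\<^sup>+x. ennreal ((norm (g x))\<^sup>2) \<partial>sg) \<le> liminf (\<lambda>n. \<integral>\<^sup>+x. ennreal ((norm (D (\<rho> n) x))\<^sup>2) \<partial>sg)"
    proof (rule fatou_tendsto)
      show "AE x in sg. (\<lambda>n. (norm (D (\<rho> n) x))\<^sup>2) \<longlonglongrightarrow> (norm (g x))\<^sup>2"
        using glim by eventually_elim (intro tendsto_intros)
    qed measurable
    also have "\<dots> \<le> liminf (\<lambda>n. ennreal (4 * ?N))"
    proof (rule Liminf_mono, rule always_eventually, rule allI)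
      fix n
      have "1 / 2 \<le> r (\<rho> n)" by (simp add: r_def field_simps)
      then have "(1 / 2)\<^sup>2 \<le> (r (\<rho> n))\<^sup>2" by (intro power_mono) auto
      then have "(1 / 2)\<^sup>2 * chi f (r (\<rho> n) * r (\<rho> n)) \<le> (r (\<rho> n))\<^sup>2 * chi f (r (\<rho> n) * r (\<rho> n))"
        unfolding chi_square(2)[OF r fi, symmetric] by (intro mult_right_mono) auto
      also have "\<dots> \<le> ?N" by (rule chi_upper[OF r f])
      finally have "chi f (r (\<rho> n) * r (\<rho> n)) \<le> 4 * ?N" by (simp add: power2_eq_square)
      then show "(\<integral>\<^sup>+x. ennreal ((norm (D (\<rho> n) x))\<^sup>2) \<partial>sg) \<le> ennreal (4 * ?N)"
        unfolding nn_integral_norm_square[OF DL2] by (simp add: D_def chi_square(2)[OF r fi] ennreal_leI)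
    qed
    also have "\<dots> < \<infinity>" by (simp add: Liminf_const)
    finally show ?thesis
      unfolding L2_iff by (auto intro!: integrableI_bounded)
  qed
  have gi: "integrable sg g" using gL2 by (rule L2_imp_integrable)
  have L1: "(\<lambda>n. LINT x|sg. norm (D (\<rho> n) x - g x)) \<longlonglongrightarrow> 0"
  proof (rule LIMSEQ_I)
    fix e :: real assume e: "e > 0"
    obtain N where N: "\<And>i j. i \<ge> N \<Longrightarrow> j \<ge> N \<Longrightarrow> (LINT x|sg. norm (D i x - D j x)) < e / 2"
      using cauchy[of "e / 2"] e by auto
    have le: "(LINT x|sg. norm (D (\<rho> n) x - g x)) \<le> e / 2" if n: "n \<ge> N" for n
    proof -
      have nn: "(\<integral>\<^sup>+x. ennreal (norm (D i x - D j x)) \<partial>sg) = ennreal (LINT x|sg. norm (D i x - D j x))" for i j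
        using Dint by (intro nn_integral_eq_integral) auto
      have "(\<integral>\<^sup>+x. ennreal (norm (D (\<rho> n) x - g x)) \<partial>sg)
          \<le> liminf (\<lambda>m. \<integral>\<^sup>+x. ennreal (norm (D (\<rho> n) x - D (\<rho> m) x)) \<partial>sg)"
      proof (rule fatou_tendsto)
        show "AE x in sg. (\<lambda>m. norm (D (\<rho> n) x - D (\<rho> m) x)) \<longlonglongrightarrow> norm (D (\<rho> n) x - g x)"
          using glim by eventually_elim (intro tendsto_intros)
      qed measurable
      also have "\<dots> \<le> liminf (\<lambda>m. ennreal (e / 2))"
      proof (rule Liminf_mono, rule eventually_sequentiallyI)
        fix m assume m: "m \<ge> N"
        have "\<rho> n \<ge> N" "\<rho> m \<ge> N" using seq_suble[OF \<rho>(1)] n m order_trans by blast+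
        then show "(\<integral>\<^sup>+x. ennreal (norm (D (\<rho> n) x - D (\<rho> m) x)) \<partial>sg) \<le> ennreal (e / 2)"
          unfolding nn using N by (intro ennreal_leI less_imp_le) auto
      qed
      also have "\<dots> = ennreal (e / 2)" by (simp add: Liminf_const)
      also have "(\<integral>\<^sup>+x. ennreal (norm (D (\<rho> n) x - g x)) \<partial>sg) = ennreal (LINT x|sg. norm (D (\<rho> n) x - g x))"
        using Dint gi by (intro nn_integral_eq_integral) auto
      finally show ?thesis using e by (simp add: ennreal_le_iff)
    qed
    show "\<exists>N. \<forall>n\<ge>N. norm ((LINT x|sg. norm (D (\<rho> n) x - g x)) - 0) < e"
    proof (intro exI[of _ N] allI impI)
      fix n assume "N \<le> n"
      then have "(LINT x|sg. norm (D (\<rho> n) x - g x)) < e" using le[of n] e by simp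
      then show "norm ((LINT x|sg. norm (D (\<rho> n) x - g x)) - 0) < e" by simp
    qed
  qed
  have key: "opS s g x = opD s f x" if s: "0 < s" "s < 1" and x: "x \<in> S2" for s x
  proof -
    note k = kernel_kA_kB[OF s]
    \<comment> \<open>At a fixed radius the kernel is bounded, so convergence in mean of the
      functions gives convergence of their images at every single point of the sphere.\<close>
    have conv: "(\<lambda>n. kop K (D (\<rho> n)) x) \<longlonglongrightarrow> kop K g x" if K: "kernel K" for K
    proof -
      obtain C where C: "\<And>y v. y \<in> S2 \<Longrightarrow> norm (K x y v) \<le> C * norm v"
        using kernel_bound[OF K] x by blast
      have "(\<lambda>n. kop K (D (\<rho> n)) x - kop K g x) \<longlonglongrightarrow> 0"
      proof (rule Lim_null_comparison)
        show "(\<lambda>n. C * (LINT x|sg. norm (D (\<rho> n) x - g x))) \<longlonglongrightarrow> 0"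
          using tendsto_mult_left[OF L1, of C] by simp
        show "\<forall>\<^sub>F n in sequentially. norm (kop K (D (\<rho> n)) x - kop K g x) \<le> C * (LINT x|sg. norm (D (\<rho> n) x - g x))"
          unfolding kop_diff[OF K x Dint gi, symmetric]
          using C Dint gi by (intro always_eventually allI kop_bound) auto
      qed
      then show ?thesis by (simp add: LIM_zero_iff)
    qed
    have "(\<lambda>n. opS s (D (\<rho> n)) x) \<longlonglongrightarrow> opS s g x"
      unfolding opS_def by (intro tendsto_add conv k)
    moreover have "(\<lambda>n. opS s (D (\<rho> n)) x) \<longlonglongrightarrow> opD s f x"
    proof -
      have lim: "(\<lambda>n. s * r (\<rho> n)) \<longlonglongrightarrow> s * 1"
        by (intro tendsto_intros LIMSEQ_subseq_LIMSEQ[OF rlim \<rho>(1), unfolded o_def])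
      have "(\<lambda>n. opD (s * r (\<rho> n)) f x) \<longlonglongrightarrow> opD s f x"
        unfolding opD_def using s r lim less_imp_le[OF r(2)]
        by (intro tendsto_diff kop_continuous[OF x s fi]) (auto simp: mult_left_le)
      then show ?thesis using opS_opD[OF s r x fi] by (simp add: D_def)
    qed
    ultimately show ?thesis by (rule LIMSEQ_unique)
  qed
  have "AE x in sg. ((\<lambda>r. opD r f x) \<longlongrightarrow> g x) (at_left 1)"
    using opS_tendsto_AE[OF gi] AE_sphere_measure_sphere
  proof eventually_elim
    case (elim x)
    show ?case
    proof (rule Lim_transform_eventually[OF elim(1)])
      show "\<forall>\<^sub>F r in at_left 1. opS r g x = opD r f x"
        using eventually_at_left_real[of 0 "1::real", OF zero_less_one]
        by eventually_elim (use key elim(2) in auto)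
    qed
  qed
  moreover have "(LINT x|sg. (norm (g x))\<^sup>2) = ?N"
  proof -
    \<comment> \<open>The intertwining relation equates the norms of \<open>opS g\<close> and
      \<open>opD f\<close>, and these are \<open>chi g\<close> and \<open>chi f\<close>. Letting t
      tend to 1 yields the equality of norms.\<close>
    have "chi g t = chi f t" if "t \<in> {0<..<1}" for t
    proof -
      have t: "0 < sqrt t" "sqrt t < 1" "sqrt t * sqrt t = t" using that by auto
      have [measurable]: "opS (sqrt t) g \<in> borel_measurable borel" "opD (sqrt t) f \<in> borel_measurable borel"
        using opS_opD_L2[OF t(1,2)] gi fi by (auto simp: L2_iff)
      have "(LINT x|sg. (norm (opS (sqrt t) g x))\<^sup>2) = (LINT x|sg. (norm (opD (sqrt t) f x))\<^sup>2)"
        by (rule integral_sphere_cong) (use key[OF t(1,2)] in auto)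
      then show ?thesis using chi_square(1)[OF t(1,2) gi] chi_square(2)[OF t(1,2) fi] t(3) by simp
    qed
    then have "\<forall>\<^sub>F t in at_left 1. chi g t = chi f t"
      by (intro eventually_mono[OF eventually_at_left_real[of 0 1]]) auto
    from Lim_transform_eventually[OF chi_tendsto[OF gL2] this]
    show ?thesis using chi_tendsto[OF f] tendsto_unique[OF trivial_limit_at_left_real] by blast
  qed
  ultimately show ?thesis using gL2 by blast
qed

subsection \<open>Principal values\<close>

definition trunc :: "(real^3 \<Rightarrow> spinor) \<Rightarrow> real \<Rightarrow> real^3 \<Rightarrow> spinor" where
  "trunc f \<epsilon> x = (LINT z:{z. \<epsilon> < norm (x - z)}|sg. w_kernel (x - z) *v f z)"

lemma kpow_sqrt:
  assumes "qd r x y > 0"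
  shows "kpow 3 r x y = 1 / (4 * pi * sqrt (qd r x y) ^ 3)"
proof -
  define a where "a = sqrt (qd r x y)"
  have a0: "a > 0" using assms by (simp add: a_def)
  have "a powr 2 = a\<^sup>2" using a0 by (simp add: powr_numeral)
  also have "\<dots> = qd r x y" using assms by (simp add: a_def)
  finally have a2: "a powr 2 = qd r x y" .
  have "(a powr 2) powr (- 3 / 2) = a powr (- real 3)" unfolding powr_powr by simp
  also have "\<dots> = inverse (a ^ 3)" unfolding powr_minus powr_realpow[OF a0] by (rule refl)
  finally have "qd r x y powr (- 3 / 2) = inverse (a ^ 3)" unfolding a2 .
  then show ?thesis unfolding kpow_def a_def[symmetric] by (simp only: inverse_eq_divide divide_divide_eq_left mult.commute)
qed

text \<open>The cutoff 1 - r is the distance of r x from the sphere. With a = |r x - z| and s = a /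
  d, outside the cutoff 1 / d^3 is s^3 / a^3, and s^2 - 1 = (1 - r)^2 / d^2 - (1 - r) is at most of
  order (1 - r) / d. The error times d is thus of order (1 - r) / a^3, the size of the Poisson
  kernel. The estimate yields 7; 11 leaves slack.\<close>

lemma truncation_error_bound:
  assumes x: "x \<in> S2" and z: "z \<in> S2" and r: "0 < r" "r < 1"
  defines "d \<equiv> norm (x - z)"
  shows "\<bar>(if 1 - r < d then inverse (4 * pi * d ^ 3) else 0) - (1 + r) / 2 * kpow 3 r x z\<bar> * d \<le> 11 * kP r x z"
proof -
  have q: "qd r x z > 0" using r by (intro qd_pos[OF x z]) auto
  define a where "a = sqrt (qd r x z)"
  have a: "a > 0" "a\<^sup>2 = (1 - r)\<^sup>2 + r * d\<^sup>2" using q by (auto simp: a_def d_def qd_sphere[OF x z])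
  have K: "kpow 3 r x z = 1 / (4 * pi * a ^ 3)" using kpow_sqrt[OF q] by (simp add: a_def)
  have P: "kP r x z = (1 - r) * (1 + r) * kpow 3 r x z" by (simp add: kP_def power2_eq_square algebra_simps)
  have d2: "0 \<le> d" "d \<le> 2" using norm_triangle_ineq4[of x z] x z by (auto simp: d_def)
  show ?thesis
  proof (cases "1 - r < d")
    case False
    \<comment> \<open>Inside the cutoff the truncated kernel is zero, and d \<le> 1 - r supplies the
      factor that turns \<open>kpow\<close> into \<open>kP\<close>.\<close>
    have "\<bar>(1 + r) / 2 * kpow 3 r x z\<bar> * d \<le> \<bar>(1 + r) / 2 * kpow 3 r x z\<bar> * (1 - r)"
      using False by (intro mult_left_mono) auto
    also have "\<dots> = kP r x z / 2" using r by (simp add: P abs_mult)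
    also have "\<dots> \<le> 11 * kP r x z" using kP_nonneg[of r x z] r by simp
    finally show ?thesis using False by simp
  next
    case True
    have d0: "d > 0" using True r by linarith
    define s where "s = a / d"
    have s: "s > 0" "s\<^sup>2 = r + (1 - r)\<^sup>2 / d\<^sup>2" using a d0 by (auto simp: s_def power_divide field_simps)
    have quot: "(1 - r)\<^sup>2 / d\<^sup>2 \<le> 1" using True r d0 by (simp add: power_mono)
    have s2: "s \<le> 2"
    proof (rule power2_le_imp_le)
      show "s\<^sup>2 \<le> 2\<^sup>2" using s(2) quot r by simp
    qed simp
    have cube: "\<bar>s ^ 3 - 1\<bar> \<le> 3 * \<bar>s\<^sup>2 - 1\<bar>"
    proof -
      have "s ^ 3 - 1 = (s - 1) * (s\<^sup>2 + s + 1)" "s\<^sup>2 - 1 = (s - 1) * (s + 1)"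
        by (simp_all add: power2_eq_square power3_eq_cube algebra_simps)
      moreover have "0 \<le> s\<^sup>2 + s + 1" "0 \<le> s + 1"
        using s(1) by (intro add_nonneg_nonneg; simp)+
      ultimately have cubes: "\<bar>s ^ 3 - 1\<bar> = \<bar>s - 1\<bar> * (s\<^sup>2 + s + 1)" "\<bar>s\<^sup>2 - 1\<bar> = \<bar>s - 1\<bar> * (s + 1)"
        by (simp_all only: abs_mult abs_of_nonneg)
      have "s\<^sup>2 \<le> 2 * s"
        unfolding power2_eq_square by (rule mult_right_mono[OF s2]) (use s(1) in simp)
      then have "s\<^sup>2 + s + 1 \<le> 2 * s + s + 1" by (intro add_mono order_refl)
      also have "\<dots> \<le> 3 * (s + 1)" by simp
      finally have "\<bar>s ^ 3 - 1\<bar> \<le> \<bar>s - 1\<bar> * (3 * (s + 1))"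
        unfolding cubes by (rule mult_left_mono) simp
      also have "\<dots> = 3 * \<bar>s\<^sup>2 - 1\<bar>" unfolding cubes by simp
      finally show ?thesis .
    qed
    have sq: "\<bar>s\<^sup>2 - 1\<bar> * d \<le> 2 * (1 - r)"
    proof -
      have "(s\<^sup>2 - 1) * d = (1 - r) * ((1 - r) / d) - (1 - r) * d"
        using d0 unfolding s(2) by (simp add: power2_eq_square field_simps)
      moreover have "(1 - r) / d \<le> 1" using True d0 by (simp add: divide_le_eq_1)
      then have "(1 - r) * ((1 - r) / d) \<le> (1 - r) * 1" using r by (intro mult_left_mono) auto
      moreover have "0 \<le> (1 - r) * ((1 - r) / d)" using d0 r by simp
      moreover have "(1 - r) * d \<le> (1 - r) * 2"
        by (rule mult_left_mono[OF d2(2)]) (use r in simp)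
      moreover have "0 \<le> (1 - r) * d" using d2(1) r by simp
      ultimately have "\<bar>(s\<^sup>2 - 1) * d\<bar> \<le> 2 * (1 - r)" using r by linarith
      then show ?thesis using d0 by (simp add: abs_mult)
    qed
    have main: "\<bar>s ^ 3 - (1 + r) / 2\<bar> * d \<le> 11 * ((1 - r) * (1 + r))"
    proof -
      have "\<bar>(s ^ 3 - 1) + (1 - r) / 2\<bar> \<le> \<bar>s ^ 3 - 1\<bar> + \<bar>(1 - r) / 2\<bar>" by (rule abs_triangle_ineq)
      also have "(s ^ 3 - 1) + (1 - r) / 2 = s ^ 3 - (1 + r) / 2" by (simp add: field_simps)
      also have "\<bar>(1 - r) / 2\<bar> = (1 - r) / 2" using r by simp
      finally have "\<bar>s ^ 3 - (1 + r) / 2\<bar> \<le> \<bar>s ^ 3 - 1\<bar> + (1 - r) / 2" .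
      then have "\<bar>s ^ 3 - (1 + r) / 2\<bar> * d \<le> (3 * \<bar>s\<^sup>2 - 1\<bar> + (1 - r) / 2) * d"
        using cube d0 by (intro mult_right_mono) auto
      also have "\<dots> = 3 * (\<bar>s\<^sup>2 - 1\<bar> * d) + (1 - r) * d / 2" by (simp add: algebra_simps)
      also have "\<dots> \<le> 3 * (2 * (1 - r)) + (1 - r) * 2 / 2"
        using sq d2 r by (intro add_mono mult_left_mono divide_right_mono) auto
      also have "\<dots> \<le> 11 * ((1 - r) * (1 + r))"
      proof -
        have "3 * (2 * (1 - r)) + (1 - r) * 2 / 2 \<le> 11 * ((1 - r) * 1)" using r by (simp add: field_simps)
        also have "\<dots> \<le> 11 * ((1 - r) * (1 + r))" using r by (intro mult_left_mono) auto
        finally show ?thesis .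
      qed
      finally show ?thesis .
    qed
    have "inverse (4 * pi * d ^ 3) - (1 + r) / 2 * kpow 3 r x z = (s ^ 3 - (1 + r) / 2) * kpow 3 r x z"
      using a d0 by (simp add: K s_def field_simps)
    then have "\<bar>inverse (4 * pi * d ^ 3) - (1 + r) / 2 * kpow 3 r x z\<bar> * d
        = (\<bar>s ^ 3 - (1 + r) / 2\<bar> * d) * kpow 3 r x z"
      by (simp add: abs_mult)
    also have "\<dots> \<le> 11 * ((1 - r) * (1 + r)) * kpow 3 r x z"
      using main by (intro mult_right_mono) auto
    finally show ?thesis using True by (simp add: P)
  qed
qed

text \<open>\<open>- clif x\<close> applied to \<open>kA\<close> gives the direction r x - z, and
  \<open>clif x\<close> applied to \<open>kB\<close> gives x - r z, both with the same scalar
  \<open>kpow 3\<close>. Their mean is (1 + r) / 2 times x - z, so the kernel differs from the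
  truncated one by a scalar factor only.\<close>

lemma opD_kernel:
  assumes x: "x \<in> S2"
  shows "(- 1 / 2) *\<^sub>R clif x (kA r x z v - kB r x z v) = ((1 + r) / 2 * kpow 3 r x z) *\<^sub>R clif (x - z) v"
proof -
  have "clif x (clif (cross3 x z) v) = - clif x (clif x (clif z v)) - (x \<bullet> z) *\<^sub>R clif x v"
    by (simp add: clif_clif[of x z] clif.diff_right clif.minus_right clif.scaleR_right)
  also have "\<dots> = clif z v - (x \<bullet> z) *\<^sub>R clif x v"
    using x by (simp add: clif_self)
  finally have *: "clif x (clif (cross3 x z) v) = clif z v - (x \<bullet> z) *\<^sub>R clif x v" .
  have dif: "kA r x z v - kB r x z v = (kpow 3 r x z * (1 + r)) *\<^sub>R ((x \<bullet> z - 1) *\<^sub>R v + clif (cross3 x z) v)"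
    by (simp add: kA_def kB_def algebra_simps)
  have cd: "clif x (kA r x z v - kB r x z v) = (kpow 3 r x z * (1 + r)) *\<^sub>R (clif z v - clif x v)"
    unfolding dif clif.scaleR_right clif.add_right * by (simp add: algebra_simps)
  have "(1 + r) / 2 * kpow 3 r x z = kpow 3 r x z * (1 + r) / 2" by simp
  then show ?thesis unfolding cd clif.diff_left by (simp add: scaleR_diff_right mult.commute)
qed

definition trunc_err :: "real \<Rightarrow> real^3 \<Rightarrow> real^3 \<Rightarrow> real" where
  "trunc_err r x z = (if 1 - r < norm (x - z) then inverse (4 * pi * norm (x - z) ^ 3) else 0)
     - (1 + r) / 2 * kpow 3 r x z"

lemma trunc_err_measurable [measurable]: "trunc_err r x \<in> borel_measurable borel"
  unfolding trunc_err_def[abs_def] by measurable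

lemma trunc_err_integrable:
  assumes x: "x \<in> S2" and r: "0 < r" "r < 1" and f: "integrable sg f"
  shows "integrable sg (\<lambda>z. trunc_err r x z *\<^sub>R clif (x - z) (f z))"
    and "norm (LINT z|sg. trunc_err r x z *\<^sub>R clif (x - z) (f z)) \<le> 11 * (LINT z|sg. kP r x z * norm (f z))"
proof -
  have [measurable]: "f \<in> borel_measurable borel" using borel_measurable_integrable[OF f] by simp
  have i: "integrable sg (\<lambda>z. 11 * (kP r x z * norm (f z)))"
    using integrable_kP_mult[OF x r] f by simp
  have le: "norm (trunc_err r x z *\<^sub>R clif (x - z) (f z)) \<le> 11 * (kP r x z * norm (f z))" if "z \<in> S2" for z
  proof -
    have "\<bar>trunc_err r x z\<bar> * norm (x - z) \<le> 11 * kP r x z"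
      using truncation_error_bound[OF x that r] unfolding trunc_err_def .
    from mult_right_mono[OF this norm_ge_zero[of "f z"]] show ?thesis
      by (simp add: norm_clif mult.assoc)
  qed
  show int: "integrable sg (\<lambda>z. trunc_err r x z *\<^sub>R clif (x - z) (f z))"
  proof (rule Bochner_Integration.integrable_bound[OF i])
    show "AE z in sg. norm (trunc_err r x z *\<^sub>R clif (x - z) (f z)) \<le> norm (11 * (kP r x z * norm (f z)))"
      using AE_sphere_measure_sphere by eventually_elim (use le in \<open>auto intro: order_trans[OF _ abs_ge_self]\<close>)
  qed measurable
  have "norm (LINT z|sg. trunc_err r x z *\<^sub>R clif (x - z) (f z))
      \<le> (LINT z|sg. norm (trunc_err r x z *\<^sub>R clif (x - z) (f z)))"
    by (rule integral_norm_bound)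
  also have "\<dots> \<le> (LINT z|sg. 11 * (kP r x z * norm (f z)))"
  proof (rule integral_mono_AE[OF integrable_norm[OF int] i])
    show "AE z in sg. norm (trunc_err r x z *\<^sub>R clif (x - z) (f z)) \<le> 11 * (kP r x z * norm (f z))"
      using AE_sphere_measure_sphere by eventually_elim (rule le)
  qed
  finally show "norm (LINT z|sg. trunc_err r x z *\<^sub>R clif (x - z) (f z)) \<le> 11 * (LINT z|sg. kP r x z * norm (f z))"
    by simp
qed

lemma trunc_minus_opD:
  assumes x: "x \<in> S2" and r: "0 < r" "r < 1" and f: "integrable sg f"
  shows "trunc f (1 - r) x = (- 1 / 2) *\<^sub>R clif x (opD r f x) + (LINT z|sg. trunc_err r x z *\<^sub>R clif (x - z) (f z))"
proof -
  note k = kernel_integrable[OF kernel_kA_kB(1)[OF r] x f] kernel_integrable[OF kernel_kA_kB(2)[OF r] x f]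
  have bl: "bounded_linear (\<lambda>v. (- 1 / 2) *\<^sub>R clif x v)"
    by (intro bounded_linear_const_scaleR clif.bounded_linear_right)
  have i1: "integrable sg (\<lambda>z. (- 1 / 2) *\<^sub>R clif x (kA r x z (f z) - kB r x z (f z)))"
    using k by (intro integrable_bounded_linear[OF bl]) auto
  have "(- 1 / 2) *\<^sub>R clif x (opD r f x) = (- 1 / 2) *\<^sub>R clif x (LINT z|sg. kA r x z (f z) - kB r x z (f z))"
    using k by (simp add: opD_def kop_def)
  also have "\<dots> = (LINT z|sg. (- 1 / 2) *\<^sub>R clif x (kA r x z (f z) - kB r x z (f z)))"
    using k by (intro integral_bounded_linear[OF bl, symmetric]) auto
  finally have "(- 1 / 2) *\<^sub>R clif x (opD r f x) + (LINT z|sg. trunc_err r x z *\<^sub>R clif (x - z) (f z))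
      = (LINT z|sg. (- 1 / 2) *\<^sub>R clif x (kA r x z (f z) - kB r x z (f z)) + trunc_err r x z *\<^sub>R clif (x - z) (f z))"
    using i1 trunc_err_integrable(1)[OF x r f] by simp
  also have "\<dots> = trunc f (1 - r) x"
    unfolding trunc_def set_lebesgue_integral_def
    unfolding opD_kernel[OF x]
    by (intro Bochner_Integration.integral_cong refl)
      (simp add: trunc_err_def w_kernel_mult indicator_def scaleR_diff_left)
  finally show ?thesis by simp
qed

lemma orthogonal_reflection:
  assumes x: "norm x = 1"
  shows "orthogonal_transformation (\<lambda>y. (2 * (x \<bullet> y)) *\<^sub>R x - y)"
proof -
  have "linear (\<lambda>y. (2 * (x \<bullet> y)) *\<^sub>R x - y)"
    by (rule linearI) (simp_all add: inner_add_right algebra_simps)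
  moreover have "norm ((2 * (x \<bullet> y)) *\<^sub>R x - y) = norm y" for y
  proof -
    have "x \<bullet> x = 1" using x by (simp add: norm_eq_1)
    then have "((2 * (x \<bullet> y)) *\<^sub>R x - y) \<bullet> ((2 * (x \<bullet> y)) *\<^sub>R x - y) = y \<bullet> y"
      by (simp add: inner_diff_left inner_diff_right inner_commute[of y x])
    then show ?thesis by (simp add: norm_eq_sqrt_inner)
  qed
  ultimately show ?thesis by (simp add: orthogonal_transformation)
qed

text \<open>The reflection in the axis through \<open>x\<close> cancels the tangential part of \<open>x - z\<close>; the normal part has
  length \<open>|x - z|\<^sup>2 / 2\<close>, which gains a factor \<open>|x - z|\<close>.\<close>

lemma trunc_err_vector_bound:
  assumes x: "x \<in> S2" and r: "0 < r" "r < 1"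
  shows "norm (LINT z|sg. trunc_err r x z *\<^sub>R (x - z)) \<le> 11 * (LINT z|sg. kP r x z * norm (x - z))"
    and "integrable sg (\<lambda>z. trunc_err r x z *\<^sub>R (x - z))"
proof -
  define V where "V = (LINT z|sg. trunc_err r x z *\<^sub>R (x - z))"
  have nx: "norm x = 1" using x by simp
  have ib: "integrable sg (\<lambda>z. kP r x z * norm (x - z))"
    by (intro integrable_kP_mult[OF x r] integrable_sphere_continuous) (auto intro!: continuous_intros)
  have le: "norm (trunc_err r x z *\<^sub>R (x - z)) \<le> 11 * kP r x z" if "z \<in> S2" for z
    using truncation_error_bound[OF x that r] unfolding trunc_err_def norm_scaleR .
  show int: "integrable sg (\<lambda>z. trunc_err r x z *\<^sub>R (x - z))"
  proof (rule Bochner_Integration.integrable_bound)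
    show "integrable sg (\<lambda>z. 11 * kP r x z)" using integrable_kernels(6)[OF x, of r] r by simp
    show "AE z in sg. norm (trunc_err r x z *\<^sub>R (x - z)) \<le> norm (11 * kP r x z)"
      using AE_sphere_measure_sphere by eventually_elim (use le in \<open>auto intro: order_trans[OF _ abs_ge_self]\<close>)
  qed measurable
  define T where "T y = (2 * (x \<bullet> y)) *\<^sub>R x - y" for y
  have T: "orthogonal_transformation T" unfolding T_def[abs_def] by (rule orthogonal_reflection[OF nx])
  have Tx: "T x = x" using nx by (simp add: T_def norm_eq_1 scaleR_2)
  have dT: "norm (x - T z) = norm (x - z)" for z
  proof -
    have "x - T z = T (x - z)" by (simp add: linear_diff[OF orthogonal_transformation_linear[OF T]] Tx)
    then show ?thesis using orthogonal_transformation_norm[OF T] by metis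
  qed
  have eT: "trunc_err r x (T z) = trunc_err r x z" for z
  proof -
    have "x \<bullet> T z = x \<bullet> z" using nx by (simp add: T_def inner_diff_right norm_eq_1)
    then show ?thesis by (simp add: trunc_err_def dT kpow_def qd_def)
  qed
  have meas: "(\<lambda>z. trunc_err r x z *\<^sub>R (x - z)) \<in> borel_measurable borel" by measurable
  have VT: "V = (LINT z|sg. trunc_err r x z *\<^sub>R (x - T z))"
    using integral_sphere_orthogonal[OF T meas] by (simp add: eT V_def)
  have intT: "integrable sg (\<lambda>z. trunc_err r x z *\<^sub>R (x - T z))"
  proof -
    have "integrable (distr sg borel T) (\<lambda>z. trunc_err r x z *\<^sub>R (x - z))"
      using int by (simp add: distr_sphere_measure_orthogonal[OF T])
    moreover have "T \<in> measurable sg borel" unfolding T_def[abs_def] by measurable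
    ultimately have "integrable sg (\<lambda>z. trunc_err r x (T z) *\<^sub>R (x - T z))" by (rule integrable_distr[rotated])
    then show ?thesis by (simp add: eT)
  qed
  have "2 *\<^sub>R V = V + V" by (rule scaleR_2)
  also have "\<dots> = (LINT z|sg. trunc_err r x z *\<^sub>R (x - z)) + (LINT z|sg. trunc_err r x z *\<^sub>R (x - T z))"
    by (rule arg_cong2[OF V_def VT])
  also have "\<dots> = (LINT z|sg. trunc_err r x z *\<^sub>R (x - z) + trunc_err r x z *\<^sub>R (x - T z))"
    by (rule Bochner_Integration.integral_add[OF int intT, symmetric])
  also have "\<dots> = (LINT z|sg. (2 * trunc_err r x z * (1 - x \<bullet> z)) *\<^sub>R x)"
    by (intro Bochner_Integration.integral_cong refl) (simp add: vec_eq_iff T_def algebra_simps)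
  finally have V2: "2 *\<^sub>R V = (LINT z|sg. (2 * trunc_err r x z * (1 - x \<bullet> z)) *\<^sub>R x)" .
  have "norm (2 *\<^sub>R V) \<le> (LINT z|sg. norm ((2 * trunc_err r x z * (1 - x \<bullet> z)) *\<^sub>R x))"
    unfolding V2 by (rule integral_norm_bound)
  also have "\<dots> \<le> (LINT z|sg. 11 * (kP r x z * norm (x - z)))"
  proof (rule integral_mono_AE')
    show "AE z in sg. norm ((2 * trunc_err r x z * (1 - x \<bullet> z)) *\<^sub>R x) \<le> 11 * (kP r x z * norm (x - z))"
      using AE_sphere_measure_sphere
    proof eventually_elim
      case (elim z)
      have n2: "(norm (x - z))\<^sup>2 = 2 * (1 - x \<bullet> z)"
        using elim nx by (simp add: power2_norm_eq_inner inner_diff_left inner_diff_right inner_commute norm_eq_1)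
      have "norm ((2 * trunc_err r x z * (1 - x \<bullet> z)) *\<^sub>R x) = \<bar>trunc_err r x z * (norm (x - z))\<^sup>2\<bar>"
        unfolding n2 norm_scaleR nx by (simp add: algebra_simps)
      also have "\<dots> = (\<bar>trunc_err r x z\<bar> * norm (x - z)) * norm (x - z)"
        by (simp add: abs_mult power2_eq_square)
      also have "\<dots> \<le> (11 * kP r x z) * norm (x - z)"
        using le[OF elim] by (intro mult_right_mono) auto
      finally show ?case by (simp add: mult_ac)
    qed
    show "integrable sg (\<lambda>z. 11 * (kP r x z * norm (x - z)))" using ib by simp
    show "AE z in sg. 0 \<le> 11 * (kP r x z * norm (x - z))"
      using r by (intro AE_I2 mult_nonneg_nonneg kP_nonneg) auto
  qed
  finally have "2 * norm V \<le> 11 * (LINT z|sg. kP r x z * norm (x - z))" by simp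
  moreover have "norm V \<ge> 0" by simp
  ultimately show "norm (LINT z|sg. trunc_err r x z *\<^sub>R (x - z)) \<le> 11 * (LINT z|sg. kP r x z * norm (x - z))"
    unfolding V_def[symmetric] by linarith
qed

text \<open>The error kernel is of Poisson size, so its absolute integral need not be small. On f -
  f x it is controlled by the Lebesgue point; on the constant f x the cancellation in
  \<open>trunc_err_vector_bound\<close> is decisive.\<close>

lemma trunc_err_tendsto_0:
  assumes x: "x \<in> S2" and f: "integrable sg f"
    and leb: "((\<lambda>r. LINT y|sg. kP r x y * norm (f y - f x)) \<longlongrightarrow> 0) (at_left 1)"
  shows "((\<lambda>r. LINT z|sg. trunc_err r x z *\<^sub>R clif (x - z) (f z)) \<longlongrightarrow> 0) (at_left 1)"
proof (rule Lim_null_comparison)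
  let ?\<Phi> = "\<lambda>r. LINT y|sg. kP r x y * norm (f y - f x)" and ?\<Psi> = "\<lambda>r. LINT z|sg. kP r x z * norm (x - z)"
  have psi: "(?\<Psi> \<longlongrightarrow> norm (x - x)) (at_left 1)"
    by (rule kP_tendsto[OF x, of "\<lambda>z. norm (x - z)"]) (auto intro!: continuous_intros)
  have "((\<lambda>r. 11 * ?\<Phi> r + 11 * ?\<Psi> r * norm (f x)) \<longlongrightarrow> 11 * 0 + 11 * norm (x - x) * norm (f x)) (at_left 1)"
    by (intro tendsto_add tendsto_mult tendsto_const leb psi)
  then show "((\<lambda>r. 11 * ?\<Phi> r + 11 * ?\<Psi> r * norm (f x)) \<longlongrightarrow> 0) (at_left 1)" by simp
  show "\<forall>\<^sub>F r in at_left 1. norm (LINT z|sg. trunc_err r x z *\<^sub>R clif (x - z) (f z)) \<le> 11 * ?\<Phi> r + 11 * ?\<Psi> r * norm (f x)"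
    using eventually_at_left_real[of 0 "1::real", OF zero_less_one]
  proof eventually_elim
    case (elim r)
    then have r: "0 < r" "r < 1" by auto
    have d: "integrable sg (\<lambda>z. f z - f x)" "integrable sg (\<lambda>z. f x)" using f by auto
    have eq: "trunc_err r x z *\<^sub>R clif (x - z) (f z)
        = trunc_err r x z *\<^sub>R clif (x - z) (f z - f x) + trunc_err r x z *\<^sub>R clif (x - z) (f x)" for z
      by (simp only: clif.diff_right scaleR_diff_right diff_add_cancel)
    define V where "V = (LINT z|sg. trunc_err r x z *\<^sub>R (x - z))"
    define E where "E = (LINT z|sg. trunc_err r x z *\<^sub>R clif (x - z) (f z - f x))"
    have "(LINT z|sg. trunc_err r x z *\<^sub>R clif (x - z) (f z))
        = (LINT z|sg. trunc_err r x z *\<^sub>R clif (x - z) (f z - f x) + trunc_err r x z *\<^sub>R clif (x - z) (f x))"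
      by (rule Bochner_Integration.integral_cong[OF refl eq])
    moreover have "(LINT z|sg. trunc_err r x z *\<^sub>R clif (x - z) (f z - f x) + trunc_err r x z *\<^sub>R clif (x - z) (f x))
        = E + (LINT z|sg. trunc_err r x z *\<^sub>R clif (x - z) (f x))"
      unfolding E_def
      by (rule Bochner_Integration.integral_add[OF trunc_err_integrable(1)[OF x r d(1)] trunc_err_integrable(1)[OF x r d(2)]])
    moreover have "(LINT z|sg. trunc_err r x z *\<^sub>R clif (x - z) (f x)) = clif V (f x)"
      using integral_bounded_linear[OF clif.bounded_linear_left[of "f x"] trunc_err_vector_bound(2)[OF x r]]
      by (simp add: V_def clif.scaleR_left)
    ultimately have split: "(LINT z|sg. trunc_err r x z *\<^sub>R clif (x - z) (f z)) = E + clif V (f x)" by simp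
    have "norm (E + clif V (f x)) \<le> norm E + norm V * norm (f x)"
      using norm_triangle_ineq[of E "clif V (f x)"] by (simp add: norm_clif)
    moreover have "norm E \<le> 11 * ?\<Phi> r"
      unfolding E_def by (rule trunc_err_integrable(2)[OF x r d(1)])
    moreover have "norm V * norm (f x) \<le> 11 * ?\<Psi> r * norm (f x)"
      unfolding V_def by (intro mult_right_mono trunc_err_vector_bound(1)[OF x r]) simp
    ultimately show ?case unfolding split by linarith
  qed
qed

theorem trunc_limit:
  assumes f: "f \<in> L2 sg"
  shows "\<exists>g. g \<in> L2 sg \<and> (LINT x|sg. (norm (g x))\<^sup>2) = (LINT x|sg. (norm (f x))\<^sup>2) / 4
     \<and> (AE x in sg. ((\<lambda>\<epsilon>. trunc f \<epsilon> x) \<longlongrightarrow> g x) (at_right 0))"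
proof -
  have fi: "integrable sg f" using f by (rule L2_imp_integrable)
  obtain g where g: "g \<in> L2 sg" "(LINT x|sg. (norm (g x))\<^sup>2) = (LINT x|sg. (norm (f x))\<^sup>2)"
    "AE x in sg. ((\<lambda>r. opD r f x) \<longlongrightarrow> g x) (at_left 1)"
    using opD_limit[OF f] by blast
  \<comment> \<open>Clifford multiplication by a unit vector is an isometry, so the factor 1 / 2 is
    all that changes the norm.\<close>
  define G where "G x = (- 1 / 2) *\<^sub>R clif x (g x)" for x
  have [measurable]: "g \<in> borel_measurable borel" using g(1) by (simp add: L2_iff)
  have Gm [measurable]: "G \<in> borel_measurable borel" unfolding G_def[abs_def] by measurable
  have Gn: "AE x in sg. (norm (G x))\<^sup>2 = (norm (g x))\<^sup>2 / 4"
    using AE_sphere_measure_sphere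
    by eventually_elim (simp add: G_def norm_clif power2_eq_square)
  have gint: "integrable sg (\<lambda>x. (norm (g x))\<^sup>2 / 4)" using g(1) by (simp add: L2_iff)
  have "integrable sg (\<lambda>x. (norm (G x))\<^sup>2)"
    using Gn by (subst integrable_cong_AE[OF _ _ Gn]) (use gint in auto)
  then have "G \<in> L2 sg" by (simp add: L2_iff)
  moreover have "(LINT x|sg. (norm (G x))\<^sup>2) = (LINT x|sg. (norm (f x))\<^sup>2) / 4"
    using g(2) by (subst integral_cong_AE[OF _ _ Gn]) auto
  moreover have "AE x in sg. ((\<lambda>\<epsilon>. trunc f \<epsilon> x) \<longlongrightarrow> G x) (at_right 0)"
    using g(3) kP_lebesgue_points[OF fi] AE_sphere_measure_sphere
  proof eventually_elim
    case (elim x)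
    note x = elim(3)
    have limA: "((\<lambda>r. (- 1 / 2) *\<^sub>R clif x (opD r f x) + (LINT z|sg. trunc_err r x z *\<^sub>R clif (x - z) (f z))) \<longlongrightarrow> G x + 0) (at_left 1)"
      unfolding G_def
      by (intro tendsto_intros clif.tendsto elim(1) trunc_err_tendsto_0[OF x fi elim(2)])
    have "((\<lambda>r. trunc f (1 - r) x) \<longlongrightarrow> G x + 0) (at_left 1)"
    proof (rule Lim_transform_eventually[OF limA])
      show "\<forall>\<^sub>F r in at_left 1. (- 1 / 2) *\<^sub>R clif x (opD r f x) + (LINT z|sg. trunc_err r x z *\<^sub>R clif (x - z) (f z)) = trunc f (1 - r) x"
        using eventually_at_left_real[of 0 "1::real", OF zero_less_one]
        by eventually_elim (rule trunc_minus_opD[OF x _ _ fi, symmetric], auto)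
    qed
    then have lim: "((\<lambda>r. trunc f (1 - r) x) \<longlongrightarrow> G x) (at_left 1)" by simp
    have "filterlim (\<lambda>\<epsilon>::real. 1 - \<epsilon>) (at_left 1) (at_right 0)"
      unfolding filterlim_at
    proof
      have "((\<lambda>\<epsilon>::real. 1 - \<epsilon>) \<longlongrightarrow> 1 - 0) (at_right 0)" by (intro tendsto_intros)
      then show "((\<lambda>\<epsilon>::real. 1 - \<epsilon>) \<longlongrightarrow> 1) (at_right 0)" by simp
      show "\<forall>\<^sub>F \<epsilon> in at_right 0. 1 - \<epsilon> \<in> {..<1::real} \<and> 1 - \<epsilon> \<noteq> 1"
        by (rule eventually_mono[OF eventually_at_right_less]) auto
    qed
    from filterlim_compose[OF lim this] show ?case by simp
  qed
  ultimately show ?thesis by blast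
qed

section \<open>Measurability of the principal value\<close>

lemma w_kernel_integrable:
  assumes \<epsilon>: "\<epsilon> > 0" and f: "integrable sg f"
  shows "integrable sg (\<lambda>z. indicator {z. \<epsilon> < norm (x - z)} z *\<^sub>R (w_kernel (x - z) *v f z))"
proof -
  have [measurable]: "f \<in> borel_measurable borel" using borel_measurable_integrable[OF f] by simp
  show ?thesis
  proof (rule Bochner_Integration.integrable_bound)
    show "integrable sg (\<lambda>z. inverse (\<epsilon> ^ 2) *\<^sub>R f z)" using f by simp
    show "(\<lambda>z. indicator {z. \<epsilon> < norm (x - z)} z *\<^sub>R (w_kernel (x - z) *v f z)) \<in> borel_measurable sg"
      unfolding w_kernel_mult indicator_def by measurable
    show "AE z in sg. norm (indicator {z. \<epsilon> < norm (x - z)} z *\<^sub>R (w_kernel (x - z) *v f z)) \<le> norm (inverse (\<epsilon> ^ 2) *\<^sub>R f z)"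
    proof (rule AE_I2)
      fix z
      show "norm (indicator {z. \<epsilon> < norm (x - z)} z *\<^sub>R (w_kernel (x - z) *v f z)) \<le> norm (inverse (\<epsilon> ^ 2) *\<^sub>R f z)"
      proof (cases "\<epsilon> < norm (x - z)")
        case True
        define d where "d = norm (x - z)"
        have d: "\<epsilon> < d" "0 < d" using True \<epsilon> by (auto simp: d_def)
        have "inverse (4 * pi * d ^ 3) * d = inverse (4 * pi) * inverse (d\<^sup>2)"
          using d by (simp add: power3_eq_cube power2_eq_square field_simps)
        also have "\<dots> \<le> 1 * inverse (\<epsilon>\<^sup>2)"
        proof (intro mult_mono)
          show "inverse (4 * pi) \<le> 1" using pi_gt3 by (intro inverse_le_1_iff[THEN iffD2]) auto
          show "inverse (d\<^sup>2) \<le> inverse (\<epsilon>\<^sup>2)" using d \<epsilon> by (intro le_imp_inverse_le power_mono) auto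
        qed auto
        finally have "inverse (4 * pi * d ^ 3) * d * norm (f z) \<le> inverse (\<epsilon>\<^sup>2) * norm (f z)"
          by (intro mult_right_mono) auto
        then show ?thesis using True d by (simp add: w_kernel_mult norm_clif d_def[symmetric] mult.assoc)
      qed simp
    qed
  qed
qed

lemma trunc_measurable:
  assumes f: "f \<in> borel_measurable borel"
  shows "trunc f \<epsilon> \<in> borel_measurable borel"
proof -
  have [measurable]: "f \<in> borel_measurable borel" by fact
  have "trunc f \<epsilon> \<in> borel_measurable sg"
    unfolding trunc_def[abs_def] set_lebesgue_integral_def
  proof (rule sphere.borel_measurable_lebesgue_integral)
    show "(\<lambda>(x, z). indicator {z. \<epsilon> < norm (x - z)} z *\<^sub>R (w_kernel (x - z) *v f z)) \<in> borel_measurable (sg \<Otimes>\<^sub>M sg)"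
      unfolding w_kernel_mult indicator_def case_prod_beta by measurable
  qed
  then show ?thesis by simp
qed

text \<open>The strict inequality in the cutoff makes its indicator right continuous in \<epsilon>
  for every z, and the integrand at \<epsilon> dominates those at larger radii.\<close>

lemma trunc_right_continuous:
  assumes \<epsilon>: "\<epsilon> > 0" and f: "integrable sg f" and p: "\<And>n. p n > \<epsilon>" "p \<longlonglongrightarrow> \<epsilon>"
  shows "(\<lambda>n. trunc f (p n) x) \<longlonglongrightarrow> trunc f \<epsilon> x"
  unfolding trunc_def set_lebesgue_integral_def
proof (rule integral_dominated_convergence)
  let ?k = "\<lambda>\<epsilon> z. indicator {z. \<epsilon> < norm (x - z)} z *\<^sub>R (w_kernel (x - z) *v f z)"
  show "?k (p n) \<in> borel_measurable sg" for n
    using w_kernel_integrable[of "p n" f x] p(1)[of n] \<epsilon> f by (intro borel_measurable_integrable) auto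
  show "?k \<epsilon> \<in> borel_measurable sg"
    using w_kernel_integrable[OF \<epsilon> f] by (rule borel_measurable_integrable)
  show "integrable sg (\<lambda>z. norm (?k \<epsilon> z))" using w_kernel_integrable[OF \<epsilon> f] by (rule integrable_norm)
  show "AE z in sg. norm (?k (p n) z) \<le> norm (?k \<epsilon> z)" for n
    using p(1)[of n] by (intro AE_I2) (auto simp: indicator_def)
  show "AE z in sg. (\<lambda>n. ?k (p n) z) \<longlonglongrightarrow> ?k \<epsilon> z"
  proof (rule AE_I2)
    fix z
    show "(\<lambda>n. ?k (p n) z) \<longlonglongrightarrow> ?k \<epsilon> z"
    proof (cases "\<epsilon> < norm (x - z)")
      case True
      have "\<forall>\<^sub>F n in sequentially. p n < norm (x - z)" by (rule order_tendstoD(2)[OF p(2) True])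
      then have "\<forall>\<^sub>F n in sequentially. ?k (p n) z = ?k \<epsilon> z"
        by eventually_elim (use True in simp)
      then show ?thesis by (rule tendsto_eventually)
    next
      case False
      then have eq: "?k (p n) z = ?k \<epsilon> z" for n using p(1)[of n] by simp
      show ?thesis unfolding eq by (rule tendsto_const)
    qed
  qed
qed

definition trunc_cauchy :: "(real^3 \<Rightarrow> spinor) \<Rightarrow> real^3 \<Rightarrow> bool" where
  "trunc_cauchy f x \<longleftrightarrow> (\<forall>k::nat. \<exists>m::nat. \<forall>p\<in>\<rat> \<inter> {0<..<1 / Suc m}. \<forall>q\<in>\<rat> \<inter> {0<..<1 / Suc m}.
     norm (trunc f p x - trunc f q x) \<le> 1 / Suc k)"

lemma trunc_convergent_imp_cauchy:
  assumes "((\<lambda>\<epsilon>. trunc f \<epsilon> x) \<longlongrightarrow> l) (at_right 0)"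
  shows "trunc_cauchy f x"
  unfolding trunc_cauchy_def
proof
  fix k :: nat
  have "\<forall>\<^sub>F \<epsilon> in at_right 0. dist (trunc f \<epsilon> x) l < 1 / Suc k / 2"
    by (intro tendstoD[OF assms]) simp
  then obtain b where b: "b > 0" "\<And>\<epsilon>. 0 < \<epsilon> \<Longrightarrow> \<epsilon> < b \<Longrightarrow> dist (trunc f \<epsilon> x) l < 1 / Suc k / 2"
    by (auto simp: eventually_at_right_field)
  obtain m :: nat where m: "1 / Suc m < b"
    using reals_Archimedean[OF b(1)] by (auto simp: inverse_eq_divide)
  show "\<exists>m::nat. \<forall>p\<in>\<rat> \<inter> {0<..<1 / Suc m}. \<forall>q\<in>\<rat> \<inter> {0<..<1 / Suc m}. norm (trunc f p x - trunc f q x) \<le> 1 / Suc k"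
  proof (intro exI[of _ m] ballI)
    fix p q :: real assume "p \<in> \<rat> \<inter> {0<..<1 / Suc m}" "q \<in> \<rat> \<inter> {0<..<1 / Suc m}"
    then have pq: "0 < p" "p < b" "0 < q" "q < b" using m by auto
    have "dist (trunc f p x) (trunc f q x) < 1 / Suc k"
      by (rule dist_triangle_half_l[OF b(2)[OF pq(1,2)] b(2)[OF pq(3,4)]])
    then show "norm (trunc f p x - trunc f q x) \<le> 1 / Suc k" by (simp add: dist_norm)
  qed
qed

text \<open>Truncations at irrational radii are limits of truncations at rational ones, so countably many
  truncations decide whether the principal value exists.\<close>

lemma trunc_cauchy_imp_tendsto:
  assumes f: "integrable sg f" and c: "trunc_cauchy f x"
  shows "((\<lambda>\<epsilon>. trunc f \<epsilon> x) \<longlongrightarrow> lim (\<lambda>n. trunc f (1 / Suc n) x)) (at_right 0)"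
proof -
  \<comment> \<open>The rationals approach \<epsilon> from above, the side on which the truncations
    have been shown to be continuous.\<close>
  have approx: "\<exists>p. (\<forall>n. p n \<in> \<rat> \<and> \<epsilon> < p n \<and> p n < b) \<and> p \<longlonglongrightarrow> \<epsilon>" if \<epsilon>: "\<epsilon> < b" for \<epsilon> b :: real
  proof -
    have "\<exists>p\<in>\<rat>. \<epsilon> < p \<and> p < min b (\<epsilon> + 1 / Suc n)" for n :: nat
      using \<epsilon> by (intro Rats_dense_in_real) auto
    then obtain p where p: "\<And>n. p n \<in> \<rat>" "\<And>n. \<epsilon> < p n" "\<And>n. p n < min b (\<epsilon> + 1 / Suc n)" by metis
    have "p \<longlonglongrightarrow> \<epsilon>"
    proof (rule tendsto_sandwich[of "\<lambda>_. \<epsilon>" p _ "\<lambda>n. \<epsilon> + 1 / Suc n"])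
      show "(\<lambda>n. \<epsilon> + 1 / Suc n) \<longlonglongrightarrow> \<epsilon>"
        using tendsto_add[OF tendsto_const[of \<epsilon>] LIMSEQ_inverse_real_of_nat] by (simp add: inverse_eq_divide)
    qed (use p in \<open>auto intro!: always_eventually less_imp_le\<close>)
    then show ?thesis using p by auto
  qed
  have bound: "\<exists>m::nat. \<forall>\<epsilon> \<delta>. 0 < \<epsilon> \<longrightarrow> \<epsilon> < 1 / Suc m \<longrightarrow> 0 < \<delta> \<longrightarrow> \<delta> < 1 / Suc m \<longrightarrow>
      norm (trunc f \<epsilon> x - trunc f \<delta> x) \<le> 1 / Suc k" for k :: nat
  proof -
    obtain m :: nat where m: "\<And>p q. p \<in> \<rat> \<inter> {0<..<1 / Suc m} \<Longrightarrow> q \<in> \<rat> \<inter> {0<..<1 / Suc m} \<Longrightarrow>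
        norm (trunc f p x - trunc f q x) \<le> 1 / Suc k"
      using c unfolding trunc_cauchy_def by blast
    have "norm (trunc f \<epsilon> x - trunc f \<delta> x) \<le> 1 / Suc k"
      if \<epsilon>: "0 < \<epsilon>" "\<epsilon> < 1 / Suc m" and \<delta>: "0 < \<delta>" "\<delta> < 1 / Suc m" for \<epsilon> \<delta>
    proof -
      obtain p where p: "\<And>n. p n \<in> \<rat>" "\<And>n. \<epsilon> < p n" "\<And>n. p n < 1 / Suc m" "p \<longlonglongrightarrow> \<epsilon>"
        using approx[OF \<epsilon>(2)] by blast
      obtain q where q: "\<And>n. q n \<in> \<rat>" "\<And>n. \<delta> < q n" "\<And>n. q n < 1 / Suc m" "q \<longlonglongrightarrow> \<delta>"
        using approx[OF \<delta>(2)] by blast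
      have "(\<lambda>n. norm (trunc f (p n) x - trunc f (q n) x)) \<longlonglongrightarrow> norm (trunc f \<epsilon> x - trunc f \<delta> x)"
        by (intro tendsto_intros trunc_right_continuous f \<epsilon> \<delta> p q)
      moreover have "norm (trunc f (p n) x - trunc f (q n) x) \<le> 1 / Suc k" for n
        using p(1-3)[of n] q(1-3)[of n] \<epsilon>(1) \<delta>(1) by (intro m) auto
      ultimately show ?thesis by (intro LIMSEQ_le_const2) auto
    qed
    then show ?thesis by blast
  qed
  define L where "L = lim (\<lambda>n. trunc f (1 / Suc n) x)"
  have "Cauchy (\<lambda>n. trunc f (1 / Suc n) x)"
  proof (rule metric_CauchyI)
    fix e :: real assume "e > 0"
    then obtain k :: nat where k: "1 / Suc k < e"
      using reals_Archimedean by (auto simp: inverse_eq_divide)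
    obtain m :: nat where m: "\<And>\<epsilon> \<delta>. 0 < \<epsilon> \<Longrightarrow> \<epsilon> < 1 / Suc m \<Longrightarrow> 0 < \<delta> \<Longrightarrow> \<delta> < 1 / Suc m \<Longrightarrow>
      norm (trunc f \<epsilon> x - trunc f \<delta> x) \<le> 1 / Suc k" using bound[of k] by blast
    have "dist (trunc f (1 / Suc i) x) (trunc f (1 / Suc j) x) < e" if "i > m" "j > m" for i j
    proof -
      have "norm (trunc f (1 / Suc i) x - trunc f (1 / Suc j) x) \<le> 1 / Suc k"
        using that by (intro m) (auto intro!: divide_strict_left_mono)
      then show ?thesis using k by (simp add: dist_norm)
    qed
    then show "\<exists>M. \<forall>i\<ge>M. \<forall>j\<ge>M. dist (trunc f (1 / Suc i) x) (trunc f (1 / Suc j) x) < e"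
      by (intro exI[of _ "Suc m"]) auto
  qed
  then have L: "(\<lambda>n. trunc f (1 / Suc n) x) \<longlonglongrightarrow> L"
    unfolding L_def by (simp add: Cauchy_convergent convergent_LIMSEQ_iff[symmetric])
  have "((\<lambda>\<epsilon>. trunc f \<epsilon> x) \<longlongrightarrow> L) (at_right 0)"
  proof (rule tendstoI)
    fix e :: real assume "e > 0"
    then obtain k :: nat where k: "1 / Suc k < e"
      using reals_Archimedean by (auto simp: inverse_eq_divide)
    obtain m :: nat where m: "\<And>\<epsilon> \<delta>. 0 < \<epsilon> \<Longrightarrow> \<epsilon> < 1 / Suc m \<Longrightarrow> 0 < \<delta> \<Longrightarrow> \<delta> < 1 / Suc m \<Longrightarrow>
      norm (trunc f \<epsilon> x - trunc f \<delta> x) \<le> 1 / Suc k" using bound[of k] by blast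
    show "\<forall>\<^sub>F \<epsilon> in at_right 0. dist (trunc f \<epsilon> x) L < e"
    proof (rule eventually_mono[OF eventually_at_right_real[of 0 "1 / Suc m"]])
      fix \<epsilon> assume \<epsilon>: "\<epsilon> \<in> {0<..<1 / Suc m}"
      have "(\<lambda>n. norm (trunc f \<epsilon> x - trunc f (1 / Suc n) x)) \<longlonglongrightarrow> norm (trunc f \<epsilon> x - L)"
        by (intro tendsto_intros L)
      moreover have "\<exists>N. \<forall>n\<ge>N. norm (trunc f \<epsilon> x - trunc f (1 / Suc n) x) \<le> 1 / Suc k"
        using \<epsilon> by (intro exI[of _ "Suc m"] allI impI m) (auto intro!: divide_strict_left_mono)
      ultimately have "norm (trunc f \<epsilon> x - L) \<le> 1 / Suc k" by (rule LIMSEQ_le_const2)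
      then show "dist (trunc f \<epsilon> x) L < e" using k by (simp add: dist_norm)
    qed simp
  qed
  then show ?thesis by (simp add: L_def)
qed

lemma trunc_cauchy_measurable:
  assumes f: "f \<in> borel_measurable borel"
  shows "Measurable.pred borel (trunc_cauchy f)"
proof -
  have [measurable]: "trunc f p \<in> borel_measurable borel" for p by (rule trunc_measurable[OF f])
  have c: "countable (\<rat> \<inter> {0<..<1 / Suc m} :: real set)" for m
    by (rule countable_Int1[OF countable_rat])
  show ?thesis
    unfolding trunc_cauchy_def[abs_def]
    by (intro pred_intros_countable measurable_pred_countable[OF c]) measurable
qed

lemma W_op_Lim: "W_op f x = Lim (at_right 0) (\<lambda>\<epsilon>. trunc f \<epsilon> x)"
  unfolding W_op_def trunc_def by (rule refl)

text \<open>Where the limit does not exist, \<open>Lim\<close> is one fixed value, so \<open>W_op f\<close> is Borel measurable everywhere.\<close>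

lemma Lim_junk:
  assumes "\<And>l. \<not> (g \<longlongrightarrow> l) F" shows "Lim F g = (THE l. False)"
  unfolding Topological_Spaces.Lim_def using assms by simp

lemma W_op_eq:
  assumes f: "integrable sg f"
  shows "W_op f x = (if trunc_cauchy f x then lim (\<lambda>n. trunc f (1 / Suc n) x) else (THE l. False))"
proof (cases "trunc_cauchy f x")
  case True
  then show ?thesis
    using tendsto_Lim[OF trivial_limit_at_right_real trunc_cauchy_imp_tendsto[OF f True]]
    by (simp add: W_op_Lim)
next
  case False
  then have "\<not> ((\<lambda>\<epsilon>. trunc f \<epsilon> x) \<longlongrightarrow> l) (at_right 0)" for l
    using trunc_convergent_imp_cauchy by blast
  from Lim_junk[OF this] show ?thesis using False by (simp add: W_op_Lim)
qed

text \<open>The Bochner integral of a non-measurable function is 0 by convention, and the measure is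
  Borel without completion. Agreement almost everywhere with a measurable limit would therefore not
  determine \<open>L2_norm\<close>; Borel measurability of \<open>W_op f\<close> itself is
  required.\<close>

lemma W_op_measurable:
  assumes f: "integrable sg f"
  shows "W_op f \<in> borel_measurable borel"
proof -
  have m: "f \<in> borel_measurable borel" using borel_measurable_integrable[OF f] by simp
  note [measurable] = trunc_cauchy_measurable[OF m] trunc_measurable[OF m]
  show ?thesis unfolding W_op_eq[OF f, abs_def] by measurable
qed

lemma W_op_norm:
  assumes f: "f \<in> L2 sg"
  shows "2 * L2_norm sg (W_op f) = L2_norm sg f"
    and "AE x in sg. trunc_cauchy f x"
proof -
  have fi: "integrable sg f" using f by (rule L2_imp_integrable)
  obtain g where g: "g \<in> L2 sg" "(LINT x|sg. (norm (g x))\<^sup>2) = (LINT x|sg. (norm (f x))\<^sup>2) / 4"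
    "AE x in sg. ((\<lambda>\<epsilon>. trunc f \<epsilon> x) \<longlongrightarrow> g x) (at_right 0)"
    using trunc_limit[OF f] by blast
  show "AE x in sg. trunc_cauchy f x"
    using g(3) by eventually_elim (rule trunc_convergent_imp_cauchy)
  have "AE x in sg. W_op f x = g x"
    using g(3)
  proof eventually_elim
    case (elim x)
    then show ?case
      using tendsto_Lim[OF trivial_limit_at_right_real] by (simp add: W_op_Lim)
  qed
  then have eq: "AE x in sg. (norm (W_op f x))\<^sup>2 = (norm (g x))\<^sup>2" by eventually_elim simp
  have [measurable]: "W_op f \<in> borel_measurable borel" "g \<in> borel_measurable borel"
    using W_op_measurable[OF fi] g(1) by (auto simp: L2_iff)
  have W: "(LINT x|sg. (norm (W_op f x))\<^sup>2) = (LINT x|sg. (norm (f x))\<^sup>2) / 4"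
    unfolding g(2)[symmetric] by (rule integral_cong_AE[OF _ _ eq]) measurable
  show "2 * L2_norm sg (W_op f) = L2_norm sg f"
    unfolding L2_norm_def W real_sqrt_divide by simp
qed

section \<open>The Riesz transform through spinors\<close>

definition spin_up :: spinor where "spin_up = axis 1 1"

lemma norm_spin_up [simp]: "norm spin_up = 1"
  by (simp add: spin_up_def norm_axis_1)

text \<open>The vectors \<open>clif (axis j 1) spin_up\<close> are orthonormal for the real inner
  product, so the coordinates of a along them are recovered from \<open>clif a spin_up\<close>. This
  is a left inverse only: spinors have real dimension 4, vectors 3.\<close>

definition unclif :: "spinor \<Rightarrow> real^3" where
  "unclif v = (\<chi> j. v \<bullet> clif (axis j 1) spin_up)"

lemma clif_inner_clif: "clif a v \<bullet> clif b v = (a \<bullet> b) * (v \<bullet> v)"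
proof -
  have "v \<bullet> clif (cross3 a b) v = - (v \<bullet> clif (cross3 a b) v)"
    by (metis clif_skew inner_commute)
  then have "v \<bullet> clif (cross3 a b) v = 0" by simp
  then show ?thesis
    unfolding clif_skew[of a v] clif_clif by (simp add: inner_diff_right)
qed

lemma unclif_clif: "unclif (clif a spin_up) = a"
proof -
  have "spin_up \<bullet> spin_up = 1" by (metis norm_eq_1 norm_spin_up)
  then show ?thesis by (simp add: unclif_def vec_eq_iff clif_inner_clif inner_axis)
qed

lemma bounded_linear_unclif: "bounded_linear unclif"
  unfolding linear_conv_bounded_linear[symmetric]
  by (rule linearI) (simp_all add: unclif_def vec_eq_iff inner_add_left)

text \<open>Since \<open>unclif\<close> is not injective, the first formula alone could neither
  carry convergence from R back to the spinor side nor preserve norms. The second one states that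
  the spinor truncation lies in the range of a \<mapsto> \<open>clif a spin_up\<close>.\<close>

lemma riesz_trunc:
  fixes x :: "real^3"
  assumes h: "integrable sg h" and \<epsilon>: "\<epsilon> > 0"
  defines "R \<equiv> LINT y:{y. \<epsilon> < norm (x - y)}|sg. h y *\<^sub>R (inverse (norm (x - y) ^ 3) *\<^sub>R (x - y))"
  shows "R = (4 * pi) *\<^sub>R unclif (trunc (\<lambda>y. h y *\<^sub>R spin_up) \<epsilon> x)"
    and "trunc (\<lambda>y. h y *\<^sub>R spin_up) \<epsilon> x = (1 / (4 * pi)) *\<^sub>R clif R spin_up"
proof -
  have hs: "integrable sg (\<lambda>y. h y *\<^sub>R spin_up)" using h by simp
  have bl: "bounded_linear (\<lambda>v. (4 * pi) *\<^sub>R unclif v)"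
    by (intro bounded_linear_const_scaleR bounded_linear_unclif)
  have lin: "linear unclif" by (rule bounded_linear.linear[OF bounded_linear_unclif])
  have pt: "(4 * pi) *\<^sub>R unclif (indicator {y. \<epsilon> < norm (x - y)} y *\<^sub>R (w_kernel (x - y) *v (h y *\<^sub>R spin_up)))
      = indicator {y. \<epsilon> < norm (x - y)} y *\<^sub>R (h y *\<^sub>R (inverse (norm (x - y) ^ 3) *\<^sub>R (x - y)))" for y
  proof -
    have "(4 * pi) * (i * (inverse (4 * pi * n) * k)) = i * (k * inverse n)" for i n k :: real by simp
    then show ?thesis
      unfolding w_kernel_mult clif.scaleR_right linear_scale[OF lin] unclif_clif scaleR_scaleR by (simp only:)
  qed
  show R: "R = (4 * pi) *\<^sub>R unclif (trunc (\<lambda>y. h y *\<^sub>R spin_up) \<epsilon> x)"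
    unfolding R_def trunc_def set_lebesgue_integral_def pt[symmetric]
    by (rule integral_bounded_linear[OF bl w_kernel_integrable[OF \<epsilon> hs]])
  have intR: "integrable sg (\<lambda>y. indicator {y. \<epsilon> < norm (x - y)} y *\<^sub>R (h y *\<^sub>R (inverse (norm (x - y) ^ 3) *\<^sub>R (x - y))))"
    using integrable_bounded_linear[OF bl w_kernel_integrable[OF \<epsilon> hs, of x]] unfolding pt .
  have bl2: "bounded_linear (\<lambda>v. (1 / (4 * pi)) *\<^sub>R clif v spin_up)"
    by (intro bounded_linear_const_scaleR clif.bounded_linear_left)
  have pt2: "(1 / (4 * pi)) *\<^sub>R clif (indicator {y. \<epsilon> < norm (x - y)} y *\<^sub>R (h y *\<^sub>R (inverse (norm (x - y) ^ 3) *\<^sub>R (x - y)))) spin_up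
    = indicator {y. \<epsilon> < norm (x - y)} y *\<^sub>R (w_kernel (x - y) *v (h y *\<^sub>R spin_up))" for y
  proof -
    have "(1 / (4 * pi)) * (i * (k * inverse n)) = i * (inverse (4 * pi * n) * k)" for i n k :: real
      unfolding inverse_eq_divide[of "4 * pi", symmetric] inverse_mult_distrib by (simp only: mult_ac)
    then show ?thesis
      unfolding w_kernel_mult clif.scaleR_right clif.scaleR_left scaleR_scaleR by (simp only:)
  qed
  show "trunc (\<lambda>y. h y *\<^sub>R spin_up) \<epsilon> x = (1 / (4 * pi)) *\<^sub>R clif R spin_up"
    unfolding R_def trunc_def set_lebesgue_integral_def pt2[symmetric]
    by (rule integral_bounded_linear[OF bl2 intR])
qed

text \<open>The two formulas for truncations make the scalar and the spinor principal value exist at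
  the same points. Elsewhere both are fixed default values, which yields a Borel formula valid at
  every point.\<close>

lemma riesz_transform_eq:
  assumes h: "integrable sg h"
  defines "f \<equiv> \<lambda>y. h y *\<^sub>R spin_up"
  shows "riesz_transform h x = (if trunc_cauchy f x then (4 * pi) *\<^sub>R unclif (W_op f x) else (THE l. False))"
    and "trunc_cauchy f x \<Longrightarrow> norm (riesz_transform h x) = 4 * pi * norm (W_op f x)"
proof -
  have fi: "integrable sg f" using h by (simp add: f_def)
  define R where "R \<epsilon> = (LINT y:{y. \<epsilon> < norm (x - y)}|sg. h y *\<^sub>R (inverse (norm (x - y) ^ 3) *\<^sub>R (x - y)))" for \<epsilon>
  have RT: "R \<epsilon> = (4 * pi) *\<^sub>R unclif (trunc f \<epsilon> x)" "trunc f \<epsilon> x = (1 / (4 * pi)) *\<^sub>R clif (R \<epsilon>) spin_up" if "\<epsilon> > 0" for \<epsilon>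
    using riesz_trunc[OF h that, of x] by (simp_all add: R_def f_def)
  have pos: "\<forall>\<^sub>F \<epsilon> in at_right (0::real). 0 < \<epsilon>" by (rule eventually_at_right_less)
  have fwd: "(R \<longlongrightarrow> (4 * pi) *\<^sub>R unclif l) (at_right 0)" if "((\<lambda>\<epsilon>. trunc f \<epsilon> x) \<longlongrightarrow> l) (at_right 0)" for l
  proof (rule Lim_transform_eventually)
    show "((\<lambda>\<epsilon>. (4 * pi) *\<^sub>R unclif (trunc f \<epsilon> x)) \<longlongrightarrow> (4 * pi) *\<^sub>R unclif l) (at_right 0)"
      by (intro tendsto_intros bounded_linear.tendsto[OF bounded_linear_unclif] that)
    show "\<forall>\<^sub>F \<epsilon> in at_right 0. (4 * pi) *\<^sub>R unclif (trunc f \<epsilon> x) = R \<epsilon>"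
      using pos by eventually_elim (rule RT(1)[symmetric])
  qed
  have bwd: "((\<lambda>\<epsilon>. trunc f \<epsilon> x) \<longlongrightarrow> (1 / (4 * pi)) *\<^sub>R clif l spin_up) (at_right 0)" if "(R \<longlongrightarrow> l) (at_right 0)" for l
  proof (rule Lim_transform_eventually)
    show "((\<lambda>\<epsilon>. (1 / (4 * pi)) *\<^sub>R clif (R \<epsilon>) spin_up) \<longlongrightarrow> (1 / (4 * pi)) *\<^sub>R clif l spin_up) (at_right 0)"
      by (intro tendsto_scaleR tendsto_const bounded_linear.tendsto[OF clif.bounded_linear_left] that)
    show "\<forall>\<^sub>F \<epsilon> in at_right 0. (1 / (4 * pi)) *\<^sub>R clif (R \<epsilon>) spin_up = trunc f \<epsilon> x"
      using pos by eventually_elim (rule RT(2)[symmetric])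
  qed
  have rL: "riesz_transform h x = Lim (at_right 0) R"
    unfolding riesz_transform_def R_def[symmetric] by (rule refl)
  have lim: "riesz_transform h x = l" if "(R \<longlongrightarrow> l) (at_right 0)" for l
    using tendsto_Lim[OF trivial_limit_at_right_real that] by (simp add: rL)
  have limW: "W_op f x = l" if "((\<lambda>\<epsilon>. trunc f \<epsilon> x) \<longlongrightarrow> l) (at_right 0)" for l
    using tendsto_Lim[OF trivial_limit_at_right_real that] by (simp add: W_op_Lim)
  show 1: "riesz_transform h x = (if trunc_cauchy f x then (4 * pi) *\<^sub>R unclif (W_op f x) else (THE l. False))"
  proof (cases "trunc_cauchy f x")
    case True
    note T = trunc_cauchy_imp_tendsto[OF fi True]
    show ?thesis using lim[OF fwd[OF T]] limW[OF T] True by simp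
  next
    case False
    then have "\<not> (R \<longlongrightarrow> l) (at_right 0)" for l
      using trunc_convergent_imp_cauchy bwd by blast
    from Lim_junk[OF this] show ?thesis using False by (simp add: rL)
  qed
  show "norm (riesz_transform h x) = 4 * pi * norm (W_op f x)" if c: "trunc_cauchy f x"
  proof -
    note T = trunc_cauchy_imp_tendsto[OF fi c]
    have "W_op f x = (1 / (4 * pi)) *\<^sub>R clif (riesz_transform h x) spin_up"
      using limW[OF bwd[OF fwd[OF T]]] lim[OF fwd[OF T]] by simp
    then show ?thesis by (simp add: norm_clif)
  qed
qed

text \<open>The constant is 4 * pi, from the normalisation of \<open>w_kernel\<close>, times the
  factor 1 / 2 by which \<open>W_op\<close> scales norms.\<close>

lemma riesz_transform_norm:
  fixes h :: "real^3 \<Rightarrow> real"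
  assumes h: "h \<in> L2 sg"
  shows "L2_norm sg (riesz_transform h) = 2 * pi * L2_norm sg h"
proof -
  define f where "f y = h y *\<^sub>R spin_up" for y
  have hi: "integrable sg h" using h by (rule L2_imp_integrable)
  have fi: "integrable sg f" using hi by (simp add: f_def[abs_def])
  have [measurable]: "f \<in> borel_measurable borel" using borel_measurable_integrable[OF fi] by simp
  have nf: "norm (f y) = norm (h y)" for y by (simp add: f_def)
  have f: "f \<in> L2 sg"
    using h unfolding L2_iff nf by (intro conjI) (simp, blast)
  note eq = riesz_transform_eq[OF hi, folded f_def[abs_def]]
  note [measurable] = trunc_cauchy_measurable[of f] W_op_measurable[OF fi]
  have [measurable]: "unclif \<in> borel_measurable borel"
    by (intro borel_measurable_continuous_onI linear_continuous_on bounded_linear_unclif)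
  have [measurable]: "riesz_transform h \<in> borel_measurable borel"
    unfolding eq(1)[abs_def] by measurable
  have ae: "AE x in sg. (norm (riesz_transform h x))\<^sup>2 = (4 * pi)\<^sup>2 * (norm (W_op f x))\<^sup>2"
    using W_op_norm(2)[OF f] by eventually_elim (simp add: eq(2) power_mult_distrib)
  have "(LINT x|sg. (norm (riesz_transform h x))\<^sup>2) = (LINT x|sg. (4 * pi)\<^sup>2 * (norm (W_op f x))\<^sup>2)"
    by (rule integral_cong_AE[OF _ _ ae]) measurable
  then have "L2_norm sg (riesz_transform h) = 2 * pi * (2 * L2_norm sg (W_op f))"
    by (simp add: L2_norm_def real_sqrt_mult)
  also have "\<dots> = 2 * pi * L2_norm sg h"
    by (subst W_op_norm(1)[OF f]) (simp only: L2_norm_def nf)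
  finally show ?thesis .
qed

lemma L2_norm_const: "(\<lambda>_. v) \<in> L2 sg" "L2_norm sg (\<lambda>_. v) = sqrt (4 * pi) * norm v"
  by (simp_all add: L2_iff L2_norm_def measure_sphere_UNIV real_sqrt_mult)

theorem corollary4p5:
  shows "(\<forall>f :: real^3 \<Rightarrow> complex^2. f \<in> L2 sphere_measure \<longrightarrow>
            L2_norm sphere_measure f \<le> 2 * L2_norm sphere_measure (W_op f))
       \<and> (\<forall>C :: real. (\<forall>f :: real^3 \<Rightarrow> complex^2. f \<in> L2 sphere_measure \<longrightarrow>
            L2_norm sphere_measure f \<le> C * L2_norm sphere_measure (W_op f)) \<longrightarrow> 2 \<le> C)
       \<and> (\<forall>h :: real^3 \<Rightarrow> real. h \<in> L2 sphere_measure \<longrightarrow>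
            2 * pi * L2_norm sphere_measure h \<le> L2_norm sphere_measure (riesz_transform h))
       \<and> (\<forall>c :: real. (\<forall>h :: real^3 \<Rightarrow> real. h \<in> L2 sphere_measure \<longrightarrow>
            c * L2_norm sphere_measure h \<le> L2_norm sphere_measure (riesz_transform h)) \<longrightarrow> c \<le> 2 * pi)"
proof (intro conjI allI impI)
  fix C :: real
  assume C: "\<forall>f :: real^3 \<Rightarrow> complex^2. f \<in> L2 sg \<longrightarrow> L2_norm sg f \<le> C * L2_norm sg (W_op f)"
  \<comment> \<open>The estimate is an equality, so any function of positive norm shows sharpness;
    constants have norm \<open>sqrt (4 * pi)\<close> times their length.\<close>
  let ?f = "\<lambda>_::real^3. spin_up"
  have W: "L2_norm sg (W_op ?f) = L2_norm sg ?f / 2"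
    using W_op_norm(1)[OF L2_norm_const(1), of spin_up] by simp
  have "L2_norm sg ?f \<le> C * L2_norm sg (W_op ?f)" using C L2_norm_const(1) by blast
  then have "L2_norm sg ?f * 2 \<le> L2_norm sg ?f * C" unfolding W by (simp add: field_simps)
  moreover have "L2_norm sg ?f > 0" by (simp add: L2_norm_const)
  ultimately show "2 \<le> C" by simp
next
  fix c :: real
  assume c: "\<forall>h :: real^3 \<Rightarrow> real. h \<in> L2 sg \<longrightarrow> c * L2_norm sg h \<le> L2_norm sg (riesz_transform h)"
  let ?h = "\<lambda>_::real^3. 1 :: real"
  have "c * L2_norm sg ?h \<le> 2 * pi * L2_norm sg ?h"
    using c L2_norm_const(1)[of "1::real"] riesz_transform_norm[of ?h] by metis
  moreover have "L2_norm sg ?h > 0" by (simp add: L2_norm_const)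
  ultimately show "c \<le> 2 * pi" by simp
qed (simp_all add: W_op_norm(1) riesz_transform_norm)

end
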